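(* Let $n\ge1$ and let $a_{2n}(t)$ denote the coefficient $a_{2n}$ of the heat kernel expansion of $D^2$ for the Robertson-Walker metric with scale factor $a(t)$, computed without performing the time integration. Then $a_{2n}(t)$ is a period integral $$a_{2n}(t)=C\cdot\int_{A_{2n+2}}\Omega^\alpha_{\alpha_1,\dots,\alpha_{2n}}\Big|_{\alpha=a(t),\,\alpha_i=a^{(i)}(t)},$$ with $C$ a constant, of an algebraic differential form $\Omega^\alpha_{\alpha_1,\dots,\alpha_{2n}}(u_0,u_1,\dots,u_{2n+2})$ (depending on the parameters $\alpha\ne0$ and $\alpha_1,\dots,\alpha_{2n}$) defined on the complement $$\mathbb A^{2n+3}\smallsetminus(\widehat{CZ}_{\alpha,2n}\cup H_0\cup H_1),$$ where $\widehat{CZ}_{\alpha,2n}$ is the hypersurface defined by the vanishing of $$Q_{\alpha,2n}=u_1^2+\frac1{\alpha^2}(u_2^2+u_3^2+u_4^2)+u_5^2+\cdots+u_{2n+2}^2,$$ and $H_0=\{u_0=0\}$, $H_1=\{u_0=1\}$. The integral is performed over the $\mathbb Q$-semialgebraic set $$A_{2n+2}=\Big\{(u_0,\dots,u_{2n+2})\in\mathbb A^{2n+3}(\mathbb R): u_1^2+u_2^2+u_0u_3^2+(1-u_0)u_4^2+\sum_{i=5}^{2n+2}u_i^2=1,\ 0<u_i<1\text{ for }i=0,1,2,5,6,\dots,2n+2\Big\}.$$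
   Context: Setting. Let $a(t)>0$ be a smooth function and consider the (Euclidean) Robertson-Walker metric $ds^2=dt^2+a(t)^2d\sigma^2$, with $d\sigma^2$ the round metric on $\mathbb S^3$, in Hopf coordinates $x=(x_1,x_2,x_3,x_4)=(t,\eta,\phi_1,\phi_2)$, $0<\eta<\pi/2$, $0<\phi_1,\phi_2<2\pi$: $ds^2=dt^2+a(t)^2(d\eta^2+\sin^2\eta\,d\phi_1^2+\cos^2\eta\,d\phi_2^2)$. In a local trivialization of the spinor bundle the Dirac operator $D$ has symbol $q_1+q_0$, with $q_1=\begin{pmatrix}0&A_1\\ B_1&0\end{pmatrix}$, $q_0=\begin{pmatrix}0&A_0\\ B_0&0\end{pmatrix}$ in $2\times2$ blocks, where (with $a=a(t)$) $$A_1=\begin{pmatrix}\frac{i\sec\eta\,\xi_4}{a}-\xi_1&\frac{i\xi_2+\csc\eta\,\xi_3}{a}\\ \frac{i\xi_2-\csc\eta\,\xi_3}{a}&-\xi_1-\frac{i\sec\eta\,\xi_4}{a}\end{pmatrix},\quad B_1=\begin{pmatrix}-\xi_1-\frac{i\sec\eta\,\xi_4}{a}&\frac{-i\xi_2-\csc\eta\,\xi_3}{a}\\ \frac{\csc\eta\,\xi_3-i\xi_2}{a}&\frac{i\sec\eta\,\xi_4}{a}-\xi_1\end{pmatrix},$$ $$A_0=\begin{pmatrix}\frac{3ia'}{2a}&\frac{\cot\eta-\tan\eta}{2a}\\ \frac{\cot\eta-\tan\eta}{2a}&\frac{3ia'}{2a}\end{pmatrix},\quad B_0=\begin{pmatrix}\frac{3ia'}{2a}&\frac{\tan\eta-\cot\eta}{2a}\\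 \frac{\tan\eta-\cot\eta}{2a}&\frac{3ia'}{2a}\end{pmatrix}.$$ The symbol of $D^2$ is $p_2+p_1+p_0$ with $p_2=q_1^2=\big(\xi_1^2+\frac{\xi_2^2+\csc^2\eta\,\xi_3^2+\sec^2\eta\,\xi_4^2}{a^2}\big)I_4$, $p_1=q_0q_1+q_1q_0-i\sum_j\partial_{\xi_j}q_1\,\partial_{x_j}q_1$, $p_0=q_0^2-i\sum_j\partial_{\xi_j}q_1\,\partial_{x_j}q_0$. Parametrix. Let $\Delta_{2n}=D^2\otimes1+1\otimes\Delta_{\mathbb T^{2n-2}}$, with $\Delta_{\mathbb T^{2n-2}}$ the flat Laplacian on $\mathbb T^{2n-2}=(\mathbb R/\mathbb Z)^{2n-2}$ (symbol $\xi_5^2+\cdots+\xi_{2n+2}^2$, absent for $n=1$). The homogeneous terms of the symbol of the parametrix $\Delta_{2n}^{-1}$ are $\sigma_{-2}=(p_2+(\xi_5^2+\cdots+\xi_{2n+2}^2)I_4)^{-1}$ and, for $N>0$, $\sigma_{-2-N}=-\big(\sum\frac{(-i)^{|\beta|}}{\beta!}(\partial_\xi^\beta\sigma_{-2-j})(\partial_x^\beta p_k)\big)\sigma_{-2}$, the sum being over $0\le j<N$, $0\le k\le2$, $\beta\in\mathbb Z_{\ge0}^4$ (derivatives in $\xi_1,\dots,\xi_4$ and $x_1,\dots,x_4$) with $-2-j-|\beta|+k=-N$. The term $a_{2n}$. In the expansion $\mathrm{Tr}(e^{-sD^2})\sim_{s\to0^+}\sum_{m\ge0}a_{2m}s^{m-2}$,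 one has $a_{2n}=\frac1{2^5\pi^{3+n}}\mathrm{Res}(\Delta_{2n}^{-1})$ (Wodzicki residue). "Without performing the time integration" means the function $$a_{2n}(t)=\frac1{2^5\pi^{3+n}}\int_0^{\pi/2}d\eta\int_0^{2\pi}d\phi_1\int_0^{2\pi}d\phi_2\int_{\mathbb T^{2n-2}}dx'\int_{|\xi|=1}\mathrm{tr}(\sigma_{-2n-2})\,\sigma_{\xi,2n+1},$$ where $|\xi|=1$ is the unit sphere in $\mathbb R^{2n+2}$ and $\sigma_{\xi,2n+1}=\sum_{j=1}^{2n+2}(-1)^{j-1}\xi_j\,d\xi_1\wedge\cdots\wedge\widehat{d\xi_j}\wedge\cdots\wedge d\xi_{2n+2}$. The variables $u$ are related to $(\eta,\xi)$ by $u_0=\sin^2\eta$, $u_3=\csc(\eta)\xi_3$, $u_4=\sec(\eta)\xi_4$, $u_j=\xi_j$ otherwise. Integrals over $A_{2n+2}$ are taken first over the slices with $u_0$ fixed, then over $u_0$, with $A_{2n+2}$ oriented as the image of the corresponding part of $(0,\pi/2)\times\mathbb S^{2n+1}$. A $\mathbb Q$-semialgebraic set is a subset of some $\mathbb R^N$ obtained from sets $\{P\ge0\}$, $P\in\mathbb Q[x_1,\dots,x_N]$, by finitely many complements, intersections and unions. "Algebraic differential form" means a rational differential form in $u_0,\dots,u_{2n+2}$, with coefficients rational functions over $\mathbb Q$ of $u_0,\dots,u_{2n+2},\alpha,\alpha_1,\dots,\alpha_{2n}$, regular on the indicated complement; a "period integral" is the integral of such a form over a $\mathbb Q$-semialgebraic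 set. *)

theory Defs
  imports
    "HOL-Analysis.Analysis"
    "HOL-Combinatorics.Permutations"
    "HOL-Library.Poly_Mapping"
begin

section \<open>Coordinates, partial derivatives and integrals of differential forms\<close>

text \<open>
  Points of all coordinate spaces are functions \<open>nat \<Rightarrow> _\<close>, indexed exactly as in
  \<open>x\<^sub>1, x\<^sub>2, \<dots>\<close>, \<open>\<xi>\<^sub>1, \<xi>\<^sub>2, \<dots>\<close> and \<open>u\<^sub>0, u\<^sub>1, \<dots>\<close>; only the coordinates in
  the relevant finite index set matter.
\<close>

definition partial_deriv ::
    "nat \<Rightarrow> ((nat \<Rightarrow> real) \<Rightarrow> 'b::real_normed_vector) \<Rightarrow> (nat \<Rightarrow> real) \<Rightarrow> 'b" where
  "partial_deriv i f x = vector_derivative (\<lambda>s. f (x(i := s))) (at (x i))"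

text \<open>
  A differential form of degree \<open>k\<close> in coordinates indexed by \<open>K\<close> is given by its coefficients:
  \<open>\<omega> I\<close> is the coefficient of \<open>dx\<^sub>I\<close>, for \<open>I \<subseteq> K\<close> with \<open>card I = k\<close>, where \<open>dx\<^sub>I\<close> is
  the wedge product of the \<open>dx\<^sub>i\<close>, \<open>i \<in> I\<close>, in increasing order of \<open>i\<close>.
\<close>

type_synonym 'b form = "nat set \<Rightarrow> (nat \<Rightarrow> real) \<Rightarrow> 'b"

text \<open>
  The Jacobian minor: the coefficient of \<open>dy\<^sub>J\<close> in \<open>\<phi>\<^sup>* dx\<^sub>I\<close> (where \<open>card I = card J\<close>).
\<close>

definition jacobian_minor ::
    "nat set \<Rightarrow> nat set \<Rightarrow> ((nat \<Rightarrow> real) \<Rightarrow> nat \<Rightarrow> real) \<Rightarrow> (nat \<Rightarrow> real) \<Rightarrow> real" where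
  "jacobian_minor I J \<phi> y =
     (\<Sum>p | p permutes {..<card J}. of_int (sign p) *
        (\<Prod>r<card J. partial_deriv (sorted_list_of_set J ! p r)
                       (\<lambda>z. \<phi> z (sorted_list_of_set I ! r)) y))"

text \<open>
  The coefficient of the top form \<open>dy\<^sub>J\<close> in the pullback along \<open>\<phi>\<close> (from coordinates \<open>J\<close> to
  coordinates \<open>K\<close>) of a form of degree \<open>card J\<close>.
\<close>

definition pullback_coeff ::
    "nat set \<Rightarrow> nat set \<Rightarrow> ((nat \<Rightarrow> real) \<Rightarrow> nat \<Rightarrow> real) \<Rightarrow> 'b::real_normed_vector form
      \<Rightarrow> (nat \<Rightarrow> real) \<Rightarrow> 'b" where
  "pullback_coeff K J \<phi> \<omega> y =
     (\<Sum>I | I \<subseteq> K \<and> card I = card J. jacobian_minor I J \<phi> y *\<^sub>R \<omega> I (\<phi> y))"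

text \<open>
  The unit sphere in \<open>\<real>\<^sup>m\<close> (coordinates \<open>1, \<dots>, m\<close>), oriented as the boundary of the ball.
  Up to a null set it is covered by the graphs \<open>\<xi>\<^sub>1 = s \<surd>(1 - \<xi>\<^sub>2\<^sup>2 - \<dots> - \<xi>\<^sub>m\<^sup>2)\<close>, \<open>s = 1, -1\<close>,
  and the chart \<open>(\<xi>\<^sub>2, \<dots>, \<xi>\<^sub>m)\<close> is positively oriented for \<open>s = 1\<close> and negatively for \<open>s = -1\<close>.
\<close>

definition hemisphere :: "nat \<Rightarrow> real \<Rightarrow> (nat \<Rightarrow> real) \<Rightarrow> nat \<Rightarrow> real" where
  "hemisphere m s y = y(1 := s * sqrt (1 - (\<Sum>i=2..m. (y i)\<^sup>2)))"

definition sphere_integral :: "nat \<Rightarrow> 'b::{banach, second_countable_topology} form \<Rightarrow> 'b" where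
  "sphere_integral m \<omega> =
     (\<Sum>s\<in>{1, -1}. s *\<^sub>R
        (LINT y : {y. (\<Sum>i=2..m. (y i)\<^sup>2) < 1} | PiM {2..m} (\<lambda>_. lborel).
           pullback_coeff {1..m} {2..m} (hemisphere m s) \<omega> y))"

text \<open>\<open>\<sigma>\<^bsub>\<xi>,m-1\<^esub> = \<Sum>\<^sub>j (-1)\<^sup>j\<^sup>-\<^sup>1 \<xi>\<^sub>j d\<xi>\<^sub>1 \<and> \<dots> (omit d\<xi>\<^sub>j) \<dots> \<and> d\<xi>\<^sub>m\<close>\<close>

definition sphere_form :: "nat \<Rightarrow> real form" where
  "sphere_form m I \<xi> = (\<Sum>j=1..m. if I = {1..m} - {j} then (-1) ^ (j - 1) * \<xi> j else 0)"


section \<open>The symbol of the Dirac operator and of the parametrix\<close>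

type_synonym symbol = "(nat \<Rightarrow> real) \<Rightarrow> (nat \<Rightarrow> real) \<Rightarrow> complex^4^4"

text \<open>The \<open>4 \<times> 4\<close> matrix with \<open>2 \<times> 2\<close> blocks \<open>0, A\<close> in the first and \<open>B, 0\<close> in the second row.\<close>

definition offdiag :: "complex^2^2 \<Rightarrow> complex^2^2 \<Rightarrow> complex^4^4" where
  "offdiag A B = vector
     [vector [0, 0, A$1$1, A$1$2],
      vector [0, 0, A$2$1, A$2$2],
      vector [B$1$1, B$1$2, 0, 0],
      vector [B$2$1, B$2$2, 0, 0]]"

definition mat2 :: "complex \<Rightarrow> complex \<Rightarrow> complex \<Rightarrow> complex \<Rightarrow> complex^2^2" where
  "mat2 a b c d = vector [vector [a, b], vector [c, d]]"

definition dirac_q1 :: "(real \<Rightarrow> real) \<Rightarrow> symbol" where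
  "dirac_q1 a x \<xi> =
    (let X1 = complex_of_real (\<xi> 1);
         X2 = complex_of_real (\<xi> 2 / a (x 1));
         X3 = complex_of_real (\<xi> 3 / (sin (x 2) * a (x 1)));
         X4 = complex_of_real (\<xi> 4 / (cos (x 2) * a (x 1)))
     in offdiag
       (mat2 (\<i> * X4 - X1)   (\<i> * X2 + X3)
             (\<i> * X2 - X3)   (- X1 - \<i> * X4))
       (mat2 (- X1 - \<i> * X4) (- \<i> * X2 - X3)
             (X3 - \<i> * X2)   (\<i> * X4 - X1)))"

definition dirac_q0 :: "(real \<Rightarrow> real) \<Rightarrow> symbol" where
  "dirac_q0 a x \<xi> =
    (let d = \<i> * complex_of_real (3 * deriv a (x 1) / (2 * a (x 1)));
         e = complex_of_real ((cot (x 2) - tan (x 2)) / (2 * a (x 1)))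
     in offdiag (mat2 d e e d) (mat2 d (- e) (- e) d))"

definition x_deriv :: "nat \<Rightarrow> symbol \<Rightarrow> symbol" where
  "x_deriv j q = (\<lambda>x \<xi>. partial_deriv j (\<lambda>z. q z \<xi>) x)"

definition xi_deriv :: "nat \<Rightarrow> symbol \<Rightarrow> symbol" where
  "xi_deriv j q = (\<lambda>x \<xi>. partial_deriv j (q x) \<xi>)"

text \<open>\<open>dirac_sq a k\<close> is the term \<open>p\<^sub>k\<close> of order \<open>k\<close> of the symbol of \<open>D\<^sup>2\<close>; \<open>mat c\<close> is the
  scalar matrix \<open>c I\<^sub>4\<close>.\<close>

definition dirac_sq :: "(real \<Rightarrow> real) \<Rightarrow> nat \<Rightarrow> symbol" where
  "dirac_sq a k x \<xi> =
    (let q1 = dirac_q1 a; q0 = dirac_q0 a in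
     if k = 2 then q1 x \<xi> ** q1 x \<xi>
     else if k = 1 then
       q0 x \<xi> ** q1 x \<xi> + q1 x \<xi> ** q0 x \<xi>
         - mat \<i> ** (\<Sum>j=1..4. xi_deriv j q1 x \<xi> ** x_deriv j q1 x \<xi>)
     else if k = 0 then
       q0 x \<xi> ** q0 x \<xi> - mat \<i> ** (\<Sum>j=1..4. xi_deriv j q1 x \<xi> ** x_deriv j q0 x \<xi>)
     else 0)"

lemma vector_4_nth: fixes w x y z :: "'a::zero" shows
 "(vector [w,x,y,z] :: 'a^4)$1 = w" "(vector [w,x,y,z] :: 'a^4)$2 = x"
 "(vector [w,x,y,z] :: 'a^4)$3 = y" "(vector [w,x,y,z] :: 'a^4)$4 = z"
 by (simp_all add: vector_def)
lemma dirac_sq_2: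
  assumes "sin (x 2) \<noteq> 0" "cos (x 2) \<noteq> 0" "a (x 1) \<noteq> 0"
  shows "dirac_sq a 2 x \<xi> =
    mat (complex_of_real ((\<xi> 1)\<^sup>2 + ((\<xi> 2)\<^sup>2 + (\<xi> 3 / sin (x 2))\<^sup>2 + (\<xi> 4 / cos (x 2))\<^sup>2) / (a (x 1))\<^sup>2))"
proof -
  have "complex_of_real ((\<xi> 1)\<^sup>2 + ((\<xi> 2)\<^sup>2 + (\<xi> 3 / sin (x 2))\<^sup>2 + (\<xi> 4 / cos (x 2))\<^sup>2) / (a (x 1))\<^sup>2)
    = (of_real (\<xi> 1))\<^sup>2 + (of_real (\<xi> 2 / a (x 1)))\<^sup>2 + (of_real (\<xi> 3 / (sin (x 2) * a (x 1))))\<^sup>2 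
      + (of_real (\<xi> 4 / (cos (x 2) * a (x 1))))\<^sup>2"
    by (simp add: power_divide power_mult_distrib add_divide_distrib)
  then show ?thesis
  unfolding dirac_sq_def Let_def dirac_q1_def offdiag_def mat2_def
  apply (simp add: vec_eq_iff forall_4 matrix_matrix_mult_def mat_def sum_4 vector_4_nth del: of_real_divide of_real_mult of_real_add of_real_power)
  apply (simp add: algebra_simps power2_eq_square del: of_real_divide of_real_mult of_real_add of_real_power)
  done
qed

definition multi_x_deriv :: "(nat \<Rightarrow> nat) \<Rightarrow> symbol \<Rightarrow> symbol" where
  "multi_x_deriv \<beta> q =
     (x_deriv 1 ^^ \<beta> 1) ((x_deriv 2 ^^ \<beta> 2) ((x_deriv 3 ^^ \<beta> 3) ((x_deriv 4 ^^ \<beta> 4) q)))"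

definition multi_xi_deriv :: "(nat \<Rightarrow> nat) \<Rightarrow> symbol \<Rightarrow> symbol" where
  "multi_xi_deriv \<beta> q =
     (xi_deriv 1 ^^ \<beta> 1) ((xi_deriv 2 ^^ \<beta> 2) ((xi_deriv 3 ^^ \<beta> 3) ((xi_deriv 4 ^^ \<beta> 4) q)))"

definition param_leading :: "(real \<Rightarrow> real) \<Rightarrow> nat \<Rightarrow> symbol" where
  "param_leading a n x \<xi> =
     matrix_inv (dirac_sq a 2 x \<xi> + mat (complex_of_real (\<Sum>i=5..2*n+2. (\<xi> i)\<^sup>2)))"

text \<open>
  \<open>parametrix a n N\<close> is \<open>\<sigma>\<^bsub>-2-N\<^esub>\<close>. The condition on \<open>\<beta>\<close> is \<open>-2 - j - |\<beta>| + k = -N\<close> without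
  subtraction; for given \<open>j\<close> and \<open>k\<close> it is satisfied by finitely many \<open>\<beta>\<close>.
\<close>

fun parametrix :: "(real \<Rightarrow> real) \<Rightarrow> nat \<Rightarrow> nat \<Rightarrow> symbol" where
  "parametrix a n N =
    (if N = 0 then param_leading a n
     else (\<lambda>x \<xi>.
       - (\<Sum>j<N. \<Sum>k\<le>2. \<Sum>\<beta> | \<beta> \<in> {1..4} \<rightarrow>\<^sub>E UNIV \<and> 2 + j + (\<Sum>i=1..4. \<beta> i) = N + k.
            mat ((- \<i>) ^ (\<Sum>i=1..4. \<beta> i) / of_nat (\<Prod>i=1..4. fact (\<beta> i))) **
            (multi_xi_deriv \<beta> (parametrix a n j) x \<xi> ** multi_x_deriv \<beta> (dirac_sq a k) x \<xi>))
       ** param_leading a n x \<xi>))"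

declare parametrix.simps [simp del]


section \<open>The coefficient \<open>a\<^sub>2\<^sub>n(t)\<close>\<close>

text \<open>
  The integrand of the \<open>\<eta>\<close>-integral defining \<open>a\<^sub>2\<^sub>n(t)\<close>. The torus \<open>(\<real>/\<int>)\<^sup>2\<^sup>n\<^sup>-\<^sup>2\<close> is replaced by its
  fundamental domain, a product of unit intervals (for \<open>n = 1\<close>, a single point of measure 1).
\<close>

definition eta_density :: "(real \<Rightarrow> real) \<Rightarrow> nat \<Rightarrow> real \<Rightarrow> real \<Rightarrow> complex" where
  "eta_density a n t \<eta> =
     (LINT \<phi>1 : {0<..<2*pi} | lborel. LINT \<phi>2 : {0<..<2*pi} | lborel.
      LINT x' : {x'. \<forall>i\<in>{5..2*n+2}. 0 \<le> x' i \<and> x' i < 1} | PiM {5..2*n+2} (\<lambda>_. lborel).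
        sphere_integral (2*n+2)
          (\<lambda>I \<xi>. trace (parametrix a n (2*n) (x'(1 := t, 2 := \<eta>, 3 := \<phi>1, 4 := \<phi>2)) \<xi>)
                   * complex_of_real (sphere_form (2*n+2) I \<xi>)))"

definition heat_coeff :: "(real \<Rightarrow> real) \<Rightarrow> nat \<Rightarrow> real \<Rightarrow> complex" where
  "heat_coeff a n t =
     complex_of_real (1 / (2^5 * pi^(3+n))) *
       (LINT \<eta> : {0<..<pi/2} | lborel. eta_density a n t \<eta>)"


section \<open>Polynomials over \<open>\<rat>\<close>, semialgebraic sets and algebraic differential forms\<close>

text \<open>Polynomials over \<open>\<rat>\<close> in variables indexed by \<open>nat\<close>: finitely supported maps from
  exponent vectors to coefficients.\<close>

type_synonym qpoly = "((nat, nat) poly_mapping, rat) poly_mapping"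

definition qpoly_vars :: "qpoly \<Rightarrow> nat set" where
  "qpoly_vars P = (\<Union>m\<in>Poly_Mapping.keys P. Poly_Mapping.keys m)"

definition qpoly_eval :: "qpoly \<Rightarrow> (nat \<Rightarrow> 'b::field_char_0) \<Rightarrow> 'b" where
  "qpoly_eval P x =
     (\<Sum>m\<in>Poly_Mapping.keys P. of_rat (Poly_Mapping.lookup P m) *
        (\<Prod>i\<in>Poly_Mapping.keys m. x i ^ Poly_Mapping.lookup m i))"

text \<open>The affine space over the field \<open>'b\<close> with coordinates \<open>0, \<dots>, N - 1\<close>\<close>

definition affine_space :: "nat \<Rightarrow> (nat \<Rightarrow> 'b) set" where
  "affine_space N = {..<N} \<rightarrow>\<^sub>E UNIV"

inductive Q_semialgebraic :: "nat \<Rightarrow> (nat \<Rightarrow> real) set \<Rightarrow> bool" for N where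
  nonneg: "qpoly_vars P \<subseteq> {..<N} \<Longrightarrow>
    Q_semialgebraic N {x \<in> affine_space N. qpoly_eval P x \<ge> 0}"
| compl: "Q_semialgebraic N S \<Longrightarrow> Q_semialgebraic N (affine_space N - S)"
| inter: "Q_semialgebraic N S \<Longrightarrow> Q_semialgebraic N T \<Longrightarrow> Q_semialgebraic N (S \<inter> T)"
| union: "Q_semialgebraic N S \<Longrightarrow> Q_semialgebraic N T \<Longrightarrow> Q_semialgebraic N (S \<union> T)"

definition Q_form :: "nat \<Rightarrow> 'b::field \<Rightarrow> (nat \<Rightarrow> 'b) \<Rightarrow> 'b" where
  "Q_form n \<alpha> u =
     (u 1)\<^sup>2 + 1 / \<alpha>\<^sup>2 * ((u 2)\<^sup>2 + (u 3)\<^sup>2 + (u 4)\<^sup>2) + (\<Sum>i=5..2*n+2. (u i)\<^sup>2)"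

definition CZ_hat :: "nat \<Rightarrow> 'b::field \<Rightarrow> (nat \<Rightarrow> 'b) set" where
  "CZ_hat n \<alpha> = {u \<in> affine_space (2*n+3). Q_form n \<alpha> u = 0}"

definition H0 :: "nat \<Rightarrow> (nat \<Rightarrow> 'b::field) set" where
  "H0 n = {u \<in> affine_space (2*n+3). u 0 = 0}"

definition H1 :: "nat \<Rightarrow> (nat \<Rightarrow> 'b::field) set" where
  "H1 n = {u \<in> affine_space (2*n+3). u 0 = 1}"

text \<open>
  The parameters are \<open>b 0 = \<alpha>\<close> and \<open>b i = \<alpha>\<^sub>i\<close> for \<open>1 \<le> i \<le> 2n\<close>. As polynomial variables,
  \<open>u\<^sub>0, \<dots>, u\<^bsub>2n+2\<^esub>, \<alpha>, \<alpha>\<^sub>1, \<dots>, \<alpha>\<^sub>2\<^sub>n\<close> have the indices \<open>0, \<dots>, 4n+3\<close>.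
\<close>

definition join_vars :: "nat \<Rightarrow> (nat \<Rightarrow> 'b) \<Rightarrow> (nat \<Rightarrow> 'b) \<Rightarrow> nat \<Rightarrow> 'b" where
  "join_vars n b u = (\<lambda>i. if i \<le> 2*n+2 then u i else b (i - (2*n+3)))"

text \<open>
  A rational form of degree \<open>2n+2\<close> in \<open>u\<^sub>0, \<dots>, u\<^bsub>2n+2\<^esub>\<close>: the coefficient of \<open>du\<^sub>I\<close> is the fraction
  with numerator and denominator \<open>\<Omega> I\<close>. Regularity is regularity on the variety, i.e. at all
  complex points of the complement and all parameters with \<open>\<alpha> \<noteq> 0\<close>. As the polynomial ring is
  factorial, a rational function regular at each of these points is a single fraction whose
  denominator vanishes at none of them.
\<close>

definition algebraic_form :: "nat \<Rightarrow> (nat set \<Rightarrow> qpoly \<times> qpoly) \<Rightarrow> bool" where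
  "algebraic_form n \<Omega> \<longleftrightarrow>
     (\<forall>I. I \<subseteq> {0..2*n+2} \<and> card I = 2*n+2 \<longrightarrow>
        qpoly_vars (fst (\<Omega> I)) \<subseteq> {..<4*n+4} \<and> qpoly_vars (snd (\<Omega> I)) \<subseteq> {..<4*n+4} \<and>
        (\<forall>(b :: nat \<Rightarrow> complex) u. b 0 \<noteq> 0 \<and>
           u \<in> affine_space (2*n+3) - (CZ_hat n (b 0) \<union> H0 n \<union> H1 n) \<longrightarrow>
           qpoly_eval (snd (\<Omega> I)) (join_vars n b u) \<noteq> 0))"

definition form_at :: "nat \<Rightarrow> (nat set \<Rightarrow> qpoly \<times> qpoly) \<Rightarrow> (nat \<Rightarrow> real) \<Rightarrow> real form" where
  "form_at n \<Omega> b I u =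
     qpoly_eval (fst (\<Omega> I)) (join_vars n b u) / qpoly_eval (snd (\<Omega> I)) (join_vars n b u)"


section \<open>The domain \<open>A\<^bsub>2n+2\<^esub>\<close> and integration over it\<close>

definition A_set :: "nat \<Rightarrow> (nat \<Rightarrow> real) set" where
  "A_set n = {u \<in> affine_space (2*n+3).
     (u 1)\<^sup>2 + (u 2)\<^sup>2 + u 0 * (u 3)\<^sup>2 + (1 - u 0) * (u 4)\<^sup>2 + (\<Sum>i=5..2*n+2. (u i)\<^sup>2) = 1 \<and>
     (\<forall>i\<in>{0,1,2} \<union> {5..2*n+2}. 0 < u i \<and> u i < 1)}"

text \<open>
  As \<open>u\<^sub>1 > 0\<close> on \<open>A\<^bsub>2n+2\<^esub>\<close>, it is a graph over the coordinates \<open>u\<^sub>0, u\<^sub>2, u\<^sub>3, \<dots>, u\<^bsub>2n+2\<^esub>\<close>. Through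
  \<open>u\<^sub>0 = sin\<^sup>2 \<eta>\<close>, \<open>u\<^sub>3 = csc \<eta> \<xi>\<^sub>3\<close>, \<open>u\<^sub>4 = sec \<eta> \<xi>\<^sub>4\<close> (increasing in \<open>\<eta>\<close>, and positive multiples for
  fixed \<open>\<eta>\<close>) these correspond to the coordinates \<open>\<eta>, \<xi>\<^sub>2, \<dots>, \<xi>\<^bsub>2n+2\<^esub>\<close>, which on the part \<open>\<xi>\<^sub>1 > 0\<close>
  of \<open>(0, \<pi>/2) \<times> S\<^bsup>2n+1\<^esup>\<close> are positively oriented; so this chart of \<open>A\<^bsub>2n+2\<^esub>\<close> is positively oriented.
\<close>

definition A_chart :: "nat \<Rightarrow> (nat \<Rightarrow> real) \<Rightarrow> nat \<Rightarrow> real" where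
  "A_chart n y = restrict
     (y(1 := sqrt (1 - ((y 2)\<^sup>2 + y 0 * (y 3)\<^sup>2 + (1 - y 0) * (y 4)\<^sup>2 + (\<Sum>i=5..2*n+2. (y i)\<^sup>2)))))
     {..<2*n+3}"

lemma A_set_chart: "u \<in> A_set n \<Longrightarrow> A_chart n u = u"
proof -
  assume u: "u \<in> A_set n"
  then have "1 - ((u 2)\<^sup>2 + u 0 * (u 3)\<^sup>2 + (1 - u 0) * (u 4)\<^sup>2 + (\<Sum>i=5..2*n+2. (u i)\<^sup>2)) = (u 1)\<^sup>2"
    and "u 1 > 0" and "u \<in> extensional {..<2*n+3}"
    by (auto simp: A_set_def affine_space_def PiE_def)
  then show ?thesis
    by (simp add: A_chart_def extensional_restrict)
qed

text \<open>The slice of \<open>A\<^bsub>2n+2\<^esub>\<close> over a fixed \<open>u\<^sub>0\<close>, in the coordinates \<open>u\<^sub>2, \<dots>, u\<^bsub>2n+2\<^esub>\<close>, and the coefficient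
  of \<open>du\<^sub>0 \<and> du\<^sub>2 \<and> \<dots> \<and> du\<^bsub>2n+2\<^esub>\<close> in the restriction of a form to \<open>A\<^bsub>2n+2\<^esub>\<close>\<close>

definition A_slice :: "nat \<Rightarrow> real \<Rightarrow> (nat \<Rightarrow> real) set" where
  "A_slice n u0 = {y. A_chart n (y(0 := u0)) \<in> A_set n}"

definition A_coeff :: "nat \<Rightarrow> real form \<Rightarrow> real \<Rightarrow> (nat \<Rightarrow> real) \<Rightarrow> real" where
  "A_coeff n \<omega> u0 y =
     pullback_coeff {0..2*n+2} ({0} \<union> {2..2*n+2}) (A_chart n) \<omega> (y(0 := u0))"

definition slice_integrable :: "nat \<Rightarrow> real form \<Rightarrow> real \<Rightarrow> bool" where
  "slice_integrable n \<omega> u0 \<longleftrightarrow>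
     set_integrable (PiM {2..2*n+2} (\<lambda>_. lborel)) (A_slice n u0) (A_coeff n \<omega> u0)"

definition slice_integral :: "nat \<Rightarrow> real form \<Rightarrow> real \<Rightarrow> real" where
  "slice_integral n \<omega> u0 =
     (LINT y : A_slice n u0 | PiM {2..2*n+2} (\<lambda>_. lborel). A_coeff n \<omega> u0 y)"

definition A_integral :: "nat \<Rightarrow> real form \<Rightarrow> real" where
  "A_integral n \<omega> = (LINT u0 : {0<..<1} | lborel. slice_integral n \<omega> u0)"

end

theory Submission
  imports Defs
begin

text \<open>
  In the coordinates \<open>u\<close> all symbols are polynomials in the \<open>u\<^sub>i\<close>, the derivatives of \<open>a\<close>, the
  inverses of \<open>u\<^sub>0\<close>, \<open>1 - u\<^sub>0\<close>, \<open>a\<close> and \<open>Q\<close>, and \<open>s = sin \<eta> cos \<eta>\<close>; this ring is closed under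
  the derivatives with respect to \<open>x\<^sub>1, x\<^sub>2, \<xi>\<^sub>1, \<xi>\<^sub>2\<close>, and nothing depends on \<open>x\<^sub>3, x\<^sub>4\<close>. Two symmetries
  propagate through the recursion for the parametrix. Charge conjugation makes \<open>tr \<sigma>\<^bsub>-2n-2\<^esub>\<close> real.
  The reflection \<open>\<eta> \<mapsto> -\<eta>\<close> makes it invariant under \<open>(s, u\<^sub>2, u\<^sub>3) \<mapsto> (-s, -u\<^sub>2, -u\<^sub>3)\<close>, so that the part
  which is odd in \<open>s\<close> integrates to zero over the sphere, and a rational function of the \<open>u\<^sub>i\<close> remains.
  Its poles lie on \<open>Q = 0\<close>, \<open>u\<^sub>0 = 0\<close> and \<open>u\<^sub>0 = 1\<close>. Averaging over the signs of \<open>\<xi>\<^sub>1, \<xi>\<^sub>2, \<xi>\<^sub>5, \<dots>\<close> reduces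
  the sphere to the part with positive coordinates. On it, \<open>\<sigma>\<^bsub>\<xi>,2n+1\<^esub>\<close> has density \<open>1/\<xi>\<^sub>1\<close>, as has the
  contraction of \<open>du\<^sub>1 du\<^sub>2 \<dots>\<close> with the Euler field in \<open>u\<close>; the Jacobian \<open>s\<close> of the slices and
  \<open>du\<^sub>0 = 2 s d\<eta>\<close> match.
\<close>

section \<open>Polynomials over the rationals and semialgebraic sets\<close>

text \<open>The form has to be fixed before the scale factor is known. Every representation of a
  symbol is therefore by rational polynomials in generators, chosen ahead of \<open>a\<close>, of
  the point and of the covector; derivatives of \<open>a\<close> enter only as values of generators.
  The derivative of u_3 with respect to \<xi>_3 is csc \<eta>, which lies outside the ring. This is
  harmless, because in the recursion it is always multiplied by a derivative in x_3, which vanishes.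
  Two things then obstruct a rational form over the rationals: the unit \<open>\<i>\<close>, which
  charge conjugation removes, and s, a square root of u_0 (1 - u_0), which the reflection removes.
  Neither cancellation is visible in a single term of the recursion, so both symmetries are carried
  as degrees mod 2 through all sums, products and derivatives. The available bounds degenerate at
  u_0 = 0 and u_0 = 1. Convergence is thus proved slice by slice only, and the outer integrals are
  compared by a change of variables that is valid whether or not they converge.\<close>

lemma qpoly_eval_superset:
  assumes "finite K" "Poly_Mapping.keys P \<subseteq> K"
  shows "qpoly_eval P x = (\<Sum>m\<in>K. of_rat (Poly_Mapping.lookup P m) *
        (\<Prod>i\<in>Poly_Mapping.keys m. x i ^ Poly_Mapping.lookup m i))"
  unfolding qpoly_eval_def using assms
  by (intro sum.mono_neutral_left) (auto simp: in_keys_iff)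

lemma qpoly_eval_add: "qpoly_eval (P + Q) x = qpoly_eval P x + qpoly_eval Q x"
proof -
  let ?K = "Poly_Mapping.keys P \<union> Poly_Mapping.keys Q"
  have "finite ?K" "Poly_Mapping.keys (P + Q) \<subseteq> ?K" "Poly_Mapping.keys P \<subseteq> ?K" "Poly_Mapping.keys Q \<subseteq> ?K"
    using keys_add[of P Q] by auto
  then show ?thesis
    by (simp add: qpoly_eval_superset[of ?K] lookup_add of_rat_add algebra_simps sum.distrib)
qed

lemma qpoly_eval_0 [simp]: "qpoly_eval 0 x = 0"
  by (simp add: qpoly_eval_def)

lemma qpoly_eval_sum: "qpoly_eval (sum f A) x = (\<Sum>i\<in>A. qpoly_eval (f i) x)"
  by (induction A rule: infinite_finite_induct) (auto simp: qpoly_eval_add)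

text \<open>A variable of exponent 0 contributes a factor 1, so all three products extend to the
  union of the two supports.\<close>

lemma monomial_eval_add:
  fixes x :: "nat \<Rightarrow> 'b::comm_semiring_1"
  shows "(\<Prod>i\<in>Poly_Mapping.keys (k + l). x i ^ Poly_Mapping.lookup (k + l) i) =
    (\<Prod>i\<in>Poly_Mapping.keys k. x i ^ Poly_Mapping.lookup k i) *
    (\<Prod>i\<in>Poly_Mapping.keys l. x i ^ Poly_Mapping.lookup l i)"
proof -
  let ?K = "Poly_Mapping.keys k \<union> Poly_Mapping.keys l"
  have *: "(\<Prod>i\<in>Poly_Mapping.keys m. x i ^ Poly_Mapping.lookup m i) =
      (\<Prod>i\<in>?K. x i ^ Poly_Mapping.lookup m i)" if "Poly_Mapping.keys m \<subseteq> ?K" for m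
    using that by (intro prod.mono_neutral_left) (auto simp: in_keys_iff)
  show ?thesis
    unfolding *[OF keys_add] *[of k, OF Un_upper1] *[of l, OF Un_upper2]
    by (simp only: lookup_add power_add prod.distrib)
qed

lemma qpoly_eval_single:
  "qpoly_eval (Poly_Mapping.single m c) x =
     of_rat c * (\<Prod>i\<in>Poly_Mapping.keys m. x i ^ Poly_Mapping.lookup m i)"
  by (cases "c = 0") (auto simp: qpoly_eval_def)

lemma poly_mapping_eq_sum_single:
  "P = (\<Sum>m\<in>Poly_Mapping.keys P. Poly_Mapping.single m (Poly_Mapping.lookup P m))"
  by (rule poly_mapping_eqI)
     (auto simp: lookup_sum lookup_single when_def sum.delta in_keys_iff)

lemma qpoly_eval_mult: "qpoly_eval (P * Q) x = qpoly_eval P x * qpoly_eval Q x"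
proof -
  have "P * Q = (\<Sum>m\<in>Poly_Mapping.keys P. Poly_Mapping.single m (Poly_Mapping.lookup P m)) *
      (\<Sum>m\<in>Poly_Mapping.keys Q. Poly_Mapping.single m (Poly_Mapping.lookup Q m))"
    using poly_mapping_eq_sum_single[of P] poly_mapping_eq_sum_single[of Q] by simp
  then have "qpoly_eval (P * Q) x = (\<Sum>k\<in>Poly_Mapping.keys P. \<Sum>l\<in>Poly_Mapping.keys Q.
      qpoly_eval (Poly_Mapping.single (k + l) (Poly_Mapping.lookup P k * Poly_Mapping.lookup Q l)) x)"
    by (simp add: sum_product qpoly_eval_sum mult_single)
  also have "\<dots> = qpoly_eval P x * qpoly_eval Q x"
    unfolding qpoly_eval_single monomial_eval_add of_rat_mult
    by (simp add: qpoly_eval_def sum_product mult_ac)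
  finally show ?thesis .
qed

lemma qpoly_vars_add: "qpoly_vars (P + Q) \<subseteq> qpoly_vars P \<union> qpoly_vars Q"
  using keys_add[of P Q] by (fastforce simp: qpoly_vars_def)

lemma qpoly_vars_mult: "qpoly_vars (P * Q) \<subseteq> qpoly_vars P \<union> qpoly_vars Q"
proof
  fix i assume "i \<in> qpoly_vars (P * Q)"
  then obtain m where m: "m \<in> Poly_Mapping.keys (P * Q)" "i \<in> Poly_Mapping.keys m"
    by (auto simp: qpoly_vars_def)
  then obtain k l where "m = k + l" "k \<in> Poly_Mapping.keys P" "l \<in> Poly_Mapping.keys Q"
    using keys_mult[of P Q] by auto
  then show "i \<in> qpoly_vars P \<union> qpoly_vars Q"
    using m keys_add[of k l] by (auto simp: qpoly_vars_def)
qed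

definition qconst :: "rat \<Rightarrow> qpoly" where
  "qconst c = Poly_Mapping.single 0 c"

definition qvar :: "nat \<Rightarrow> qpoly" where
  "qvar i = Poly_Mapping.single (Poly_Mapping.single i 1) 1"

lemma qpoly_eval_qconst [simp]: "qpoly_eval (qconst c) x = of_rat c"
  by (simp add: qconst_def qpoly_eval_single)

lemma qpoly_eval_qvar [simp]: "qpoly_eval (qvar i) x = x i"
  by (simp add: qvar_def qpoly_eval_single)

lemma qpoly_vars_qconst [simp]: "qpoly_vars (qconst c) = {}"
  by (auto simp: qconst_def qpoly_vars_def)

lemma qpoly_vars_qvar [simp]: "qpoly_vars (qvar i) = {i}"
  by (auto simp: qvar_def qpoly_vars_def)

lemma qpoly_eval_power: "qpoly_eval (P ^ k) x = qpoly_eval P x ^ k"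
proof (induction k)
  case 0
  have "(1 :: qpoly) = qconst 1" by (simp add: qconst_def)
  then show ?case by (metis power_0 qpoly_eval_qconst of_rat_1)
qed (simp add: qpoly_eval_mult)

lemma qpoly_vars_0 [simp]: "qpoly_vars 0 = {}"
  by (simp add: qpoly_vars_def)

lemma qpoly_vars_sum: "(\<And>i. i \<in> A \<Longrightarrow> qpoly_vars (f i) \<subseteq> V) \<Longrightarrow> qpoly_vars (sum f A) \<subseteq> V"
proof (induction A rule: infinite_finite_induct)
  case (insert i A)
  then show ?case using qpoly_vars_add[of "f i" "sum f A"] by fastforce
qed auto

lemma qpoly_vars_power: "qpoly_vars (P ^ k) \<subseteq> qpoly_vars P"
proof (induction k)
  case 0
  show ?case using qpoly_vars_qconst[of 1] by (simp add: qconst_def)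
next
  case (Suc k)
  then show ?case using qpoly_vars_mult[of P "P ^ k"] by auto
qed

text \<open>Rational polynomials as functions, not as formal expressions: composition with sign
  changes, measurability and bounds become inductions over the generation.
  \<open>polyfuns_qpoly\<close> returns to formal polynomials where semialgebraic sets and algebraic
  forms require them.\<close>

inductive_set polyfuns :: "nat \<Rightarrow> ((nat \<Rightarrow> real) \<Rightarrow> real) set" for N where
  const: "(\<lambda>_. of_rat c) \<in> polyfuns N"
| var: "i < N \<Longrightarrow> (\<lambda>w. w i) \<in> polyfuns N"
| add: "p \<in> polyfuns N \<Longrightarrow> q \<in> polyfuns N \<Longrightarrow> (\<lambda>w. p w + q w) \<in> polyfuns N"
| mult: "p \<in> polyfuns N \<Longrightarrow> q \<in> polyfuns N \<Longrightarrow> (\<lambda>w. p w * q w) \<in> polyfuns N"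

lemma polyfuns_qpoly:
  "p \<in> polyfuns N \<Longrightarrow> \<exists>P. qpoly_vars P \<subseteq> {..<N} \<and> qpoly_eval P = p"
proof (induction rule: polyfuns.induct)
  case (const c)
  then show ?case by (intro exI[of _ "qconst c"]) (simp add: fun_eq_iff)
next
  case (var i)
  then show ?case by (intro exI[of _ "qvar i"]) (auto simp: fun_eq_iff)
next
  case (add p q)
  then obtain P Q where "qpoly_vars P \<subseteq> {..<N}" "qpoly_eval P = p" "qpoly_vars Q \<subseteq> {..<N}" "qpoly_eval Q = q"
    by blast
  then show ?case using qpoly_vars_add[of P Q]
    by (intro exI[of _ "P + Q"]) (auto simp: qpoly_eval_add)
next
  case (mult p q)
  then obtain P Q where "qpoly_vars P \<subseteq> {..<N}" "qpoly_eval P = p" "qpoly_vars Q \<subseteq> {..<N}" "qpoly_eval Q = q"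
    by blast
  then show ?case using qpoly_vars_mult[of P Q]
    by (intro exI[of _ "P * Q"]) (auto simp: qpoly_eval_mult)
qed

lemma polyfuns_of_nat: "(\<lambda>_. of_nat c) \<in> polyfuns N"
  using polyfuns.const[of "of_nat c"] by simp

lemma polyfuns_uminus: "p \<in> polyfuns N \<Longrightarrow> (\<lambda>w. - p w) \<in> polyfuns N"
  using polyfuns.mult[OF polyfuns.const[of "-1"]] by (simp add: of_rat_minus)

lemma polyfuns_diff: "p \<in> polyfuns N \<Longrightarrow> q \<in> polyfuns N \<Longrightarrow> (\<lambda>w. p w - q w) \<in> polyfuns N"
  using polyfuns.add[OF _ polyfuns_uminus] by simp

lemma polyfuns_one: "(\<lambda>_. 1) \<in> polyfuns N"
  using polyfuns.const[of 1] by simp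

lemma polyfuns_power: "p \<in> polyfuns N \<Longrightarrow> (\<lambda>w. p w ^ k) \<in> polyfuns N"
  by (induction k) (auto intro: polyfuns_one polyfuns.mult)

lemma polyfuns_zero: "(\<lambda>_. 0) \<in> polyfuns N"
  using polyfuns.const[of 0] by simp

lemma polyfuns_sum: "(\<And>i. i \<in> A \<Longrightarrow> f i \<in> polyfuns N) \<Longrightarrow> (\<lambda>w. \<Sum>i\<in>A. f i w) \<in> polyfuns N"
  by (induction A rule: infinite_finite_induct) (auto intro: polyfuns_zero polyfuns.add)

lemmas polyfuns_intros = polyfuns.var polyfuns.add polyfuns.mult polyfuns_of_nat polyfuns_uminus
  polyfuns_diff polyfuns_one polyfuns_power polyfuns_zero polyfuns_sum

lemma polyfuns_flip:
  assumes "p \<in> polyfuns N"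
  shows "(\<lambda>w. p (w(i := - w i))) \<in> polyfuns N"
  using assms
proof induction
  case (var j)
  show ?case
    by (cases "j = i") (use var in \<open>auto intro: polyfuns_intros\<close>)
qed (auto intro: polyfuns.intros)

lemma polyfuns_measurable:
  assumes "p \<in> polyfuns N" "\<And>i. i < N \<Longrightarrow> (\<lambda>y. W y i) \<in> borel_measurable M"
  shows "(\<lambda>y. p (W y)) \<in> borel_measurable M"
  using assms by induction auto

lemma polyfuns_bounded:
  assumes "p \<in> polyfuns N"
  shows "\<exists>B. \<forall>w. (\<forall>i<N. \<bar>w i\<bar> \<le> R) \<longrightarrow> \<bar>p w\<bar> \<le> B"
  using assms
proof induction
  case (add p q)
  then obtain B B' where "\<And>w. (\<forall>i<N. \<bar>w i\<bar> \<le> R) \<Longrightarrow> \<bar>p w\<bar> \<le> B"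
    "\<And>w. (\<forall>i<N. \<bar>w i\<bar> \<le> R) \<Longrightarrow> \<bar>q w\<bar> \<le> B'" by blast
  then show ?case by (intro exI[of _ "B + B'"]) (meson abs_triangle_ineq add_mono order_trans)
next
  case (mult p q)
  then obtain B B' where "\<And>w. (\<forall>i<N. \<bar>w i\<bar> \<le> R) \<Longrightarrow> \<bar>p w\<bar> \<le> B"
    "\<And>w. (\<forall>i<N. \<bar>w i\<bar> \<le> R) \<Longrightarrow> \<bar>q w\<bar> \<le> B'" by blast
  \<comment> \<open>That \<open>B\<close> is nonnegative follows from the bound at \<open>w\<close>
    itself.\<close>
  then have "\<And>w. (\<forall>i<N. \<bar>w i\<bar> \<le> R) \<Longrightarrow> \<bar>p w * q w\<bar> \<le> B * B'"
    unfolding abs_mult by (intro mult_mono) (auto intro: order_trans[OF abs_ge_zero])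
  then show ?case by blast
qed auto

section \<open>Semialgebraic sets\<close>

lemma Q_semialgebraic_ge:
  assumes "p \<in> polyfuns N"
  shows "Q_semialgebraic N {x \<in> affine_space N. p x \<ge> 0}"
  using polyfuns_qpoly[OF assms] Q_semialgebraic.nonneg by blast

lemma Q_semialgebraic_gt:
  assumes "p \<in> polyfuns N"
  shows "Q_semialgebraic N {x \<in> affine_space N. p x > 0}"
proof -
  have "{x \<in> affine_space N. p x > 0} = affine_space N - {x \<in> affine_space N. - p x \<ge> 0}"
    by auto
  then show ?thesis
    using Q_semialgebraic.compl[OF Q_semialgebraic_ge[OF polyfuns_uminus[OF assms]]] by simp
qed

lemma Q_semialgebraic_eq:
  assumes "p \<in> polyfuns N"
  shows "Q_semialgebraic N {x \<in> affine_space N. p x = 0}"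
proof -
  have "{x \<in> affine_space N. p x = 0} =
      {x \<in> affine_space N. p x \<ge> 0} \<inter> {x \<in> affine_space N. - p x \<ge> 0}"
    by auto
  then show ?thesis
    using Q_semialgebraic.inter[OF Q_semialgebraic_ge[OF assms] Q_semialgebraic_ge[OF polyfuns_uminus[OF assms]]]
    by simp
qed

lemma Q_semialgebraic_Ball:
  assumes "finite I" "I \<noteq> {}" "\<And>i. i \<in> I \<Longrightarrow> Q_semialgebraic N {x \<in> affine_space N. P i x}"
  shows "Q_semialgebraic N {x \<in> affine_space N. \<forall>i\<in>I. P i x}"
  using assms
proof (induction I rule: finite_ne_induct)
  case (insert i I)
  have "{x \<in> affine_space N. \<forall>i\<in>insert i I. P i x} =
      {x \<in> affine_space N. P i x} \<inter> {x \<in> affine_space N. \<forall>i\<in>I. P i x}"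
    by auto
  then show ?case using insert by (auto intro: Q_semialgebraic.inter)
qed simp

lemma Q_semialgebraic_A_set: 
  assumes "n \<ge> 1"
  shows "Q_semialgebraic (2*n+3) (A_set n)"
proof -
  let ?N = "2*n+3" and ?I = "{0,1,2} \<union> {5..2*n+2::nat}"
  let ?p = "\<lambda>u. (u 1)\<^sup>2 + (u 2)\<^sup>2 + u 0 * (u 3)\<^sup>2 + (1 - u 0) * (u 4)\<^sup>2 + (\<Sum>i=5..2*n+2. (u i)\<^sup>2) - 1 :: real"
  have lt: "i < ?N" if "i \<in> ?I" for i using that by auto
  have "?p \<in> polyfuns ?N"
    by (intro polyfuns_intros) (use assms in auto)
  then have 1: "Q_semialgebraic ?N {x \<in> affine_space ?N. ?p x = 0}"
    by (rule Q_semialgebraic_eq)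
  have 2: "Q_semialgebraic ?N {x \<in> affine_space ?N. \<forall>i\<in>?I. 0 < x i}"
    by (rule Q_semialgebraic_Ball) (simp, simp, intro Q_semialgebraic_gt polyfuns_intros lt)
  have 3: "Q_semialgebraic ?N {x \<in> affine_space ?N. \<forall>i\<in>?I. 0 < 1 - x i}"
    by (rule Q_semialgebraic_Ball) (simp, simp, intro Q_semialgebraic_gt polyfuns_intros lt)
  have "A_set n = {x \<in> affine_space ?N. ?p x = 0} \<inter>
      ({x \<in> affine_space ?N. \<forall>i\<in>?I. 0 < x i} \<inter> {x \<in> affine_space ?N. \<forall>i\<in>?I. 0 < 1 - x i})"
    unfolding A_set_def by auto
  then show ?thesis
    using Q_semialgebraic.inter[OF 1 Q_semialgebraic.inter[OF 2 3]] by simp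
qed

section \<open>Graded symbols and their derivatives\<close>

text \<open>Inverses are generators of their own. Elements of the ring are then plain polynomials,
  and a derivation is determined by its values on the generators.\<close>

datatype symvar = UVar nat | Jet nat | SinCos | InvU0 | InvU0c | InvJet0 | InvQ

text \<open>The scalar principal symbol of the operator whose parametrix is taken, as a function of
  x and \<xi>; in the coordinates u it is Q.\<close>

definition conf_sq :: "nat \<Rightarrow> (real \<Rightarrow> real) \<Rightarrow> (nat \<Rightarrow> real) \<Rightarrow> (nat \<Rightarrow> real) \<Rightarrow> real" where
  "conf_sq n a x \<xi> = (\<xi> 1)\<^sup>2 + ((\<xi> 2)\<^sup>2 + (\<xi> 3 / sin (x 2))\<^sup>2 + (\<xi> 4 / cos (x 2))\<^sup>2) / (a (x 1))\<^sup>2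
     + (\<Sum>i=5..2*n+2. (\<xi> i)\<^sup>2)"

fun env :: "nat \<Rightarrow> (real \<Rightarrow> real) \<Rightarrow> (nat \<Rightarrow> real) \<Rightarrow> (nat \<Rightarrow> real) \<Rightarrow> symvar \<Rightarrow> real" where
  "env n a x \<xi> (UVar i) =
     (if i = 0 then (sin (x 2))\<^sup>2 else if i = 3 then \<xi> 3 / sin (x 2)
      else if i = 4 then \<xi> 4 / cos (x 2) else \<xi> i)"
| "env n a x \<xi> (Jet i) = (deriv ^^ i) a (x 1)"
| "env n a x \<xi> SinCos = sin (x 2) * cos (x 2)"
| "env n a x \<xi> InvU0 = 1 / (sin (x 2))\<^sup>2"
| "env n a x \<xi> InvU0c = 1 / (cos (x 2))\<^sup>2"
| "env n a x \<xi> InvJet0 = 1 / a (x 1)"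
| "env n a x \<xi> InvQ = 1 / conf_sq n a x \<xi>"

text \<open>The points at which symbols are represented. The conditions are stable under small
  changes of each coordinate, as derivatives require; the open set \<open>T\<close> serves this
  purpose in the direction x_1.\<close>

definition good :: "nat \<Rightarrow> (real \<Rightarrow> real) \<Rightarrow> real set \<Rightarrow> (nat \<Rightarrow> real) \<Rightarrow> (nat \<Rightarrow> real) \<Rightarrow> bool" where
  "good n a T x \<xi> \<longleftrightarrow> open T \<and> (\<forall>k. (deriv ^^ k) a differentiable_on T) \<and> (\<forall>s\<in>T. a s > 0) \<and>
     x 1 \<in> T \<and> x 2 \<in> {0<..<pi/2} \<and> conf_sq n a x \<xi> \<noteq> 0"

text \<open>
  Parity under \<open>\<eta> \<mapsto> -\<eta>\<close>, \<open>\<xi>\<^sub>2 \<mapsto> -\<xi>\<^sub>2\<close>. It preserves the symbol of the Dirac operator up to conjugation by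
  \<open>diag(1, -1, 1, -1)\<close>, whence \<open>odd_row\<close> below.
\<close>

fun odd_var :: "symvar \<Rightarrow> bool" where
  "odd_var (UVar i) \<longleftrightarrow> i = 2 \<or> i = 3"
| "odd_var SinCos \<longleftrightarrow> True"
| "odd_var _ \<longleftrightarrow> False"

fun admissible :: "nat \<Rightarrow> nat \<Rightarrow> symvar \<Rightarrow> bool" where
  "admissible n k (UVar i) \<longleftrightarrow> i \<le> 2*n+2"
| "admissible n k (Jet i) \<longleftrightarrow> i \<le> k"
| "admissible n k _ \<longleftrightarrow> True"

text \<open>The Boolean is a degree in Z/2, with \<open>g \<noteq> h\<close> as addition, and
  \<open>k\<close> bounds the order of the jets. Zero is given every degree, so that vanishing
  derivatives fit whatever degree is expected.\<close>

inductive graded :: "nat \<Rightarrow> nat \<Rightarrow> bool \<Rightarrow> ((symvar \<Rightarrow> real) \<Rightarrow> real) \<Rightarrow> bool" for n k where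
  zero: "graded n k g (\<lambda>_. 0)"
| const: "graded n k False (\<lambda>_. of_rat c)"
| var: "admissible n k v \<Longrightarrow> graded n k (odd_var v) (\<lambda>e. e v)"
| add: "graded n k g p \<Longrightarrow> graded n k g q \<Longrightarrow> graded n k g (\<lambda>e. p e + q e)"
| mult: "graded n k g p \<Longrightarrow> graded n k h q \<Longrightarrow> graded n k (g \<noteq> h) (\<lambda>e. p e * q e)"

lemma graded_mono:
  assumes "graded n k g p" "k \<le> k'"
  shows "graded n k' g p"
  using assms
proof induction
  case (var v)
  then have "admissible n k' v" by (cases v) auto
  then show ?case by (rule graded.var)
qed (auto simp only: intro: graded.intros)

text \<open>The Leibniz rule, for a derivation of parity \<open>\<delta>\<close> that raises the
  order of jets by at most \<open>\<kappa>\<close>. The polynomial \<open>d\<close> is chosen before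
  the curve, hence is the same for all scale factors and all points.\<close>

lemma graded_deriv:
  assumes var: "\<And>v k. admissible n k v \<Longrightarrow> \<exists>d. graded n (k + \<kappa>) (odd_var v \<noteq> \<delta>) d \<and>
      (\<forall>c s. C c s \<longrightarrow> ((\<lambda>s. c s v) has_real_derivative d (c s)) (at s))"
  assumes p: "graded n k g p"
  shows "\<exists>d. graded n (k + \<kappa>) (g \<noteq> \<delta>) d \<and>
      (\<forall>c s. C c s \<longrightarrow> ((\<lambda>s. p (c s)) has_real_derivative d (c s)) (at s))"
  using p
proof induction
  case (zero g)
  show ?case by (rule exI[of _ "\<lambda>_. 0"]) (auto intro: graded.zero)
next
  case (const c)
  show ?case by (rule exI[of _ "\<lambda>_. 0"]) (auto intro: graded.zero)
next
  case (var v)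
  then show ?case by (rule assms(1))
next
  case (add g p q)
  then obtain dp dq where
    "graded n (k + \<kappa>) (g \<noteq> \<delta>) dp" "\<forall>c s. C c s \<longrightarrow> ((\<lambda>s. p (c s)) has_real_derivative dp (c s)) (at s)"
    "graded n (k + \<kappa>) (g \<noteq> \<delta>) dq" "\<forall>c s. C c s \<longrightarrow> ((\<lambda>s. q (c s)) has_real_derivative dq (c s)) (at s)"
    by blast
  then show ?case
    by (intro exI[of _ "\<lambda>e. dp e + dq e"]) (auto intro!: graded.add DERIV_add)
next
  case (mult g p h q)
  then obtain dp dq where
    d: "graded n (k + \<kappa>) (g \<noteq> \<delta>) dp" "\<And>c s. C c s \<Longrightarrow> ((\<lambda>s. p (c s)) has_real_derivative dp (c s)) (at s)"
    "graded n (k + \<kappa>) (h \<noteq> \<delta>) dq" "\<And>c s. C c s \<Longrightarrow> ((\<lambda>s. q (c s)) has_real_derivative dq (c s)) (at s)"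
    by blast
  have pq: "graded n (k + \<kappa>) g p" "graded n (k + \<kappa>) h q"
    using mult.hyps by (auto intro: graded_mono)
  have e1: "((g \<noteq> \<delta>) \<noteq> h) = ((g \<noteq> h) \<noteq> \<delta>)" and e2: "((h \<noteq> \<delta>) \<noteq> g) = ((g \<noteq> h) \<noteq> \<delta>)" by auto
  have 1: "graded n (k + \<kappa>) ((g \<noteq> h) \<noteq> \<delta>) (\<lambda>e. dp e * q e)"
    using graded.mult[OF d(1) pq(2)] unfolding e1 .
  have 2: "graded n (k + \<kappa>) ((g \<noteq> h) \<noteq> \<delta>) (\<lambda>e. dq e * p e)"
    using graded.mult[OF d(3) pq(1)] unfolding e2 .
  show ?case
    using graded.add[OF 1 2] d by (intro exI[of _ "\<lambda>e. dp e * q e + dq e * p e"]) (auto intro!: DERIV_mult)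
qed

section \<open>The derivations on the generators\<close>

definition x_curve :: "nat \<Rightarrow> nat \<Rightarrow> (real \<Rightarrow> symvar \<Rightarrow> real) \<Rightarrow> real \<Rightarrow> bool" where
  "x_curve n i c s \<longleftrightarrow> (\<exists>a T x \<xi>. good n a T x \<xi> \<and> c = (\<lambda>s. env n a (x(i := s)) \<xi>) \<and> s = x i)"

definition xi_curve :: "nat \<Rightarrow> nat \<Rightarrow> (real \<Rightarrow> symvar \<Rightarrow> real) \<Rightarrow> real \<Rightarrow> bool" where
  "xi_curve n i c s \<longleftrightarrow> (\<exists>a T x \<xi>. good n a T x \<xi> \<and> c = (\<lambda>s. env n a x (\<xi>(i := s))) \<and> s = \<xi> i)"

lemma good_sin_cos: "good n a T x \<xi> \<Longrightarrow> sin (x 2) > 0 \<and> cos (x 2) > 0 \<and> a (x 1) > 0"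
  unfolding good_def by (auto intro!: sin_gt_zero cos_gt_zero)

lemma good_jet:
  assumes "good n a T x \<xi>"
  shows "((deriv ^^ i) a has_real_derivative (deriv ^^ Suc i) a (x 1)) (at (x 1))"
proof -
  have "(deriv ^^ i) a differentiable (at (x 1))"
    using assms by (auto simp: good_def differentiable_on_eq_differentiable_at)
  then show ?thesis
    by (simp add: DERIV_deriv_iff_real_differentiable)
qed

lemma graded_uminus: "graded n k g p \<Longrightarrow> graded n k g (\<lambda>e. - p e)"
  using graded.mult[OF graded.const[of n k "-1"], of g p] by (simp add: of_rat_minus)

lemma graded_eqI: "graded n k g p \<Longrightarrow> g = h \<Longrightarrow> graded n k h p"
  by simp
lemma graded_add': "graded n k g p \<Longrightarrow> graded n k h q \<Longrightarrow> h = g \<Longrightarrow> graded n k g (\<lambda>e. p e + q e)"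
  by (simp add: graded.add)
lemma graded_numeral: "graded n k False (\<lambda>e. numeral c)"
  using graded.const[of n k "numeral c"] by simp
lemma graded_one: "graded n k False (\<lambda>e. 1)"
  using graded.const[of n k "1"] by simp

lemmas graded_rules = graded.var graded.mult graded_add' graded_numeral graded_one graded_uminus

text \<open>Only the jets, 1/a and 1/Q vary with x_1. The bound on the jets rises by one because
  \<open>Jet i\<close> is taken to \<open>Jet (Suc i)\<close>.\<close>

lemma graded_curve_x1:
  assumes "1 \<le> n" "admissible n k v"
  shows "\<exists>d. graded n (k + 1) (odd_var v \<noteq> False) d \<and>
      (\<forall>c s. x_curve n 1 c s \<longrightarrow> ((\<lambda>s. c s v) has_real_derivative d (c s)) (at s))"
proof (cases v)
  case (Jet i)
  with assms have "graded n (k+1) False (\<lambda>e. e (Jet (Suc i)))"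
    by (intro graded_eqI[OF graded.var]) auto
  then show ?thesis
    by (intro exI[of _ "\<lambda>e. e (Jet (Suc i))"])
       (use Jet in \<open>auto simp: x_curve_def dest: good_jet[where i=i]\<close>)
next
  case InvJet0
  have "graded n (k+1) False (\<lambda>e. - (e InvJet0 * e InvJet0 * e (Jet 1)))"
    by (rule graded_eqI, (rule graded_rules | (use assms in simp; fail))+)
  moreover have "((\<lambda>s. 1 / a s) has_real_derivative
      - (1 / a (x 1) * (1 / a (x 1)) * deriv a (x 1))) (at (x 1))" if "good n a T x \<xi>" for a T x \<xi>
    using good_jet[OF that, of 0] good_sin_cos[OF that]
    by (auto intro!: derivative_eq_intros)
  ultimately show ?thesis
    by (intro exI[of _ "\<lambda>e. - (e InvJet0 * e InvJet0 * e (Jet 1))"])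
       (use InvJet0 in \<open>auto simp: x_curve_def\<close>)
next
  case InvQ
  \<comment> \<open>The derivative of Q in x_1 is -2 (u_2^2 + u_3^2 + u_4^2) a' / a^3, as u_3 and
    u_4 do not depend on x_1.\<close>
  let ?d = "\<lambda>e. e InvQ * e InvQ * (2 * (e (UVar 2) * e (UVar 2) + e (UVar 3) * e (UVar 3) + e (UVar 4) * e (UVar 4))
    * e InvJet0 * e InvJet0 * e InvJet0 * e (Jet 1))"
  have "graded n (k+1) False ?d"
    by (rule graded_eqI, (rule graded_rules | (use assms in simp; fail))+)
  moreover have "((\<lambda>s. env n a (x(1 := s)) \<xi> InvQ) has_real_derivative ?d (env n a x \<xi>)) (at (x 1))"
    if "good n a T x \<xi>" for a T x \<xi>
  proof -
    have "conf_sq n a x \<xi> \<noteq> 0" using that by (simp add: good_def)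
    moreover have "((\<lambda>s. conf_sq n a (x(1 := s)) \<xi>) has_real_derivative
        - (2 * ((\<xi> 2)\<^sup>2 + (\<xi> 3 / sin (x 2))\<^sup>2 + (\<xi> 4 / cos (x 2))\<^sup>2) / a (x 1) ^ 3 * deriv a (x 1))) (at (x 1))"
      unfolding conf_sq_def using good_jet[OF that, of 0] good_sin_cos[OF that]
      by (auto intro!: derivative_eq_intros simp: power2_eq_square power3_eq_cube field_simps)
    ultimately show ?thesis
      by (auto intro!: derivative_eq_intros simp: power2_eq_square power3_eq_cube)
  qed
  ultimately show ?thesis
    by (intro exI[of _ ?d]) (use InvQ in \<open>auto simp: x_curve_def simp del: env.simps\<close>)
qed (auto intro!: exI[of _ "\<lambda>_. 0"] graded.zero simp: x_curve_def cong: if_cong)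

text \<open>For fixed \<xi> the coordinates u_3 and u_4 vary with \<eta>, with logarithmic
  derivatives -cot \<eta> and tan \<eta>. The identities cot \<eta> = s / u_0 and tan \<eta> = s /
  (1 - u_0) keep the result in the ring. Parity is reversed because \<eta> is odd under the
  reflection.\<close>

lemma graded_curve_x2:
  assumes "1 \<le> n" "admissible n k v"
  shows "\<exists>d. graded n (k + 0) (odd_var v \<noteq> True) d \<and>
      (\<forall>c s. x_curve n 2 c s \<longrightarrow> ((\<lambda>s. c s v) has_real_derivative d (c s)) (at s))"
proof -
  have *: ?thesis if "graded n k (odd_var v \<noteq> True) d"
    "\<And>a T x \<xi>. good n a T x \<xi> \<Longrightarrow> sin (x 2) > 0 \<Longrightarrow> cos (x 2) > 0 \<Longrightarrow>
       ((\<lambda>s. env n a (x(2 := s)) \<xi> v) has_real_derivative d (env n a x \<xi>)) (at (x 2))" for d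
    using that good_sin_cos by (intro exI[of _ d]) (auto simp: x_curve_def simp del: env.simps)
  have sc: "cos t * cos t = 1 - sin t * sin t" for t :: real
    using sin_cos_squared_add[of t] by (simp add: power2_eq_square)
  show ?thesis
  proof (cases v)
    case (UVar i)
    show ?thesis
    proof (cases "i = 0 \<or> i = 3 \<or> i = 4")
      case False
      then show ?thesis by (intro *[of "\<lambda>_. 0"]) (auto simp: UVar intro: graded.zero)
    next
      case True
      then consider "i = 0" | "i = 3" | "i = 4" by blast
      then show ?thesis
      proof cases
        case 1
        have "graded n k True (\<lambda>e. 2 * e SinCos)"
          by (rule graded_eqI, (rule graded_rules | (use assms in simp; fail))+)
        then show ?thesis
          by (intro *[of "\<lambda>e. 2 * e SinCos"]) (auto simp: UVar 1 intro!: derivative_eq_intros)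
      next
        case 2
        have "graded n k False (\<lambda>e. - (e (UVar 3) * e SinCos * e InvU0))"
          by (rule graded_eqI, (rule graded_rules | (use assms in \<open>simp add: UVar 2\<close>; fail))+)
        then show ?thesis
          by (intro *[of "\<lambda>e. - (e (UVar 3) * e SinCos * e InvU0)"])
             (auto simp: UVar 2 power2_eq_square field_simps intro!: derivative_eq_intros)
      next
        case 3
        have "graded n k True (\<lambda>e. (e (UVar 4) * e SinCos * e InvU0c))"
          by (rule graded_eqI, (rule graded_rules | (use assms in \<open>simp add: UVar 3\<close>; fail))+)
        then show ?thesis
          by (intro *[of "\<lambda>e. (e (UVar 4) * e SinCos * e InvU0c)"])
             (auto simp: UVar 3 power2_eq_square field_simps intro!: derivative_eq_intros)
      qed
    qed
  next
    case (Jet i)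
    then show ?thesis by (intro *[of "\<lambda>_. 0"]) (auto intro: graded.zero)
  next
    case SinCos
    have "graded n k False (\<lambda>e. 1 + - (2 * e (UVar 0)))"
      by (rule graded_eqI, (rule graded_rules | (use assms in simp; fail))+)
    then show ?thesis
      by (intro *[of "\<lambda>e. 1 + - (2 * e (UVar 0))"])
         (auto simp: SinCos power2_eq_square sc intro!: derivative_eq_intros)
  next
    case InvU0
    have "graded n k True (\<lambda>e. - (2 * e SinCos * e InvU0 * e InvU0))"
      by (rule graded_eqI, (rule graded_rules | (use assms in simp; fail))+)
    then show ?thesis
      by (intro *[of "\<lambda>e. - (2 * e SinCos * e InvU0 * e InvU0)"])
         (auto simp: InvU0 power2_eq_square field_simps intro!: derivative_eq_intros)
  next
    case InvU0c
    have "graded n k True (\<lambda>e. (2 * e SinCos * e InvU0c * e InvU0c))"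
      by (rule graded_eqI, (rule graded_rules | (use assms in simp; fail))+)
    then show ?thesis
      by (intro *[of "\<lambda>e. (2 * e SinCos * e InvU0c * e InvU0c)"])
         (auto simp: InvU0c power2_eq_square field_simps intro!: derivative_eq_intros)
  next
    case InvJet0
    then show ?thesis by (intro *[of "\<lambda>_. 0"]) (auto intro: graded.zero)
  next
    case InvQ
    let ?e = "\<lambda>e. (2 * e (UVar 3) * e (UVar 3) * e SinCos * e InvU0
      + - (2 * e (UVar 4) * e (UVar 4) * e SinCos * e InvU0c)) * e InvJet0 * e InvJet0"
    let ?d = "\<lambda>e. e InvQ * e InvQ * ?e e"
    have "graded n k True ?d"
      by (rule graded_eqI, (rule graded_rules | (use assms in simp; fail))+)
    moreover have "((\<lambda>s. env n a (x(2 := s)) \<xi> InvQ) has_real_derivative ?d (env n a x \<xi>)) (at (x 2))"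
      if "good n a T x \<xi>" for a T x \<xi>
    proof -
      have q: "conf_sq n a x \<xi> \<noteq> 0" using that by (simp add: good_def)
      have d3: "((\<lambda>s. (\<xi> 3 / sin s)\<^sup>2) has_real_derivative - (2 * (\<xi> 3)\<^sup>2 * cos (x 2) / sin (x 2) ^ 3)) (at (x 2))"
        using good_sin_cos[OF that]
        by (auto intro!: derivative_eq_intros simp: power2_eq_square power3_eq_cube field_simps)
      have d4: "((\<lambda>s. (\<xi> 4 / cos s)\<^sup>2) has_real_derivative (2 * (\<xi> 4)\<^sup>2 * sin (x 2) / cos (x 2) ^ 3)) (at (x 2))"
        using good_sin_cos[OF that]
        by (auto intro!: derivative_eq_intros simp: power2_eq_square power3_eq_cube field_simps)
      have "((\<lambda>s. conf_sq n a (x(2 := s)) \<xi>) has_real_derivative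
        (- (2 * (\<xi> 3)\<^sup>2 * cos (x 2) / sin (x 2) ^ 3) + 2 * (\<xi> 4)\<^sup>2 * sin (x 2) / cos (x 2) ^ 3) / (a (x 1))\<^sup>2) (at (x 2))"
        using DERIV_add[OF DERIV_add[OF DERIV_const[of "(\<xi> 1)\<^sup>2"]
            DERIV_cdivide[OF DERIV_add[OF DERIV_add[OF DERIV_const[of "(\<xi> 2)\<^sup>2"] d3] d4], of "(a (x 1))\<^sup>2"]]
            DERIV_const[of "\<Sum>i=5..2*n+2. (\<xi> i)\<^sup>2"]]
        by (simp add: conf_sq_def)
      then have D: "((\<lambda>s. env n a (x(2 := s)) \<xi> InvQ) has_real_derivative
        - ((- (2 * (\<xi> 3)\<^sup>2 * cos (x 2) / sin (x 2) ^ 3) + 2 * (\<xi> 4)\<^sup>2 * sin (x 2) / cos (x 2) ^ 3) / (a (x 1))\<^sup>2) / (conf_sq n a x \<xi>)\<^sup>2) (at (x 2))"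
        using q by (auto intro!: derivative_eq_intros simp: power2_eq_square)
      have E: "- ((- (2 * (\<xi> 3)\<^sup>2 * cos (x 2) / sin (x 2) ^ 3) + 2 * (\<xi> 4)\<^sup>2 * sin (x 2) / cos (x 2) ^ 3) / (a (x 1))\<^sup>2) = ?e (env n a x \<xi>)"
        using good_sin_cos[OF that]
        by (simp add: power2_eq_square power3_eq_cube) (simp add: field_simps)
      have "- ((- (2 * (\<xi> 3)\<^sup>2 * cos (x 2) / sin (x 2) ^ 3) + 2 * (\<xi> 4)\<^sup>2 * sin (x 2) / cos (x 2) ^ 3) / (a (x 1))\<^sup>2) / (conf_sq n a x \<xi>)\<^sup>2 = ?d (env n a x \<xi>)"
        unfolding E[symmetric] by (simp add: power2_eq_square)
      with D show ?thesis by (simp only:)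
    qed
    ultimately show ?thesis
      by (intro *[of ?d]) (auto simp: InvQ simp del: env.simps)
  qed
qed

text \<open>Parity is reversed exactly for i = 2, as \<xi>_2 changes sign under the reflection. The
  directions 3 and 4 are excluded since they would produce csc \<eta> and sec \<eta>.\<close>

lemma graded_curve_xi:
  assumes "1 \<le> n" "admissible n k v" and i: "i = 1 \<or> i = 2"
  shows "\<exists>d. graded n (k + 0) (odd_var v \<noteq> (i = 2)) d \<and>
      (\<forall>c s. xi_curve n i c s \<longrightarrow> ((\<lambda>s. c s v) has_real_derivative d (c s)) (at s))"
proof (cases v)
  case (UVar j)
  show ?thesis
  proof (cases "j = i")
    case True
    then show ?thesis using i by (intro exI[of _ "\<lambda>_. 1"]) (auto simp: UVar xi_curve_def graded_one)
  next
    case False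
    then show ?thesis
      using i by (intro exI[of _ "\<lambda>_. 0"]) (auto simp: UVar xi_curve_def graded.zero cong: if_cong)
  qed
next
  case InvQ
  let ?d = "\<lambda>e. - (2 * e (UVar i) * (if i = 1 then 1 else e InvJet0 * e InvJet0) * e InvQ * e InvQ)"
  have "graded n k (i = 2) ?d"
  proof (cases "i = 1")
    case True
    have "graded n k False (\<lambda>e. - (2 * e (UVar 1) * 1 * e InvQ * e InvQ))"
      by (rule graded_eqI, (rule graded_rules | (use assms in simp; fail))+)
    then show ?thesis using True by simp
  next
    case False
    have "graded n k True (\<lambda>e. - (2 * e (UVar 2) * (e InvJet0 * e InvJet0) * e InvQ * e InvQ))"
      by (rule graded_eqI, (rule graded_rules | (use assms in simp; fail))+)
    then show ?thesis using False i by simp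
  qed
  moreover have "((\<lambda>s. env n a x (\<xi>(i := s)) InvQ) has_real_derivative ?d (env n a x \<xi>)) (at (\<xi> i))"
    if "good n a T x \<xi>" for a T x \<xi>
  proof -
    have "conf_sq n a x \<xi> \<noteq> 0" using that by (simp add: good_def)
    moreover have rest: "(\<Sum>j=5..2*n+2. ((\<xi>(i := s)) j)\<^sup>2) = (\<Sum>j=5..2*n+2. (\<xi> j)\<^sup>2)" for s
      using i by (intro sum.cong) auto
    have "((\<lambda>s. conf_sq n a x (\<xi>(i := s))) has_real_derivative
        2 * \<xi> i * (if i = 1 then 1 else 1 / (a (x 1))\<^sup>2)) (at (\<xi> i))"
      unfolding conf_sq_def rest using good_sin_cos[OF that] i
      by (auto intro!: derivative_eq_intros simp: power2_eq_square power4_eq_xxxx field_simps)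
    ultimately show ?thesis
      using i by (auto intro!: derivative_eq_intros simp: power2_eq_square)
  qed
  ultimately show ?thesis
    by (intro exI[of _ ?d]) (auto simp: InvQ xi_curve_def simp del: env.simps)
qed (auto simp: xi_curve_def intro!: graded.zero exI[of _ "\<lambda>_. 0"])

section \<open>Matrix-valued symbols\<close>

text \<open>A derivative depends on the symbol near the point, so a representation at good points
  can be differentiated only if nearby points of the coordinate line are good as well.\<close>

lemma good_nhds_x:
  assumes "good n a T x \<xi>"
  shows "eventually (\<lambda>s. good n a T (x(i := s)) \<xi>) (nhds (x i))"
proof -
  have T: "open T" and x1: "x 1 \<in> T" and x2: "x 2 \<in> {0<..<pi/2}" using assms by (auto simp: good_def)
  have cont: "((\<lambda>s. (x(i := s)) j) \<longlongrightarrow> x j) (nhds (x i))" for j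
    by (cases "j = i") (auto simp: filterlim_ident)
  have "isCont a (x 1)"
    using good_jet[OF assms, of 0] by (auto intro: DERIV_isCont)
  then have a: "((\<lambda>s. a ((x(i := s)) 1)) \<longlongrightarrow> a (x 1)) (nhds (x i))"
    using cont[of 1] isCont_tendsto_compose by blast
  have "((\<lambda>s. conf_sq n a (x(i := s)) \<xi>) \<longlongrightarrow> conf_sq n a x \<xi>) (nhds (x i))"
    unfolding conf_sq_def using good_sin_cos[OF assms] a cont[of 2] by (intro tendsto_intros) auto
  then have "eventually (\<lambda>s. conf_sq n a (x(i := s)) \<xi> \<noteq> 0) (nhds (x i))"
    by (rule tendsto_imp_eventually_ne) (use assms in \<open>simp add: good_def\<close>)
  moreover have "eventually (\<lambda>s. (x(i := s)) 1 \<in> T) (nhds (x i))"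
    using topological_tendstoD[OF cont T x1] .
  moreover have "eventually (\<lambda>s. (x(i := s)) 2 \<in> {0<..<pi/2}) (nhds (x i))"
    using topological_tendstoD[OF cont _ x2] by simp
  ultimately show ?thesis
    by eventually_elim (use assms in \<open>auto simp: good_def\<close>)
qed

lemma good_nhds_xi:
  assumes "good n a T x \<xi>"
  shows "eventually (\<lambda>s. good n a T x (\<xi>(i := s))) (nhds (\<xi> i))"
proof -
  have cont: "((\<lambda>s. (\<xi>(i := s)) j) \<longlongrightarrow> \<xi> j) (nhds (\<xi> i))" for j
    by (cases "j = i") (auto simp: filterlim_ident)
  have "((\<lambda>s. conf_sq n a x (\<xi>(i := s))) \<longlongrightarrow> conf_sq n a x \<xi>) (nhds (\<xi> i))"
    unfolding conf_sq_def using good_sin_cos[OF assms] by (intro tendsto_intros cont) auto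
  then have "eventually (\<lambda>s. conf_sq n a x (\<xi>(i := s)) \<noteq> 0) (nhds (\<xi> i))"
    by (rule tendsto_imp_eventually_ne) (use assms in \<open>simp add: good_def\<close>)
  then show ?thesis
    by eventually_elim (use assms in \<open>auto simp: good_def\<close>)
qed

type_synonym 'c family = "(real \<Rightarrow> real) \<Rightarrow> (nat \<Rightarrow> real) \<Rightarrow> (nat \<Rightarrow> real) \<Rightarrow> 'c"

abbreviation represents ::
    "nat \<Rightarrow> complex family \<Rightarrow> ((symvar \<Rightarrow> real) \<Rightarrow> real) \<Rightarrow> ((symvar \<Rightarrow> real) \<Rightarrow> real) \<Rightarrow> bool" where
  "represents n f p q \<equiv>
     \<forall>a T x \<xi>. good n a T x \<xi> \<longrightarrow> f a x \<xi> = Complex (p (env n a x \<xi>)) (q (env n a x \<xi>))"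

text \<open>Real and imaginary part are represented separately, which keeps all coefficients
  rational. One pair of polynomials serves all \<open>a\<close>, \<open>T\<close>, \<open>x\<close>
  and \<open>\<xi>\<close>.\<close>

definition scalar_rep :: "nat \<Rightarrow> nat \<Rightarrow> bool \<Rightarrow> complex family \<Rightarrow> bool" where
  "scalar_rep n k g f \<longleftrightarrow> (\<exists>p q. graded n k g p \<and> graded n k g q \<and> represents n f p q)"

lemma scalar_rep_cong:
  assumes "scalar_rep n k g f" "\<And>a T x \<xi>. good n a T x \<xi> \<Longrightarrow> f' a x \<xi> = f a x \<xi>"
  shows "scalar_rep n k g f'"
  using assms unfolding scalar_rep_def by metis

lemma scalar_rep_eqI: "scalar_rep n k g f \<Longrightarrow> g = h \<Longrightarrow> scalar_rep n k h f"
  by simp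

lemma scalar_rep_mono: "scalar_rep n k g f \<Longrightarrow> k \<le> k' \<Longrightarrow> scalar_rep n k' g f"
  unfolding scalar_rep_def using graded_mono by blast

lemma scalar_rep_zero: "scalar_rep n k g (\<lambda>a x \<xi>. 0)"
  unfolding scalar_rep_def by (intro exI[of _ "\<lambda>_. 0"]) (auto intro: graded.zero simp: zero_complex.code)

lemma scalar_rep_rat: "scalar_rep n k False (\<lambda>a x \<xi>. of_real (of_rat c))"
  unfolding scalar_rep_def
  by (rule exI[of _ "\<lambda>_. of_rat c"], rule exI[of _ "\<lambda>_. 0"])
     (auto intro: graded.zero graded.const simp: complex_of_real_def)

lemma scalar_rep_ii: "scalar_rep n k False (\<lambda>a x \<xi>. \<i>)"
  unfolding scalar_rep_def
  by (rule exI[of _ "\<lambda>_. 0"], rule exI[of _ "\<lambda>_. 1"])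
     (auto intro: graded.zero graded_one simp: imaginary_unit.code)

lemma scalar_rep_var:
  "admissible n k v \<Longrightarrow> scalar_rep n k (odd_var v) (\<lambda>a x \<xi>. of_real (env n a x \<xi> v))"
  unfolding scalar_rep_def
  by (rule exI[of _ "\<lambda>e. e v"], rule exI[of _ "\<lambda>_. 0"])
     (auto intro: graded.zero graded.var simp: complex_of_real_def)

lemma scalar_rep_add:
  assumes "scalar_rep n k g f" "scalar_rep n k g f'"
  shows "scalar_rep n k g (\<lambda>a x \<xi>. f a x \<xi> + f' a x \<xi>)"
proof -
  obtain p q where 1: "graded n k g p" "graded n k g q" "represents n f p q"
    using assms(1) unfolding scalar_rep_def by blast
  obtain p' q' where 2: "graded n k g p'" "graded n k g q'" "represents n f' p' q'"
    using assms(2) unfolding scalar_rep_def by blast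
  show ?thesis
    unfolding scalar_rep_def
    by (rule exI[of _ "\<lambda>e. p e + p' e"], rule exI[of _ "\<lambda>e. q e + q' e"])
       (auto intro!: graded.add simp: 1 2 complex_eq_iff)
qed

lemma scalar_rep_mult:
  assumes "scalar_rep n k g f" "scalar_rep n k h f'"
  shows "scalar_rep n k (g \<noteq> h) (\<lambda>a x \<xi>. f a x \<xi> * f' a x \<xi>)"
proof -
  obtain p q where 1: "graded n k g p" "graded n k g q" "represents n f p q"
    using assms(1) unfolding scalar_rep_def by blast
  obtain p' q' where 2: "graded n k h p'" "graded n k h q'" "represents n f' p' q'"
    using assms(2) unfolding scalar_rep_def by blast
  show ?thesis
    unfolding scalar_rep_def
  proof (intro exI conjI allI impI)
    show "graded n k (g \<noteq> h) (\<lambda>e. p e * p' e + - (q e * q' e))" "graded n k (g \<noteq> h) (\<lambda>e. p e * q' e + q e * p' e)"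
      by (intro graded.add graded_uminus graded.mult 1 2)+
    fix a T x \<xi> assume "good n a T x \<xi>"
    then show "f a x \<xi> * f' a x \<xi> = Complex (p (env n a x \<xi>) * p' (env n a x \<xi>) + - (q (env n a x \<xi>) * q' (env n a x \<xi>)))
        (p (env n a x \<xi>) * q' (env n a x \<xi>) + q (env n a x \<xi>) * p' (env n a x \<xi>))"
      by (simp add: 1(3) 2(3) complex_eq_iff)
  qed
qed

lemma scalar_rep_uminus:
  assumes "scalar_rep n k g f"
  shows "scalar_rep n k g (\<lambda>a x \<xi>. - f a x \<xi>)"
  using scalar_rep_mult[OF scalar_rep_rat[of n k "-1"] assms] by (simp add: of_rat_minus)

lemma scalar_rep_diff:
  assumes "scalar_rep n k g f" "scalar_rep n k g f'"
  shows "scalar_rep n k g (\<lambda>a x \<xi>. f a x \<xi> - f' a x \<xi>)"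
  using scalar_rep_add[OF assms(1) scalar_rep_uminus[OF assms(2)]] by simp

lemma scalar_rep_sum:
  "(\<And>i. i \<in> A \<Longrightarrow> scalar_rep n k g (f i)) \<Longrightarrow> scalar_rep n k g (\<lambda>a x \<xi>. \<Sum>i\<in>A. f i a x \<xi>)"
  by (induction A rule: infinite_finite_induct) (simp_all add: scalar_rep_zero scalar_rep_add)

lemma scalar_rep_power:
  assumes "scalar_rep n k False f"
  shows "scalar_rep n k False (\<lambda>a x \<xi>. f a x \<xi> ^ m)"
proof (induction m)
  case 0
  show ?case using scalar_rep_rat[of n k 1] by simp
next
  case (Suc m)
  show ?case using scalar_rep_mult[OF assms Suc] by simp
qed

text \<open>
  The symbol of the Dirac operator takes values in \<open>2 \<times> 2\<close> matrices over the complexified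
  quaternions; \<open>quat_conj\<close> is the antilinear algebra automorphism fixing the real form.
\<close>

definition quat_swap :: "4 \<Rightarrow> 4" where
  "quat_swap j = (if j = 1 then 2 else if j = 2 then 1 else if j = 3 then 4 else 3)"

definition quat_sign :: "4 \<Rightarrow> real" where
  "quat_sign j = (if j = 2 \<or> j = 3 then - 1 else 1)"

definition quat_conj :: "complex^4^4 \<Rightarrow> complex^4^4" where
  "quat_conj M = (\<chi> j k. of_real (quat_sign j * quat_sign k) * cnj (M $ quat_swap j $ quat_swap k))"

text \<open>\<open>quat_conj\<close> conjugates the entries and then the matrix by a signed
  permutation matrix, which is orthogonal.\<close>

lemma quat_conj_mult: "quat_conj (M ** N) = quat_conj M ** quat_conj N"
  by (simp add: vec_eq_iff forall_4 quat_conj_def quat_swap_def quat_sign_def matrix_matrix_mult_def sum_4)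

lemma quat_conj_add: "quat_conj (M + N) = quat_conj M + quat_conj N"
  by (simp add: vec_eq_iff quat_conj_def algebra_simps)

lemma quat_conj_scaleR: "quat_conj (r *\<^sub>R M) = r *\<^sub>R quat_conj M"
  by (simp add: vec_eq_iff quat_conj_def)

lemma quat_conj_bounded_linear: "bounded_linear quat_conj"
  unfolding linear_conv_bounded_linear[symmetric]
  by (rule linearI) (simp_all add: quat_conj_add quat_conj_scaleR)

lemma quat_conj_mat: "quat_conj (mat c) = mat (cnj c)"
  by (simp add: vec_eq_iff forall_4 quat_conj_def quat_swap_def quat_sign_def mat_def)

lemma quat_conj_zero [simp]: "quat_conj 0 = 0"
  by (simp add: vec_eq_iff quat_conj_def)

text \<open>The diagonal entries of a fixed matrix come in complex conjugate pairs, one pair in each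
  block.\<close>

lemma Im_trace_quat_conj:
  assumes "quat_conj M = M"
  shows "Im (trace M) = 0"
proof -
  have "M $ 1 $ 1 = cnj (M $ 2 $ 2)" "M $ 3 $ 3 = cnj (M $ 4 $ 4)"
    using arg_cong[OF assms, of "\<lambda>M. M $ 1 $ 1"] arg_cong[OF assms, of "\<lambda>M. M $ 3 $ 3"]
    by (simp_all add: quat_conj_def quat_swap_def quat_sign_def)
  then show ?thesis by (simp add: trace_def sum_4)
qed

definition odd_row :: "4 \<Rightarrow> bool" where
  "odd_row j \<longleftrightarrow> j = 2 \<or> j = 4"

text \<open>\<open>g\<close> is the parity under the reflection, corrected entrywise by conjugation
  with diag(1, -1, 1, -1); \<open>c\<close> mod 2 is the sign under charge conjugation. In what
  follows \<open>c\<close> is 1 for q_1, 0 for q_0, k for p_k and N for the N-th term of the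
  parametrix, so it is the order of the symbol mod 2.\<close>

definition matrix_rep :: "nat \<Rightarrow> nat \<Rightarrow> bool \<Rightarrow> nat \<Rightarrow> (complex^4^4) family \<Rightarrow> bool" where
  "matrix_rep n k g c F \<longleftrightarrow>
     (\<forall>i j. scalar_rep n k (g \<noteq> (odd_row i \<noteq> odd_row j)) (\<lambda>a x \<xi>. F a x \<xi> $ i $ j)) \<and>
     (\<forall>a T x \<xi>. good n a T x \<xi> \<longrightarrow> quat_conj (F a x \<xi>) = (-1) ^ c *\<^sub>R F a x \<xi>)"

lemma matrix_rep_cong:
  assumes "matrix_rep n k g c F" "\<And>a T x \<xi>. good n a T x \<xi> \<Longrightarrow> F' a x \<xi> = F a x \<xi>"
  shows "matrix_rep n k g c F'"
proof -
  have "scalar_rep n k (g \<noteq> (odd_row i \<noteq> odd_row j)) (\<lambda>a x \<xi>. F' a x \<xi> $ i $ j)" for i j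
    by (rule scalar_rep_cong[of n k _ "\<lambda>a x \<xi>. F a x \<xi> $ i $ j"])
       (use assms in \<open>simp_all add: matrix_rep_def\<close>)
  then show ?thesis using assms by (simp add: matrix_rep_def)
qed

lemma matrix_rep_mono: "matrix_rep n k g c F \<Longrightarrow> k \<le> k' \<Longrightarrow> matrix_rep n k' g c F"
  unfolding matrix_rep_def using scalar_rep_mono by blast

lemma matrix_rep_parity:
  assumes "matrix_rep n k g c F" "even (c + c')"
  shows "matrix_rep n k g c' F"
proof -
  have "(-1 :: real) ^ c = (-1) ^ c'"
    using assms(2) by (auto simp: minus_one_power_iff)
  then show ?thesis using assms(1) by (simp add: matrix_rep_def)
qed

lemma matrix_rep_zero: "matrix_rep n k g c (\<lambda>a x \<xi>. 0)"
  by (simp add: matrix_rep_def scalar_rep_zero)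

lemma matrix_rep_add:
  assumes "matrix_rep n k g c F" "matrix_rep n k g c G"
  shows "matrix_rep n k g c (\<lambda>a x \<xi>. F a x \<xi> + G a x \<xi>)"
  using assms by (simp add: matrix_rep_def quat_conj_add scaleR_add_right scalar_rep_add)

lemma matrix_rep_uminus:
  assumes "matrix_rep n k g c F"
  shows "matrix_rep n k g c (\<lambda>a x \<xi>. - F a x \<xi>)"
  using assms quat_conj_scaleR[of "-1"] by (simp add: matrix_rep_def scalar_rep_uminus)

lemma matrix_rep_diff:
  assumes "matrix_rep n k g c F" "matrix_rep n k g c G"
  shows "matrix_rep n k g c (\<lambda>a x \<xi>. F a x \<xi> - G a x \<xi>)"
  using matrix_rep_add[OF assms(1) matrix_rep_uminus[OF assms(2)]] by simp

lemma matrix_rep_sum: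
  "(\<And>i. i \<in> A \<Longrightarrow> matrix_rep n k g c (F i)) \<Longrightarrow> matrix_rep n k g c (\<lambda>a x \<xi>. \<Sum>i\<in>A. F i a x \<xi>)"
  by (induction A rule: infinite_finite_induct) (simp_all add: matrix_rep_zero matrix_rep_add)

lemma scaleR_matrix_mult:
  fixes A :: "'a::real_algebra_1 ^ 'n ^ 'm" and B :: "'a ^ 'k ^ 'n"
  shows "(r *\<^sub>R A) ** (s *\<^sub>R B) = (r * s) *\<^sub>R (A ** B)"
  by (simp add: vec_eq_iff matrix_matrix_mult_def scaleR_sum_right mult.commute)

lemma matrix_rep_mult:
  assumes "matrix_rep n k g c F" "matrix_rep n k h d G"
  shows "matrix_rep n k (g \<noteq> h) (c + d) (\<lambda>a x \<xi>. F a x \<xi> ** G a x \<xi>)"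
proof -
  have "scalar_rep n k ((g \<noteq> h) \<noteq> (odd_row i \<noteq> odd_row j)) (\<lambda>a x \<xi>. F a x \<xi> $ i $ l * G a x \<xi> $ l $ j)" for i j l
  proof -
    have "((g \<noteq> (odd_row i \<noteq> odd_row l)) \<noteq> (h \<noteq> (odd_row l \<noteq> odd_row j))) = ((g \<noteq> h) \<noteq> (odd_row i \<noteq> odd_row j))"
      by auto
    moreover have "scalar_rep n k ((g \<noteq> (odd_row i \<noteq> odd_row l)) \<noteq> (h \<noteq> (odd_row l \<noteq> odd_row j)))
        (\<lambda>a x \<xi>. F a x \<xi> $ i $ l * G a x \<xi> $ l $ j)"
      using assms by (intro scalar_rep_mult) (simp_all only: matrix_rep_def)
    ultimately show ?thesis by (simp only:)
  qed
  moreover have "quat_conj (F a x \<xi> ** G a x \<xi>) = (-1) ^ (c + d) *\<^sub>R (F a x \<xi> ** G a x \<xi>)"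
    if "good n a T x \<xi>" for a T x \<xi>
    using assms that
    by (simp add: quat_conj_mult matrix_rep_def power_add scaleR_matrix_mult)
  ultimately show ?thesis
    unfolding matrix_rep_def by (simp add: matrix_matrix_mult_def scalar_rep_sum)
qed

lemma matrix_rep_mat:
  assumes "scalar_rep n k False f" "\<And>a T x \<xi>. good n a T x \<xi> \<Longrightarrow> cnj (f a x \<xi>) = (-1) ^ c * f a x \<xi>"
  shows "matrix_rep n k False c (\<lambda>a x \<xi>. mat (f a x \<xi>))"
proof -
  have "scalar_rep n k (False \<noteq> (odd_row i \<noteq> odd_row j)) (\<lambda>a x \<xi>. mat (f a x \<xi>) $ i $ j)" for i j :: 4
    using assms(1) by (cases "i = j") (simp_all add: mat_def scalar_rep_zero)
  moreover have "quat_conj (mat (f a x \<xi>)) = (- 1) ^ c *\<^sub>R mat (f a x \<xi>)" if "good n a T x \<xi>" for a T x \<xi>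
    using assms(2)[OF that] unfolding quat_conj_mat by (cases "even c") (simp_all add: vec_eq_iff mat_def)
  ultimately show ?thesis
    by (simp add: matrix_rep_def)
qed

lemma has_vector_derivative_vec:
  fixes f :: "real \<Rightarrow> 'b::real_normed_vector ^ 'n"
  assumes "\<And>i. ((\<lambda>s. f s $ i) has_vector_derivative d $ i) F"
  shows "(f has_vector_derivative d) F"
  unfolding has_vector_derivative_def has_derivative_def
proof
  show "bounded_linear (\<lambda>x. x *\<^sub>R d)" by (rule bounded_linear_scaleR_left)
  show "((\<lambda>y. (f y - f (Lim F (\<lambda>x. x)) - (y - Lim F (\<lambda>x. x)) *\<^sub>R d) /\<^sub>R
           norm (y - Lim F (\<lambda>x. x))) \<longlongrightarrow> 0) F"
    using assms by (intro vec_tendstoI) (simp add: has_vector_derivative_def has_derivative_def)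
qed

section \<open>The parametrix\<close>

lemma has_vector_derivative_transform_eventually:
  assumes "eventually (\<lambda>s. f s = g s) (nhds t)" "(g has_vector_derivative d) (at t)"
  shows "(f has_vector_derivative d) (at t)"
proof -
  have "f t = g t" using assms(1) by (rule eventually_nhds_x_imp_x)
  moreover have "eventually (\<lambda>s. g s = f s) (at t)"
    using assms(1) by (auto simp: eventually_nhds_conv_at elim: eventually_mono)
  ultimately show ?thesis
    using has_derivative_transform_eventually[of g _ t UNIV f] assms(2)
    by (simp add: has_vector_derivative_def)
qed

text \<open>
  Common to the derivatives with respect to the \<open>x\<^sub>i\<close> and the \<open>\<xi>\<^sub>i\<close>: \<open>(X x, Y \<xi>)\<close> is the curve through
  \<open>(x, \<xi>)\<close>, which it passes at the parameter \<open>base x \<xi>\<close>.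
\<close>

lemma scalar_rep_deriv:
  assumes f: "scalar_rep n k g f"
    and curve: "\<And>v k. admissible n k v \<Longrightarrow> \<exists>d. graded n (k + \<kappa>) (odd_var v \<noteq> \<delta>) d \<and>
      (\<forall>c s. C c s \<longrightarrow> ((\<lambda>s. c s v) has_real_derivative d (c s)) (at s))"
    and C: "\<And>a T x \<xi>. good n a T x \<xi> \<Longrightarrow> C (\<lambda>s. env n a (X x s) (Y \<xi> s)) (base x \<xi>)"
    and base: "\<And>x \<xi>. X x (base x \<xi>) = x" "\<And>x \<xi>. Y \<xi> (base x \<xi>) = \<xi>"
    and ev: "\<And>a T x \<xi>. good n a T x \<xi> \<Longrightarrow> eventually (\<lambda>s. good n a T (X x s) (Y \<xi> s)) (nhds (base x \<xi>))"
  shows "\<exists>f'. scalar_rep n (k + \<kappa>) (g \<noteq> \<delta>) f' \<and> (\<forall>a T x \<xi>. good n a T x \<xi> \<longrightarrow>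
    ((\<lambda>s. f a (X x s) (Y \<xi> s)) has_vector_derivative f' a x \<xi>) (at (base x \<xi>)))"
proof -
  obtain p q where p: "graded n k g p" and q: "graded n k g q"
    and fpq: "\<And>a T x \<xi>. good n a T x \<xi> \<Longrightarrow> f a x \<xi> = Complex (p (env n a x \<xi>)) (q (env n a x \<xi>))"
    using f unfolding scalar_rep_def by blast
  obtain dp where dp: "graded n (k + \<kappa>) (g \<noteq> \<delta>) dp"
      "\<And>c s. C c s \<Longrightarrow> ((\<lambda>s. p (c s)) has_real_derivative dp (c s)) (at s)"
    using graded_deriv[OF curve p] by blast
  obtain dq where dq: "graded n (k + \<kappa>) (g \<noteq> \<delta>) dq"
      "\<And>c s. C c s \<Longrightarrow> ((\<lambda>s. q (c s)) has_real_derivative dq (c s)) (at s)"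
    using graded_deriv[OF curve q] by blast
  let ?f' = "\<lambda>a x \<xi>. Complex (dp (env n a x \<xi>)) (dq (env n a x \<xi>))"
  have "((\<lambda>s. f a (X x s) (Y \<xi> s)) has_vector_derivative ?f' a x \<xi>) (at (base x \<xi>))"
    if good: "good n a T x \<xi>" for a T x \<xi>
  proof (rule has_vector_derivative_transform_eventually)
    let ?c = "\<lambda>s. env n a (X x s) (Y \<xi> s)"
    show "eventually (\<lambda>s. f a (X x s) (Y \<xi> s) = Complex (p (?c s)) (q (?c s))) (nhds (base x \<xi>))"
      using ev[OF good] by eventually_elim (rule fpq)
    show "((\<lambda>s. Complex (p (?c s)) (q (?c s))) has_vector_derivative ?f' a x \<xi>) (at (base x \<xi>))"
      unfolding has_vector_derivative_complex_iff
      using dp(2)[OF C[OF good]] dq(2)[OF C[OF good]] by (simp add: base)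
  qed
  moreover have "scalar_rep n (k + \<kappa>) (g \<noteq> \<delta>) ?f'"
    unfolding scalar_rep_def using dp(1) dq(1) by blast
  ultimately show ?thesis by blast
qed

text \<open>\<open>quat_conj\<close> is antilinear over the complex numbers but linear over the
  reals, and the parameter is real. Hence it commutes with the derivative, and the sign under charge
  conjugation persists.\<close>

lemma matrix_rep_deriv:
  assumes F: "matrix_rep n k g c F"
    and curve: "\<And>v k. admissible n k v \<Longrightarrow> \<exists>d. graded n (k + \<kappa>) (odd_var v \<noteq> \<delta>) d \<and>
      (\<forall>c s. C c s \<longrightarrow> ((\<lambda>s. c s v) has_real_derivative d (c s)) (at s))"
    and C: "\<And>a T x \<xi>. good n a T x \<xi> \<Longrightarrow> C (\<lambda>s. env n a (X x s) (Y \<xi> s)) (base x \<xi>)"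
    and base: "\<And>x \<xi>. X x (base x \<xi>) = x" "\<And>x \<xi>. Y \<xi> (base x \<xi>) = \<xi>"
    and ev: "\<And>a T x \<xi>. good n a T x \<xi> \<Longrightarrow> eventually (\<lambda>s. good n a T (X x s) (Y \<xi> s)) (nhds (base x \<xi>))"
    and D: "\<And>a x \<xi>. D a x \<xi> = vector_derivative (\<lambda>s. F a (X x s) (Y \<xi> s)) (at (base x \<xi>))"
  shows "matrix_rep n (k + \<kappa>) (g \<noteq> \<delta>) c D"
proof -
  \<comment> \<open>The entries of the derivative are chosen once for all \<open>a\<close>,
    \<open>x\<close> and \<open>\<xi>\<close>; a choice at each point would not give a uniform
    representation.\<close>
  define is_d where "is_d i j f' \<longleftrightarrow> scalar_rep n (k + \<kappa>) ((g \<noteq> (odd_row i \<noteq> odd_row j)) \<noteq> \<delta>) f' \<and>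
      (\<forall>a T x \<xi>. good n a T x \<xi> \<longrightarrow>
        ((\<lambda>s. F a (X x s) (Y \<xi> s) $ i $ j) has_vector_derivative f' a x \<xi>) (at (base x \<xi>)))" for i j f'
  define d where "d i j = (SOME f'. is_d i j f')" for i j
  have d: "is_d i j (d i j)" for i j
    unfolding d_def
  proof (rule someI_ex[of "is_d i j"])
    have "scalar_rep n k (g \<noteq> (odd_row i \<noteq> odd_row j)) (\<lambda>a x \<xi>. F a x \<xi> $ i $ j)"
      using F by (simp only: matrix_rep_def)
    from scalar_rep_deriv[OF this curve C base ev]
    show "\<exists>f'. is_d i j f'" unfolding is_d_def .
  qed
  let ?M = "\<lambda>a x \<xi>. \<chi> i j. d i j a x \<xi>"
  have deriv: "((\<lambda>s. F a (X x s) (Y \<xi> s)) has_vector_derivative ?M a x \<xi>) (at (base x \<xi>))"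
    if "good n a T x \<xi>" for a T x \<xi>
    using d that by (intro has_vector_derivative_vec) (auto simp: is_d_def)
  then have DM: "D a x \<xi> = ?M a x \<xi>" if "good n a T x \<xi>" for a T x \<xi>
    using that unfolding D by (intro vector_derivative_at) auto
  have "quat_conj (D a x \<xi>) = (-1) ^ c *\<^sub>R D a x \<xi>" if good: "good n a T x \<xi>" for a T x \<xi>
  proof -
    let ?f = "\<lambda>s. F a (X x s) (Y \<xi> s)"
    have d: "(?f has_vector_derivative D a x \<xi>) (at (base x \<xi>))"
      using deriv[OF good] DM[OF good] by simp
    have 1: "((\<lambda>s. quat_conj (?f s)) has_vector_derivative quat_conj (D a x \<xi>)) (at (base x \<xi>))"
      by (rule bounded_linear.has_vector_derivative[OF quat_conj_bounded_linear d])
    have 2: "((\<lambda>s. (-1) ^ c *\<^sub>R ?f s) has_vector_derivative (-1) ^ c *\<^sub>R D a x \<xi>) (at (base x \<xi>))"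
      by (rule bounded_linear.has_vector_derivative[OF bounded_linear_scaleR_right d])
    have 3: "eventually (\<lambda>s. quat_conj (?f s) = (-1) ^ c *\<^sub>R ?f s) (nhds (base x \<xi>))"
      using ev[OF good] by eventually_elim (use F in \<open>auto simp: matrix_rep_def\<close>)
    show ?thesis
      by (rule vector_derivative_unique_at[OF 1 has_vector_derivative_transform_eventually[OF 3 2]])
  qed
  moreover have "scalar_rep n (k + \<kappa>) ((g \<noteq> \<delta>) \<noteq> (odd_row i \<noteq> odd_row j)) (\<lambda>a x \<xi>. D a x \<xi> $ i $ j)" for i j
  proof (rule scalar_rep_cong[OF scalar_rep_eqI])
    show "scalar_rep n (k + \<kappa>) ((g \<noteq> (odd_row i \<noteq> odd_row j)) \<noteq> \<delta>) (d i j)"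
      using d[of i j] by (simp only: is_d_def)
  qed (auto simp: DM)
  ultimately show ?thesis
    unfolding matrix_rep_def by blast
qed

lemma matrix_rep_x_deriv:
  assumes F: "matrix_rep n k g c F"
    and curve: "\<And>v k. admissible n k v \<Longrightarrow> \<exists>d. graded n (k + \<kappa>) (odd_var v \<noteq> \<delta>) d \<and>
      (\<forall>c s. x_curve n i c s \<longrightarrow> ((\<lambda>s. c s v) has_real_derivative d (c s)) (at s))"
  shows "matrix_rep n (k + \<kappa>) (g \<noteq> \<delta>) c (\<lambda>a. x_deriv i (F a))"
  by (rule matrix_rep_deriv[OF F curve, where X="\<lambda>x s. x(i := s)" and Y="\<lambda>\<xi> s. \<xi>" and base="\<lambda>x \<xi>. x i"])
     (auto simp: x_deriv_def partial_deriv_def intro: good_nhds_x, unfold x_curve_def, blast)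

lemma matrix_rep_xi_deriv:
  assumes F: "matrix_rep n k g c F"
    and curve: "\<And>v k. admissible n k v \<Longrightarrow> \<exists>d. graded n (k + \<kappa>) (odd_var v \<noteq> \<delta>) d \<and>
      (\<forall>c s. xi_curve n i c s \<longrightarrow> ((\<lambda>s. c s v) has_real_derivative d (c s)) (at s))"
  shows "matrix_rep n (k + \<kappa>) (g \<noteq> \<delta>) c (\<lambda>a. xi_deriv i (F a))"
  by (rule matrix_rep_deriv[OF F curve, where X="\<lambda>x s. x" and Y="\<lambda>\<xi> s. \<xi>(i := s)" and base="\<lambda>x \<xi>. \<xi> i"])
     (auto simp: xi_deriv_def partial_deriv_def intro: good_nhds_xi, unfold xi_curve_def, blast)

lemma matrix_rep_x1:
  "1 \<le> n \<Longrightarrow> matrix_rep n k g c F \<Longrightarrow> matrix_rep n (k + 1) g c (\<lambda>a. x_deriv 1 (F a))"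
  using matrix_rep_x_deriv[OF _ graded_curve_x1, of n k g c F] by simp

lemma matrix_rep_x2:
  "1 \<le> n \<Longrightarrow> matrix_rep n k g c F \<Longrightarrow> matrix_rep n k (\<not> g) c (\<lambda>a. x_deriv 2 (F a))"
  using matrix_rep_x_deriv[OF _ graded_curve_x2, of n k g c F] by simp

lemma matrix_rep_xi1:
  "1 \<le> n \<Longrightarrow> matrix_rep n k g c F \<Longrightarrow> matrix_rep n k g c (\<lambda>a. xi_deriv 1 (F a))"
  using matrix_rep_xi_deriv[OF _ graded_curve_xi, of n k g c F 1] by simp

lemma matrix_rep_xi2:
  "1 \<le> n \<Longrightarrow> matrix_rep n k g c F \<Longrightarrow> matrix_rep n k (\<not> g) c (\<lambda>a. xi_deriv 2 (F a))"
  using matrix_rep_xi_deriv[OF _ graded_curve_xi, of n k g c F 2] by simp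

section \<open>Independence of the angles x_3 and x_4, and iterated derivatives\<close>

lemma x_deriv_angle:
  assumes "matrix_rep n k g c F" "good n a T x \<xi>" "i = 3 \<or> i = 4"
  shows "x_deriv i (F a) x \<xi> = 0"
proof -
  have upd: "(x(i := s)) 1 = x 1" "(x(i := s)) 2 = x 2" for s
    using assms(3) by auto
  have conf: "conf_sq n a (x(i := s)) \<xi> = conf_sq n a x \<xi>" for s
    unfolding conf_sq_def upd ..
  have good: "good n a T (x(i := s)) \<xi>" for s
    using assms(2) unfolding good_def conf upd .
  have "env n a (x(i := s)) \<xi> v = env n a x \<xi> v" for s v
    by (cases v) (simp_all only: env.simps conf upd)
  then have env: "env n a (x(i := s)) \<xi> = env n a x \<xi>" for s by blast
  have "F a (x(i := s)) \<xi> $ j $ l = F a x \<xi> $ j $ l" for s j l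
  proof -
    have "scalar_rep n k (g \<noteq> (odd_row j \<noteq> odd_row l)) (\<lambda>a x \<xi>. F a x \<xi> $ j $ l)"
      using assms(1) by (simp only: matrix_rep_def)
    then obtain p q where pq: "\<forall>a T x \<xi>. good n a T x \<xi> \<longrightarrow>
        F a x \<xi> $ j $ l = Complex (p (env n a x \<xi>)) (q (env n a x \<xi>))"
      unfolding scalar_rep_def by blast
    have "F a (x(i := s)) \<xi> $ j $ l = Complex (p (env n a x \<xi>)) (q (env n a x \<xi>))"
      using pq good[of s] env[of s] by metis
    then show ?thesis using pq assms(2) by simp
  qed
  then have "F a (x(i := s)) \<xi> = F a x \<xi>" for s by (simp add: vec_eq_iff)
  then show ?thesis by (simp add: x_deriv_def partial_deriv_def)
qed

lemma matrix_rep_x_angle: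
  assumes "matrix_rep n k g c F" "i = 3 \<or> i = 4"
  shows "matrix_rep n k' g' c' (\<lambda>a. x_deriv i (F a))"
  by (rule matrix_rep_cong[OF matrix_rep_zero]) (rule x_deriv_angle[OF assms(1) _ assms(2)])

text \<open>The good points on a coordinate line form a neighbourhood, so the symbol is zero near
  the point and not only at it.\<close>

lemma x_deriv_vanishing:
  assumes "\<And>a T x \<xi>. good n a T x \<xi> \<Longrightarrow> F a x \<xi> = 0" "good n a T x \<xi>"
  shows "x_deriv i (F a) x \<xi> = 0"
proof -
  have "eventually (\<lambda>s. F a (x(i := s)) \<xi> = 0) (nhds (x i))"
    using good_nhds_x[OF assms(2)] by eventually_elim (rule assms(1))
  then have "((\<lambda>s. F a (x(i := s)) \<xi>) has_vector_derivative 0) (at (x i))"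
    by (rule has_vector_derivative_transform_eventually) simp
  then show ?thesis
    unfolding x_deriv_def partial_deriv_def by (rule vector_derivative_at)
qed

lemma x_deriv_funpow_vanishing:
  assumes "\<And>a T x \<xi>. good n a T x \<xi> \<Longrightarrow> F a x \<xi> = 0" "good n a T x \<xi>"
  shows "(x_deriv i ^^ m) (F a) x \<xi> = 0"
  using assms(2)
proof (induction m arbitrary: a T x \<xi>)
  case (Suc m)
  show ?case
    using x_deriv_vanishing[of n "\<lambda>a. (x_deriv i ^^ m) (F a)", OF Suc.IH Suc.prems] by simp
qed (use assms(1) in auto)

lemma matrix_rep_funpow_angle:
  assumes "matrix_rep n k g c F" "i = 3 \<or> i = 4"
  shows "matrix_rep n k g c (\<lambda>a. (x_deriv i ^^ m) (F a))"
proof (induction m)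
  case (Suc m)
  show ?case using matrix_rep_x_angle[OF Suc.IH assms(2), of k g c] by simp
qed (use assms(1) in simp)

text \<open>\<open>multi_x_deriv\<close> takes the derivatives in x_4 and x_3 innermost. They vanish
  at all good points, and the outer derivatives preserve this.\<close>

lemma multi_x_deriv_angle:
  assumes F: "matrix_rep n k g c F" and good: "good n a T x \<xi>" and \<beta>: "\<beta> 3 \<noteq> 0 \<or> \<beta> 4 \<noteq> 0"
  shows "multi_x_deriv \<beta> (F a) x \<xi> = 0"
proof -
  have zero: "(x_deriv i ^^ m) (G a) x \<xi> = 0"
    if G: "matrix_rep n k g c G" and good: "good n a T x \<xi>" and i: "i = 3 \<or> i = 4" and m: "m \<noteq> 0" for G i m a T x \<xi>
  proof -
    obtain l where "m = Suc l" using m by (cases m) auto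
    then show ?thesis
      using x_deriv_angle[OF matrix_rep_funpow_angle[OF G i, of l] good i] by simp
  qed
  have "(x_deriv 3 ^^ \<beta> 3) ((x_deriv 4 ^^ \<beta> 4) (F a)) x \<xi> = 0" if "good n a T x \<xi>" for a T x \<xi>
  proof (cases "\<beta> 3 = 0")
    case False
    show ?thesis
      by (rule zero[OF matrix_rep_funpow_angle[OF F, of 4 "\<beta> 4"] that _ False]) auto
  next
    case True
    then show ?thesis using zero[OF F that, of 4 "\<beta> 4"] \<beta> by simp
  qed
  then have "(x_deriv 2 ^^ \<beta> 2) ((x_deriv 3 ^^ \<beta> 3) ((x_deriv 4 ^^ \<beta> 4) (F a))) x \<xi> = 0" if "good n a T x \<xi>" for a T x \<xi>
    by (rule x_deriv_funpow_vanishing[of n "\<lambda>a. (x_deriv 3 ^^ \<beta> 3) ((x_deriv 4 ^^ \<beta> 4) (F a))", OF _ that])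
  then show ?thesis
    unfolding multi_x_deriv_def
    by (rule x_deriv_funpow_vanishing[of n "\<lambda>a. (x_deriv 2 ^^ \<beta> 2) ((x_deriv 3 ^^ \<beta> 3) ((x_deriv 4 ^^ \<beta> 4) (F a)))", OF _ good])
qed

lemma matrix_rep_funpow:
  assumes "matrix_rep n k g c F"
    and "\<And>k g F. matrix_rep n k g c F \<Longrightarrow> matrix_rep n (k + \<kappa>) (g \<noteq> \<delta>) c (\<lambda>a. D (F a))"
  shows "matrix_rep n (k + m * \<kappa>) (g \<noteq> (\<delta> \<and> odd m)) c (\<lambda>a. (D ^^ m) (F a))"
proof (induction m)
  case (Suc m)
  have "((g \<noteq> (\<delta> \<and> odd m)) \<noteq> \<delta>) = (g \<noteq> (\<delta> \<and> odd (Suc m)))" by auto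
  then show ?case using assms(2)[OF Suc.IH] by (simp add: algebra_simps)
qed (use assms(1) in simp)

lemma matrix_rep_multi_x_deriv:
  assumes n: "1 \<le> n" and F: "matrix_rep n k g c F" and \<beta>: "\<beta> 3 = 0" "\<beta> 4 = 0"
  shows "matrix_rep n (k + \<beta> 1) (g \<noteq> odd (\<beta> 2)) c (\<lambda>a. multi_x_deriv \<beta> (F a))"
  using matrix_rep_funpow[OF matrix_rep_funpow[OF F, of 0 True "x_deriv 2" "\<beta> 2"], of 1 False "x_deriv 1" "\<beta> 1"]
  by (simp add: matrix_rep_x1[OF n, simplified] matrix_rep_x2[OF n] multi_x_deriv_def \<beta>)

lemma matrix_rep_multi_xi_deriv:
  assumes n: "1 \<le> n" and F: "matrix_rep n k g c F" and \<beta>: "\<beta> 3 = 0" "\<beta> 4 = 0"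
  shows "matrix_rep n k (g \<noteq> odd (\<beta> 2)) c (\<lambda>a. multi_xi_deriv \<beta> (F a))"
  using matrix_rep_funpow[OF matrix_rep_funpow[OF F, of 0 True "xi_deriv 2" "\<beta> 2"], of 0 False "xi_deriv 1" "\<beta> 1"]
  by (simp add: matrix_rep_xi1[OF n, simplified] matrix_rep_xi2[OF n] multi_xi_deriv_def \<beta>)

section \<open>The Dirac operator and its square\<close>

lemma scalar_rep_of_rat_mult_var:
  "admissible n k v \<Longrightarrow> admissible n k w \<Longrightarrow>
   scalar_rep n k (odd_var v \<noteq> odd_var w) (\<lambda>a x \<xi>. of_real (env n a x \<xi> v) * of_real (env n a x \<xi> w))"
  by (intro scalar_rep_mult scalar_rep_var)

text \<open>The odd variables u_2 and u_3 stand exactly in those entries whose row and column differ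
  in \<open>odd_row\<close>. Moreover q_1 is \<open>\<i>\<close> times a matrix fixed by charge
  conjugation, whence the degree 1.\<close>

lemma matrix_rep_dirac_q1:
  assumes "1 \<le> n"
  shows "matrix_rep n 0 False 1 dirac_q1"
proof -
  have X1: "scalar_rep n 0 False (\<lambda>a x \<xi>. of_real (\<xi> 1))"
    by (rule scalar_rep_eqI, rule scalar_rep_cong[OF scalar_rep_var[of _ _ "UVar 1"]]) auto
  have X2: "scalar_rep n 0 True (\<lambda>a x \<xi>. of_real (\<xi> 2 / a (x 1)))"
    by (rule scalar_rep_eqI, rule scalar_rep_cong[OF scalar_rep_of_rat_mult_var[of _ _ "UVar 2" InvJet0]])
       (use assms in auto)
  have X3: "scalar_rep n 0 True (\<lambda>a x \<xi>. of_real (\<xi> 3 / (sin (x 2) * a (x 1))))"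
    by (rule scalar_rep_eqI, rule scalar_rep_cong[OF scalar_rep_of_rat_mult_var[of _ _ "UVar 3" InvJet0]])
       (use assms in auto)
  have X4: "scalar_rep n 0 False (\<lambda>a x \<xi>. of_real (\<xi> 4 / (cos (x 2) * a (x 1))))"
    by (rule scalar_rep_eqI, rule scalar_rep_cong[OF scalar_rep_of_rat_mult_var[of _ _ "UVar 4" InvJet0]])
       (use assms in auto)
  have iX2: "scalar_rep n 0 True (\<lambda>a x \<xi>. \<i> * of_real (\<xi> 2 / a (x 1)))"
    using scalar_rep_mult[OF scalar_rep_ii X2] by simp
  have iX4: "scalar_rep n 0 False (\<lambda>a x \<xi>. \<i> * of_real (\<xi> 4 / (cos (x 2) * a (x 1))))"
    using scalar_rep_mult[OF scalar_rep_ii X4] by simp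
  have "scalar_rep n 0 (False \<noteq> (odd_row i \<noteq> odd_row j)) (\<lambda>a x \<xi>. dirac_q1 a x \<xi> $ i $ j)" for i j
  proof -
    have "\<forall>i j. scalar_rep n 0 (False \<noteq> (odd_row i \<noteq> odd_row j)) (\<lambda>a x \<xi>. dirac_q1 a x \<xi> $ i $ j)"
      unfolding forall_4
      by (simp add: dirac_q1_def Let_def offdiag_def mat2_def vector_4_nth odd_row_def scalar_rep_zero
          del: of_real_divide of_real_mult One_nat_def)
         (intro conjI scalar_rep_add scalar_rep_diff scalar_rep_uminus X1 X2 X3 X4 iX2 iX4)
    then show ?thesis by blast
  qed
  moreover have "quat_conj (dirac_q1 a x \<xi>) = (-1) ^ 1 *\<^sub>R dirac_q1 a x \<xi>" for a x \<xi>
    by (simp add: vec_eq_iff forall_4 quat_conj_def quat_swap_def quat_sign_def dirac_q1_def Let_def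
          offdiag_def mat2_def vector_4_nth)
  ultimately show ?thesis
    unfolding matrix_rep_def by blast
qed

lemma matrix_rep_dirac_q0:
  assumes "1 \<le> n"
  shows "matrix_rep n 1 False 0 dirac_q0"
proof -
  let ?d = "\<lambda>a x. \<i> * complex_of_real (3 * deriv a (x 1) / (2 * a (x (1::nat))))"
  let ?e = "\<lambda>a x. complex_of_real ((cot (x 2) - tan (x 2)) / (2 * a (x (1::nat))))"
  have d: "scalar_rep n 1 False (\<lambda>a x \<xi>. ?d a x)"
  proof -
    have "scalar_rep n 1 False (\<lambda>a x \<xi>. of_real (of_rat (3/2)) * (of_real (env n a x \<xi> (Jet 1)) * of_real (env n a x \<xi> InvJet0)))"
      by (rule scalar_rep_eqI, rule scalar_rep_mult[OF scalar_rep_rat scalar_rep_of_rat_mult_var]) auto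
    from scalar_rep_mult[OF scalar_rep_ii this] show ?thesis
      by (rule scalar_rep_cong[OF scalar_rep_eqI]) (auto simp: of_rat_divide)
  qed
  \<comment> \<open>cot \<eta> - tan \<eta> = (1 - 2 u_0) / s. As s has no inverse among the
    generators, 1/s is written as s times the inverses of u_0 and 1 - u_0.\<close>
  have e: "scalar_rep n 1 True (\<lambda>a x \<xi>. ?e a x)"
  proof -
    let ?v = "\<lambda>v a x \<xi>. complex_of_real (env n a x \<xi> v)"
    have "scalar_rep n 1 False (\<lambda>a x \<xi>. of_real (of_rat (1/2)) - ?v (UVar 0) a x \<xi>)"
      by (rule scalar_rep_diff[OF scalar_rep_rat scalar_rep_eqI[OF scalar_rep_var]]) auto
    note scalar_rep_mult[OF this scalar_rep_mult[OF scalar_rep_of_rat_mult_var[of _ _ SinCos InvU0]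
      scalar_rep_of_rat_mult_var[of _ _ InvU0c InvJet0]]]
    then have *: "scalar_rep n 1 True (\<lambda>a x \<xi>. (of_real (of_rat (1/2)) - ?v (UVar 0) a x \<xi>) *
      ((?v SinCos a x \<xi> * ?v InvU0 a x \<xi>) * (?v InvU0c a x \<xi> * ?v InvJet0 a x \<xi>)))"
      by simp
    show ?thesis
    proof (rule scalar_rep_cong[OF *])
      fix a T x \<xi> assume "good n a T x \<xi>"
      note sc = good_sin_cos[OF this]
      have "(cot (x 2) - tan (x 2)) / (2 * a (x 1)) = (1 / 2 - (sin (x 2))\<^sup>2) *
         ((sin (x 2) * cos (x 2) * (1 / (sin (x 2))\<^sup>2)) * (1 / (cos (x 2))\<^sup>2 * (1 / a (x 1))))"
        using sc sin_cos_squared_add[of "x 2"]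
        by (simp add: cot_def tan_def divide_simps power2_eq_square)
      then show "?e a x = (of_real (of_rat (1/2)) - ?v (UVar 0) a x \<xi>) *
         ((?v SinCos a x \<xi> * ?v InvU0 a x \<xi>) * (?v InvU0c a x \<xi> * ?v InvJet0 a x \<xi>))"
        by (simp only: env.simps of_real_mult[symmetric] of_real_diff[symmetric]) (simp add: of_rat_divide)
    qed
  qed
  have "scalar_rep n 1 (False \<noteq> (odd_row i \<noteq> odd_row j)) (\<lambda>a x \<xi>. dirac_q0 a x \<xi> $ i $ j)" for i j
  proof -
    have "\<forall>i j. scalar_rep n 1 (False \<noteq> (odd_row i \<noteq> odd_row j)) (\<lambda>a x \<xi>. dirac_q0 a x \<xi> $ i $ j)"
      unfolding forall_4
      by (simp add: dirac_q0_def Let_def offdiag_def mat2_def vector_4_nth odd_row_def scalar_rep_zero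
          del: of_real_divide of_real_mult of_real_diff One_nat_def)
         (intro conjI scalar_rep_uminus d e)
    then show ?thesis by blast
  qed
  moreover have "quat_conj (dirac_q0 a x \<xi>) = (-1) ^ 0 *\<^sub>R dirac_q0 a x \<xi>" for a x \<xi>
    by (simp add: vec_eq_iff forall_4 quat_conj_def quat_swap_def quat_sign_def dirac_q0_def Let_def
          offdiag_def mat2_def vector_4_nth diff_divide_distrib)
  ultimately show ?thesis
    unfolding matrix_rep_def by blast
qed

lemma matrix_rep_ii: "matrix_rep n k False 1 (\<lambda>a x \<xi>. mat \<i>)"
  by (rule matrix_rep_mat[OF scalar_rep_ii]) simp

text \<open>For j = 1 the derivative of \<open>G\<close> brings in one more jet; for j = 2 both
  factors reverse parity, so their product is even. For j = 3 and j = 4 the first factor may lie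
  outside the ring but is multiplied by zero.\<close>

lemma matrix_rep_deriv_products:
  assumes n: "1 \<le> n" and F: "matrix_rep n 0 False c F" and G: "matrix_rep n k False d G"
  shows "matrix_rep n (k + 1) False (c + d) (\<lambda>a x \<xi>. \<Sum>j=1..4. xi_deriv j (F a) x \<xi> ** x_deriv j (G a) x \<xi>)"
proof (rule matrix_rep_sum)
  fix j :: nat assume "j \<in> {1..4}"
  then consider "j = 1" | "j = 2" | "j = 3 \<or> j = 4" by force
  then show "matrix_rep n (k + 1) False (c + d) (\<lambda>a x \<xi>. xi_deriv j (F a) x \<xi> ** x_deriv j (G a) x \<xi>)"
  proof cases
    case 1
    show ?thesis
      using matrix_rep_mult[OF matrix_rep_mono[OF matrix_rep_xi1[OF n F], of "k+1"] matrix_rep_x1[OF n G]] 1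
      by simp
  next
    case 2
    show ?thesis
      using matrix_rep_mult[OF matrix_rep_mono[OF matrix_rep_xi2[OF n F], of "k+1"]
          matrix_rep_mono[OF matrix_rep_x2[OF n G], of "k + 1"]] 2
      by simp
  next
    case 3
    show ?thesis
      by (rule matrix_rep_cong[OF matrix_rep_zero]) (simp add: x_deriv_angle[OF G _ 3])
  qed
qed

text \<open>The factor \<open>\<i>\<close> adds one to the degree under charge conjugation. This
  makes the sums of derivative products agree mod 2 with the products of q_0 and q_1 beside
  them.\<close>

lemma matrix_rep_dirac_sq:
  assumes n: "1 \<le> n" and "k \<le> 2"
  shows "matrix_rep n (2 - k) False k (\<lambda>a. dirac_sq a k)"
proof -
  note q1 = matrix_rep_dirac_q1[OF n] and q0 = matrix_rep_dirac_q0[OF n]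
  consider "k = 0" | "k = 1" | "k = 2" using assms(2) by linarith
  then show ?thesis
  proof cases
    case 1
    have "matrix_rep n 2 False 0 (\<lambda>a x \<xi>. dirac_q0 a x \<xi> ** dirac_q0 a x \<xi>)"
      using matrix_rep_mono[OF matrix_rep_mult[OF q0 q0], of 2] by simp
    moreover have "matrix_rep n 2 False 0 (\<lambda>a x \<xi>. mat \<i> ** (\<Sum>j=1..4. xi_deriv j (dirac_q1 a) x \<xi> ** x_deriv j (dirac_q0 a) x \<xi>))"
      using matrix_rep_parity[OF matrix_rep_mult[OF matrix_rep_ii matrix_rep_deriv_products[OF n q1 q0]], of 0]
      by (simp add: numeral_2_eq_2)
    ultimately have "matrix_rep n 2 False 0 (\<lambda>a. dirac_sq a 0)"
      by (rule matrix_rep_cong[OF matrix_rep_diff]) (simp add: dirac_sq_def Let_def)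
    then show ?thesis using 1 by simp
  next
    case 2
    have "matrix_rep n 1 False 1 (\<lambda>a x \<xi>. dirac_q0 a x \<xi> ** dirac_q1 a x \<xi> + dirac_q1 a x \<xi> ** dirac_q0 a x \<xi>)"
      using matrix_rep_add[OF matrix_rep_mult[OF q0 matrix_rep_mono[OF q1, of 1]]
        matrix_rep_mult[OF matrix_rep_mono[OF q1, of 1] q0, simplified add.commute[of 1 0]]] by simp
    moreover have "matrix_rep n 1 False 1 (\<lambda>a x \<xi>. mat \<i> ** (\<Sum>j=1..4. xi_deriv j (dirac_q1 a) x \<xi> ** x_deriv j (dirac_q1 a) x \<xi>))"
      using matrix_rep_parity[OF matrix_rep_mult[OF matrix_rep_ii matrix_rep_deriv_products[OF n q1 q1]], of 1]
      by simp
    ultimately have "matrix_rep n 1 False 1 (\<lambda>a. dirac_sq a 1)"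
      by (rule matrix_rep_cong[OF matrix_rep_diff]) (simp add: dirac_sq_def Let_def)
    then show ?thesis using 2 by simp
  next
    case 3
    have "matrix_rep n 0 (False \<noteq> False) (1 + 1) (\<lambda>a. dirac_sq a 2)"
      by (rule matrix_rep_cong[OF matrix_rep_mult[OF q1 q1]]) (simp add: dirac_sq_def Let_def)
    then show ?thesis using 3 by (simp add: numeral_2_eq_2)
  qed
qed

section \<open>The recursion for the parametrix\<close>

text \<open>\<open>matrix_inv\<close> is a choice among two-sided inverses. Multiplication by
  \<open>mat (1 / c)\<close> from the left shows that the chosen one is the expected one.\<close>

lemma matrix_inv_scalar:
  fixes c :: "'a::field"
  assumes "c \<noteq> 0"
  shows "matrix_inv (mat c :: 'a^'n^'n) = mat (1 / c)"
proof -
  have mult: "mat a ** mat b = (mat (a * b) :: 'a^'n^'n)" for a b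
  proof -
    have *: "(\<lambda>k. (if i = k then a else 0) * (if k = j then b else 0)) =
        (\<lambda>k. if k = i then (if i = j then a * b else 0) else 0)" for i j :: 'n
      by auto
    show ?thesis
      unfolding vec_eq_iff matrix_matrix_mult_def mat_def vec_lambda_beta * by simp
  qed
  let ?inv = "\<lambda>B :: 'a^'n^'n. mat c ** B = mat 1 \<and> B ** mat c = mat 1"
  have inv: "?inv (mat (1 / c))" using assms by (simp add: mult)
  have "?inv (matrix_inv (mat c))"
    unfolding matrix_inv_def by (rule someI[of ?inv, OF inv])
  then have "mat (1 / c) ** (mat c ** matrix_inv (mat c :: 'a^'n^'n)) = mat (1 / c)"
    by simp
  then show ?thesis
    using assms by (simp add: matrix_mul_assoc mult)
qed

lemma param_leading_eq:
  assumes "good n a T x \<xi>"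
  shows "param_leading a n x \<xi> = mat (of_real (env n a x \<xi> InvQ))"
proof -
  have "(mat c :: complex^4^4) + mat d = mat (c + d)" for c d
    by (simp add: vec_eq_iff mat_def)
  then have "dirac_sq a 2 x \<xi> + mat (complex_of_real (\<Sum>i=5..2*n+2. (\<xi> i)\<^sup>2)) = mat (of_real (conf_sq n a x \<xi>))"
    using good_sin_cos[OF assms] by (subst dirac_sq_2) (auto simp: conf_sq_def)
  moreover have "conf_sq n a x \<xi> \<noteq> 0" using assms by (simp add: good_def)
  ultimately show ?thesis
    unfolding param_leading_def by (simp add: matrix_inv_scalar)
qed

lemma matrix_rep_param_leading: "matrix_rep n k False 0 (\<lambda>a. param_leading a n)"
proof (rule matrix_rep_cong[OF _ param_leading_eq])
  show "matrix_rep n k False 0 (\<lambda>a x \<xi>. mat (of_real (env n a x \<xi> InvQ)))"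
    by (rule matrix_rep_mat[OF scalar_rep_eqI[OF scalar_rep_var]]) auto
qed

lemma matrix_rep_coefficient:
  "matrix_rep n k False m (\<lambda>a x \<xi>. mat ((- \<i>) ^ m / of_nat f))"
proof (rule matrix_rep_mat)
  have "scalar_rep n k False (\<lambda>a x \<xi>. (- \<i>) ^ m * of_real (of_rat (1 / of_nat f)))"
    by (rule scalar_rep_eqI[OF scalar_rep_mult[OF scalar_rep_power[OF scalar_rep_uminus[OF scalar_rep_ii]] scalar_rep_rat]]) simp
  then show "scalar_rep n k False (\<lambda>a x \<xi>. (- \<i>) ^ m / of_nat f)"
    by (rule scalar_rep_cong) (simp add: of_rat_divide)
  show "cnj ((- \<i>) ^ m / of_nat f) = (- 1) ^ m * ((- \<i>) ^ m / of_nat f)"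
    by (simp add: power_minus[of \<i> m] power_minus[of "-\<i>" m])
qed

text \<open>Three degrees balance in each summand. For charge conjugation, the power of
  -\<open>\<i>\<close> contributes |\<beta>|, and 2 + j + |\<beta>| = N + k makes |\<beta>| + j + k
  congruent to N mod 2. For the reflection, the derivatives in \<xi> and in x each change the parity
  by \<beta>_2. The orders of jets do not add in a product but are bounded by their maximum, so it
  suffices that j and 2 - k + \<beta>_1 are at most N.\<close>

lemma matrix_rep_parametrix:
  assumes n: "1 \<le> n"
  shows "matrix_rep n N False N (\<lambda>a. parametrix a n N)"
proof (induction N rule: less_induct)
  case (less N)
  show ?case
  proof (cases "N = 0")
    case True
    have "parametrix a n 0 = param_leading a n" for a
      by (subst parametrix.simps) simp
    then show ?thesis
      using matrix_rep_param_leading[of n 0] by (simp only: True)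
  next
    case False
    let ?term = "\<lambda>j k \<beta> a x \<xi>. mat ((- \<i>) ^ (\<Sum>i=1..4. \<beta> i) / of_nat (\<Prod>i=1..4. fact (\<beta> i))) **
            (multi_xi_deriv \<beta> (parametrix a n j) x \<xi> ** multi_x_deriv \<beta> (dirac_sq a k) x \<xi>)"
    have summand: "matrix_rep n N False N (?term j k \<beta>)"
      if j: "j < N" and k: "k \<le> 2" and b: "2 + j + (\<Sum>i=1..4. \<beta> i) = N + k" for j k and \<beta> :: "nat \<Rightarrow> nat"
    proof (cases "\<beta> 3 = 0 \<and> \<beta> 4 = 0")
      case False
      show ?thesis
        by (rule matrix_rep_cong[OF matrix_rep_zero])
           (use multi_x_deriv_angle[OF matrix_rep_dirac_sq[OF n k]] False in simp)
    next
      case True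
      have "(\<Sum>i=1..4. \<beta> i) = \<beta> 1 + \<beta> 2 + \<beta> 3 + \<beta> 4" by (simp add: numeral_eq_Suc)
      then have "2 - k + \<beta> 1 \<le> N" using b k by linarith
      then have 1: "matrix_rep n N (odd (\<beta> 2)) k (\<lambda>a. multi_x_deriv \<beta> (dirac_sq a k))"
        using matrix_rep_mono[OF matrix_rep_multi_x_deriv[OF n matrix_rep_dirac_sq[OF n k], of \<beta>]] True by simp
      have 2: "matrix_rep n N (odd (\<beta> 2)) j (\<lambda>a. multi_xi_deriv \<beta> (parametrix a n j))"
        using matrix_rep_mono[OF matrix_rep_multi_xi_deriv[OF n less.IH[OF j], of \<beta>], of N] j True by simp
      have "even (S + (j + k) + N)" if "2 + j + S = N + k" for S using that by presburger
      from this[OF b] have "even ((\<Sum>i=1..4. \<beta> i) + (j + k) + N)" .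
      moreover have "matrix_rep n N False ((\<Sum>i=1..4. \<beta> i) + (j + k)) (?term j k \<beta>)"
        using matrix_rep_mult[OF matrix_rep_coefficient[of n N "\<Sum>i=1..4. \<beta> i" "\<Prod>i=1..4. fact (\<beta> i)"] matrix_rep_mult[OF 2 1]]
        by (simp only: simp_thms)
      ultimately show ?thesis by (rule matrix_rep_parity[rotated])
    qed
    have "matrix_rep n N False N (\<lambda>a x \<xi>. \<Sum>j<N. \<Sum>k\<le>2. \<Sum>\<beta> | \<beta> \<in> {1..4} \<rightarrow>\<^sub>E UNIV \<and> 2 + j + (\<Sum>i=1..4. \<beta> i) = N + k.
        ?term j k \<beta> a x \<xi>)"
      by (intro matrix_rep_sum summand) auto
    note rep = matrix_rep_mult[OF matrix_rep_uminus[OF this] matrix_rep_param_leading]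
    have "matrix_rep n N (False \<noteq> False) (N + 0) (\<lambda>a. parametrix a n N)"
    proof (rule matrix_rep_cong[OF rep])
      fix a :: "real \<Rightarrow> real" and x \<xi> :: "nat \<Rightarrow> real"
      show "parametrix a n N x \<xi> = - (\<Sum>j<N. \<Sum>k\<le>2. \<Sum>\<beta> | \<beta> \<in> {1..4} \<rightarrow>\<^sub>E UNIV \<and> 2 + j + (\<Sum>i=1..4. \<beta> i) = N + k.
        ?term j k \<beta> a x \<xi>) ** param_leading a n x \<xi>"
        by (subst parametrix.simps) (simp only: False if_False)
    qed
    then show ?thesis by (simp only: simp_thms add_0_right)
  qed
qed

text \<open>The index 2n is even, so the symbol is fixed by \<open>quat_conj\<close> and its trace
  is real. Diagonal entries have the parity of the whole matrix, which is even.\<close>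

lemma trace_parametrix:
  assumes n: "1 \<le> n"
  shows "\<exists>p. graded n (2*n) False p \<and> (\<forall>a T x \<xi>. good n a T x \<xi> \<longrightarrow>
     trace (parametrix a n (2*n) x \<xi>) = of_real (p (env n a x \<xi>)))"
proof -
  note rep = matrix_rep_parametrix[OF n, of "2*n"]
  have "scalar_rep n (2*n) False (\<lambda>a x \<xi>. parametrix a n (2*n) x \<xi> $ i $ i)" for i
    using rep by (auto simp: matrix_rep_def dest!: spec[of _ i])
  then have "scalar_rep n (2*n) False (\<lambda>a x \<xi>. trace (parametrix a n (2*n) x \<xi>))"
    unfolding trace_def by (rule scalar_rep_sum)
  then obtain p q where p: "graded n (2*n) False p" and
    pq: "\<And>a T x \<xi>. good n a T x \<xi> \<Longrightarrow> trace (parametrix a n (2*n) x \<xi>) = Complex (p (env n a x \<xi>)) (q (env n a x \<xi>))"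
    unfolding scalar_rep_def by blast
  have "trace (parametrix a n (2*n) x \<xi>) = of_real (p (env n a x \<xi>))" if "good n a T x \<xi>" for a T x \<xi>
  proof -
    have "quat_conj (parametrix a n (2*n) x \<xi>) = parametrix a n (2*n) x \<xi>"
      using rep that by (simp add: matrix_rep_def)
    then have "Im (trace (parametrix a n (2*n) x \<xi>)) = 0" by (rule Im_trace_quat_conj)
    then show ?thesis by (simp add: pq[OF that] complex_of_real_def)
  qed
  with p show ?thesis by blast
qed

section \<open>The trace as a rational function\<close>

text \<open>This is \<alpha>^2 Q, free of denominators; the variable of index 2n+3 is \<alpha>, as
  in \<open>join_vars\<close>. The ring is left open because values are taken over the reals and
  regularity is tested over the complex numbers.\<close>

definition cleared_Q :: "nat \<Rightarrow> (nat \<Rightarrow> 'b::comm_ring_1) \<Rightarrow> 'b" where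
  "cleared_Q n w = (w (2*n+3))\<^sup>2 * (w 1)\<^sup>2 + ((w 2)\<^sup>2 + (w 3)\<^sup>2 + (w 4)\<^sup>2)
     + (w (2*n+3))\<^sup>2 * (\<Sum>i=5..2*n+2. (w i)\<^sup>2)"

definition denom :: "nat \<Rightarrow> (nat \<Rightarrow> 'b::comm_ring_1) \<Rightarrow> 'b" where
  "denom n w = w 0 * (1 - w 0) * w (2*n+3) * cleared_Q n w"

fun joint_env :: "nat \<Rightarrow> (nat \<Rightarrow> real) \<Rightarrow> real \<Rightarrow> symvar \<Rightarrow> real" where
  "joint_env n w s (UVar i) = w i"
| "joint_env n w s (Jet i) = w (2*n+3+i)"
| "joint_env n w s SinCos = s"
| "joint_env n w s InvU0 = 1 / w 0"
| "joint_env n w s InvU0c = 1 / (1 - w 0)"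
| "joint_env n w s InvJet0 = 1 / w (2*n+3)"
| "joint_env n w s InvQ = (w (2*n+3))\<^sup>2 / cleared_Q n w"

text \<open>The reflection of \<eta> on the variables u and the parameters; its effect on s is
  recorded apart, by splitting off the coefficient of s.\<close>

definition flip23 :: "(nat \<Rightarrow> real) \<Rightarrow> nat \<Rightarrow> real" where
  "flip23 w = w(2 := - w 2, 3 := - w 3)"

lemma flip23_fixed: "i \<noteq> 2 \<Longrightarrow> i \<noteq> 3 \<Longrightarrow> flip23 w i = w i"
  by (simp add: flip23_def)

lemma cleared_Q_flip23: "1 \<le> n \<Longrightarrow> cleared_Q n (flip23 w) = cleared_Q n w"
  by (simp add: cleared_Q_def flip23_def)

lemma denom_flip23: "1 \<le> n \<Longrightarrow> denom n (flip23 w) = denom n w"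
  by (simp add: denom_def cleared_Q_flip23) (simp add: flip23_def)

lemma cleared_Q_polyfun: "1 \<le> n \<Longrightarrow> cleared_Q n \<in> polyfuns (4*n+4)"
  unfolding cleared_Q_def[abs_def] by (intro polyfuns_intros) auto

lemma denom_polyfun: "1 \<le> n \<Longrightarrow> denom n \<in> polyfuns (4*n+4)"
  unfolding denom_def[abs_def] by (intro polyfuns_intros cleared_Q_polyfun) auto

definition parity_sign :: "bool \<Rightarrow> real" where
  "parity_sign g = (if g then - 1 else 1)"

text \<open>
  The ring of symbols is generated over the polynomials in the \<open>u\<^sub>i\<close> and the jets by \<open>1/denom\<close> and
  \<open>s = sin \<eta> cos \<eta>\<close>, and \<open>s\<^sup>2 = u\<^sub>0 (1 - u\<^sub>0)\<close>.
\<close>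

definition normal_form ::
    "nat \<Rightarrow> nat \<Rightarrow> bool \<Rightarrow> ((symvar \<Rightarrow> real) \<Rightarrow> real) \<Rightarrow> nat \<Rightarrow>
      ((nat \<Rightarrow> real) \<Rightarrow> real) \<Rightarrow> ((nat \<Rightarrow> real) \<Rightarrow> real) \<Rightarrow> bool" where
  "normal_form n k g p K P0 P1 \<longleftrightarrow> P0 \<in> polyfuns (4*n+4) \<and> P1 \<in> polyfuns (4*n+4) \<and>
    (\<forall>w. P0 (flip23 w) = parity_sign g * P0 w) \<and> (\<forall>w. P1 (flip23 w) = - parity_sign g * P1 w) \<and>
    (\<forall>w s e. denom n w \<noteq> 0 \<and> s\<^sup>2 = w 0 * (1 - w 0) \<and> (\<forall>v. admissible n k v \<longrightarrow> e v = joint_env n w s v)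
      \<longrightarrow> p e * denom n w ^ K = P0 w + s * P1 w)"

lemma normal_formD:
  assumes "normal_form n k g p K P0 P1"
  shows "P0 \<in> polyfuns (4*n+4)" "P1 \<in> polyfuns (4*n+4)"
    "P0 (flip23 w) = parity_sign g * P0 w" "P1 (flip23 w) = - parity_sign g * P1 w"
    "denom n w \<noteq> 0 \<Longrightarrow> s\<^sup>2 = w 0 * (1 - w 0) \<Longrightarrow> (\<forall>v. admissible n k v \<longrightarrow> e v = joint_env n w s v)
      \<Longrightarrow> p e * denom n w ^ K = P0 w + s * P1 w"
  using assms unfolding normal_form_def by blast+

text \<open>All inverses have \<open>denom\<close> as a common denominator, and a product of two
  coefficients of s returns to the part free of s. Environments are compared on admissible
  generators only: for k at most 2n these read no variable beyond the 4n+4 that the polynomials may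
  contain.\<close>

lemma graded_normal_form:
  assumes n: "1 \<le> n" and k: "k \<le> 2*n" and p: "graded n k g p"
  shows "\<exists>K P0 P1. normal_form n k g p K P0 P1"
  using p
proof induction
  case (zero g)
  show ?case
    by (rule exI[of _ 0], rule exI[of _ "\<lambda>_. 0"], rule exI[of _ "\<lambda>_. 0"]) (simp add: normal_form_def polyfuns_zero)
next
  case (const c)
  show ?case
    by (rule exI[of _ 0], rule exI[of _ "\<lambda>_. of_rat c"], rule exI[of _ "\<lambda>_. 0"])
       (simp add: normal_form_def polyfuns_zero polyfuns.const parity_sign_def)
next
  case (var v)
  have *: ?case if "P0 \<in> polyfuns (4*n+4)" "P1 \<in> polyfuns (4*n+4)"
    "\<And>w. P0 (flip23 w) = parity_sign (odd_var v) * P0 w" "\<And>w. P1 (flip23 w) = - parity_sign (odd_var v) * P1 w"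
    "\<And>w s. denom n w \<noteq> 0 \<Longrightarrow> joint_env n w s v * denom n w ^ K = P0 w + s * P1 w" for K P0 P1
    using that var by (intro exI[of _ K] exI[of _ P0] exI[of _ P1]) (simp add: normal_form_def)
  \<comment> \<open>For an inverse generator the numerator is the product of the remaining factors
    of \<open>denom\<close>, with an extra \<alpha>^2 for 1/Q.\<close>
  have inv: ?case if "N \<in> polyfuns (4*n+4)" "\<And>w. N (flip23 w) = N w" "\<not> odd_var v"
    "\<And>w s. denom n w \<noteq> 0 \<Longrightarrow> joint_env n w s v * denom n w = N w" for N
    using that by (intro *[of N "\<lambda>_. 0" 1]) (simp_all add: parity_sign_def polyfuns_zero)
  show ?case
  proof (cases v)
    case (UVar i)
    then show ?thesis
      using var by (intro *[of "\<lambda>w. w i" "\<lambda>_. 0" 0])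
         (auto simp: parity_sign_def flip23_def intro!: polyfuns_zero polyfuns.var)
  next
    case (Jet i)
    then show ?thesis
      using var k n by (intro *[of "\<lambda>w. w (2*n+3+i)" "\<lambda>_. 0" 0])
         (auto simp: parity_sign_def flip23_def intro!: polyfuns_zero polyfuns.var)
  next
    case SinCos
    then show ?thesis
      by (intro *[of "\<lambda>w. 0" "\<lambda>_. 1" 0]) (auto simp: parity_sign_def intro!: polyfuns_zero polyfuns_one)
  next
    case InvU0
    show ?thesis by (rule inv[of "\<lambda>w. (1 - w 0) * w (2*n+3) * cleared_Q n w"])
        (use n in \<open>auto simp: InvU0 denom_def cleared_Q_flip23 flip23_fixed intro!: polyfuns_intros cleared_Q_polyfun\<close>)
  next
    case InvU0c
    show ?thesis by (rule inv[of "\<lambda>w. w 0 * w (2*n+3) * cleared_Q n w"])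
        (use n in \<open>auto simp: InvU0c denom_def cleared_Q_flip23 flip23_fixed intro!: polyfuns_intros cleared_Q_polyfun\<close>)
  next
    case InvJet0
    show ?thesis by (rule inv[of "\<lambda>w. w 0 * (1 - w 0) * cleared_Q n w"])
        (use n in \<open>auto simp: InvJet0 denom_def cleared_Q_flip23 flip23_fixed intro!: polyfuns_intros cleared_Q_polyfun\<close>)
  next
    case InvQ
    show ?thesis by (rule inv[of "\<lambda>w. w 0 * (1 - w 0) * w (2*n+3) * (w (2*n+3))\<^sup>2"])
        (use n in \<open>auto simp: InvQ denom_def flip23_fixed intro!: polyfuns_intros\<close>)
  qed
next
  case (add g p q)
  obtain K P0 P1 where "normal_form n k g p K P0 P1"
    using add.IH(1) by blast
  note p = normal_formD[OF this]
  obtain L Q0 Q1 where "normal_form n k g q L Q0 Q1"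
    using add.IH(2) by blast
  note q = normal_formD[OF this]
  have poly: "(\<lambda>w. P0 w * denom n w ^ L + Q0 w * denom n w ^ K) \<in> polyfuns (4*n+4)"
    "(\<lambda>w. P1 w * denom n w ^ L + Q1 w * denom n w ^ K) \<in> polyfuns (4*n+4)"
    using n by (intro polyfuns_intros p q denom_polyfun; simp)+
  show ?case
    unfolding normal_form_def
  proof (rule exI[of _ "K + L"], rule exI[of _ "\<lambda>w. P0 w * denom n w ^ L + Q0 w * denom n w ^ K"],
      rule exI[of _ "\<lambda>w. P1 w * denom n w ^ L + Q1 w * denom n w ^ K"], intro conjI allI impI)
    fix w s e assume *: "denom n w \<noteq> 0 \<and> s\<^sup>2 = w 0 * (1 - w 0) \<and> (\<forall>v. admissible n k v \<longrightarrow> e v = joint_env n w s v)"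
    have "(p e + q e) * denom n w ^ (K + L) =
        (p e * denom n w ^ K) * denom n w ^ L + (q e * denom n w ^ L) * denom n w ^ K"
      by (simp add: power_add algebra_simps)
    also have "\<dots> = (P0 w + s * P1 w) * denom n w ^ L + (Q0 w + s * Q1 w) * denom n w ^ K"
      using p(5)[of w s e] q(5)[of w s e] * by simp
    finally show "(p e + q e) * denom n w ^ (K + L) = P0 w * denom n w ^ L + Q0 w * denom n w ^ K +
        s * (P1 w * denom n w ^ L + Q1 w * denom n w ^ K)"
      by (simp add: algebra_simps)
  qed (fact poly | use n in \<open>simp add: p(3,4) q(3,4) denom_flip23 algebra_simps\<close>)+
next
  case (mult g p h q)
  obtain K P0 P1 where "normal_form n k g p K P0 P1"
    using mult.IH(1) by blast
  note p = normal_formD[OF this]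
  obtain L Q0 Q1 where "normal_form n k h q L Q0 Q1"
    using mult.IH(2) by blast
  note q = normal_formD[OF this]
  have sign: "parity_sign (g \<noteq> h) = parity_sign g * parity_sign h"
    by (simp add: parity_sign_def)
  have w0: "flip23 w 0 = w 0" for w by (simp add: flip23_def)
  have poly: "(\<lambda>w. P0 w * Q0 w + w 0 * (1 - w 0) * (P1 w * Q1 w)) \<in> polyfuns (4*n+4)"
    "(\<lambda>w. P0 w * Q1 w + P1 w * Q0 w) \<in> polyfuns (4*n+4)"
    by (intro polyfuns_intros p q; simp)+
  have main: "(p e * q e) * denom n w ^ (K + L) = P0 w * Q0 w + w 0 * (1 - w 0) * (P1 w * Q1 w) +
        s * (P0 w * Q1 w + P1 w * Q0 w)"
    if *: "denom n w \<noteq> 0 \<and> s\<^sup>2 = w 0 * (1 - w 0) \<and> (\<forall>v. admissible n k v \<longrightarrow> e v = joint_env n w s v)" for w s e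
  proof -
    have "(p e * q e) * denom n w ^ (K + L) = (p e * denom n w ^ K) * (q e * denom n w ^ L)"
      by (simp add: power_add algebra_simps)
    also have "\<dots> = (P0 w + s * P1 w) * (Q0 w + s * Q1 w)"
      using p(5)[of w s e] q(5)[of w s e] * by simp
    also have "\<dots> = P0 w * Q0 w + s\<^sup>2 * (P1 w * Q1 w) + s * (P0 w * Q1 w + P1 w * Q0 w)"
      by (simp add: algebra_simps power2_eq_square)
    finally show ?thesis using * by simp
  qed
  show ?case
    unfolding normal_form_def
  proof (rule exI[of _ "K + L"], rule exI[of _ "\<lambda>w. P0 w * Q0 w + w 0 * (1 - w 0) * (P1 w * Q1 w)"],
      rule exI[of _ "\<lambda>w. P0 w * Q1 w + P1 w * Q0 w"], intro conjI allI impI)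
    fix w
    show "P0 (flip23 w) * Q0 (flip23 w) + flip23 w 0 * (1 - flip23 w 0) * (P1 (flip23 w) * Q1 (flip23 w)) =
      parity_sign (g \<noteq> h) * (P0 w * Q0 w + w 0 * (1 - w 0) * (P1 w * Q1 w))"
      unfolding p(3,4) q(3,4) w0 sign by (simp add: algebra_simps)
    show "P0 (flip23 w) * Q1 (flip23 w) + P1 (flip23 w) * Q0 (flip23 w) =
      - parity_sign (g \<noteq> h) * (P0 w * Q1 w + P1 w * Q0 w)"
      unfolding p(3,4) q(3,4) sign by (simp add: algebra_simps)
  qed (fact poly main)+
qed

definition u_point :: "real \<Rightarrow> (nat \<Rightarrow> real) \<Rightarrow> nat \<Rightarrow> real" where
  "u_point \<eta> \<xi> = \<xi>(0 := (sin \<eta>)\<^sup>2, 3 := \<xi> 3 / sin \<eta>, 4 := \<xi> 4 / cos \<eta>)"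

text \<open>In an even symbol the coefficient of s, itself odd, must be odd. Only this parity is
  kept, as it is the one that makes an integral vanish later.\<close>

lemma trace_parametrix_rational:
  assumes n: "1 \<le> n"
  shows "\<exists>K P0 P1. P0 \<in> polyfuns (4*n+4) \<and> P1 \<in> polyfuns (4*n+4) \<and> (\<forall>w. P1 (flip23 w) = - P1 w) \<and>
    (\<forall>a T x \<xi>. good n a T x \<xi> \<longrightarrow> trace (parametrix a n (2*n) x \<xi>) = of_real
       (let w = join_vars n (\<lambda>i. (deriv ^^ i) a (x 1)) (u_point (x 2) \<xi>) in
         (P0 w + sin (x 2) * cos (x 2) * P1 w) / denom n w ^ K))"
proof -
  obtain p where p: "graded n (2*n) False p" and
    trace: "\<And>a T x \<xi>. good n a T x \<xi> \<Longrightarrow> trace (parametrix a n (2*n) x \<xi>) = of_real (p (env n a x \<xi>))"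
    using trace_parametrix[OF n] by blast
  obtain K P0 P1 where "normal_form n (2*n) False p K P0 P1"
    using graded_normal_form[OF n order_refl p] by blast
  note P = normal_formD[OF this]
  have "p (env n a x \<xi>) = (P0 w + sin (x 2) * cos (x 2) * P1 w) / denom n w ^ K"
    if good: "good n a T x \<xi>" and w: "w = join_vars n (\<lambda>i. (deriv ^^ i) a (x 1)) (u_point (x 2) \<xi>)" for a T x \<xi> w
  proof -
    note sc = good_sin_cos[OF good]
    have cos2: "1 - (sin (x 2))\<^sup>2 = (cos (x 2))\<^sup>2" by (simp add: cos_squared_eq)
    have wu: "w i = u_point (x 2) \<xi> i" if "i \<le> 2*n+2" for i using that by (simp add: w join_vars_def)
    have wj: "w (2*n+3+i) = (deriv ^^ i) a (x 1)" for i by (simp add: w join_vars_def)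
    have wa: "w (2*n+3) = a (x 1)" using wj[of 0] by simp
    have sum: "(\<Sum>i=5..2*n+2. (w i)\<^sup>2) = (\<Sum>i=5..2*n+2. (\<xi> i)\<^sup>2)"
      by (rule sum.cong) (auto simp: wu u_point_def)
    have Q: "cleared_Q n w = (a (x 1))\<^sup>2 * conf_sq n a x \<xi>"
      unfolding cleared_Q_def wa sum conf_sq_def
      using n sc by (simp add: wu u_point_def field_simps)
    have w0: "w 0 = (sin (x 2))\<^sup>2" by (simp add: wu u_point_def)
    have conf: "conf_sq n a x \<xi> \<noteq> 0" using good by (simp add: good_def)
    have den: "denom n w \<noteq> 0"
      unfolding denom_def Q w0 wa cos2 using sc conf by simp
    have "env n a x \<xi> v = joint_env n w (sin (x 2) * cos (x 2)) v" if "admissible n (2*n) v" for v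
    proof (cases v)
      case (UVar i)
      then show ?thesis using that by (auto simp: wu u_point_def)
    qed (use sc in \<open>simp_all add: wj wa w0 cos2 Q wj[simplified]\<close>)
    then have "p (env n a x \<xi>) * denom n w ^ K = P0 w + sin (x 2) * cos (x 2) * P1 w"
      by (intro P(5)[OF den]) (simp_all add: w0 cos2 power_mult_distrib)
    then show ?thesis using den by (simp add: field_simps)
  qed
  then show ?thesis
    using P trace by (intro exI[of _ K] exI[of _ P0] exI[of _ P1]) (simp add: Let_def parity_sign_def)
qed

section \<open>Pullbacks to graphs over coordinate hyperplanes\<close>

text \<open>The permutation of the single surviving term in the minors below: deleting index j in
  place of 1 moves the row of the graph function past b = j - 2 unit rows.\<close>

definition shift_cycle :: "nat \<Rightarrow> nat \<Rightarrow> nat \<Rightarrow> nat" where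
  "shift_cycle a b r = (if r = a then a + b else if a < r \<and> r \<le> a + b then r - 1 else r)"

lemma shift_cycle_Suc: "shift_cycle a (Suc b) = Transposition.transpose (a + b) (Suc (a + b)) \<circ> shift_cycle a b"
  by (auto simp: fun_eq_iff shift_cycle_def Transposition.transpose_def)

lemma shift_cycle_permutes_sign:
  "a + b < m \<Longrightarrow> shift_cycle a b permutes {..<m} \<and> sign (shift_cycle a b) = (-1) ^ b"
proof (induction b)
  case 0
  have "shift_cycle a 0 = id" by (auto simp: fun_eq_iff shift_cycle_def)
  then show ?case by (metis permutes_id sign_id power_0)
next
  case (Suc b)
  then have IH: "shift_cycle a b permutes {..<m}" "sign (shift_cycle a b) = (-1) ^ b" by auto
  have t: "Transposition.transpose (a + b) (Suc (a + b)) permutes {..<m}"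
    using Suc.prems by (intro permutes_swap_id) auto
  have "permutation (shift_cycle a b)" "permutation (Transposition.transpose (a + b) (Suc (a + b)))"
    using IH(1) t permutation_permutes by blast+
  then have "sign (shift_cycle a (Suc b)) = - sign (shift_cycle a b)"
    unfolding shift_cycle_Suc by (subst sign_compose) (simp_all add: sign_swap_id)
  moreover have "shift_cycle a (Suc b) permutes {..<m}"
    unfolding shift_cycle_Suc by (rule permutes_compose[OF IH(1) t])
  ultimately show ?case using IH(2) by simp
qed

text \<open>All rows but \<open>a\<close> are unit rows. A permutation with nonzero product agrees
  with \<open>p0\<close> on them, and then also at \<open>a\<close>, where only one value is
  left.\<close>

lemma sum_permutations_single:
  fixes M :: "nat \<Rightarrow> nat \<Rightarrow> real"
  assumes p0: "p0 permutes {..<m}" and a: "a < m"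
    and M: "\<And>r c. r < m \<Longrightarrow> r \<noteq> a \<Longrightarrow> c < m \<Longrightarrow> M r c = (if c = p0 r then 1 else 0)"
  shows "(\<Sum>p | p permutes {..<m}. of_int (sign p) * (\<Prod>r<m. M r (p r))) = of_int (sign p0) * M a (p0 a)"
proof -
  have "of_int (sign p) * (\<Prod>r<m. M r (p r)) = 0" if p: "p permutes {..<m}" "p \<noteq> p0" for p
  proof -
    have "\<exists>r<m. r \<noteq> a \<and> p r \<noteq> p0 r"
    proof (rule ccontr)
      assume "\<not> ?thesis"
      then have eq: "\<And>r. r < m \<Longrightarrow> r \<noteq> a \<Longrightarrow> p r = p0 r" by blast
      have "p a < m" using permutes_in_image[OF p(1), of a] a by simp
      then obtain r where r: "r < m" "p0 r = p a"
        using permutes_image[OF p0] by (metis imageE lessThan_iff)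
      have "r = a"
        using eq[OF r(1)] r(2) permutes_inj[OF p(1)] by (metis injD)
      then have "p r = p0 r" if "r < m" for r using eq that r by metis
      moreover have "p r = p0 r" if "\<not> r < m" for r
        using that permutes_not_in[OF p(1), of r] permutes_not_in[OF p0, of r] by simp
      ultimately show False using p(2) by blast
    qed
    then obtain r where r: "r < m" "r \<noteq> a" "p r \<noteq> p0 r" by blast
    moreover have "p r < m" using permutes_in_image[OF p(1), of r] r by simp
    ultimately have "M r (p r) = 0" using M by simp
    then have "(\<Prod>r<m. M r (p r)) = 0" using r(1) by (intro prod_zero) auto
    then show ?thesis by simp
  qed
  then have "(\<Sum>p | p permutes {..<m}. of_int (sign p) * (\<Prod>r<m. M r (p r))) =
      (\<Sum>p\<in>{p0}. of_int (sign p) * (\<Prod>r<m. M r (p r)))"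
    by (intro sum.mono_neutral_right) (auto simp: finite_permutations p0)
  also have "\<dots> = of_int (sign p0) * (\<Prod>r<m. M r (p0 r))" by simp
  also have "(\<Prod>r<m. M r (p0 r)) = M a (p0 a) * (\<Prod>r\<in>{..<m} - {a}. M r (p0 r))"
    using a by (subst prod.remove[of _ a]) auto
  also have "(\<Prod>r\<in>{..<m} - {a}. M r (p0 r)) = 1"
    by (intro prod.neutral) (use M permutes_in_image[OF p0] in auto)
  finally show ?thesis by simp
qed

lemma sorted_list_of_interval_remove:
  assumes "l \<le> j" "j \<le> m"
  shows "sorted_list_of_set ({l..m} - {j}) = [l..<j] @ [Suc j..<Suc m]"
proof -
  have "sorted_wrt (<) ([l..<j] @ [Suc j..<Suc m])"
    by (auto simp: sorted_wrt_append)
  moreover have "set ([l..<j] @ [Suc j..<Suc m]) = {l..m} - {j}" using assms by auto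
  moreover have "length ([l..<j] @ [Suc j..<Suc m]) = card ({l..m} - {j})" using assms by auto
  ultimately show ?thesis
    using sorted_list_of_set_unique[of "{l..m} - {j}" "[l..<j] @ [Suc j..<Suc m]"] by blast
qed

lemma sorted_list_of_interval_remove_nth:
  assumes "l \<le> j" "j \<le> m" "r < m - l"
  shows "sorted_list_of_set ({l..m} - {j}) ! r = (if l + r < j then l + r else Suc (l + r))"
  using assms by (auto simp: sorted_list_of_interval_remove nth_append simp del: upt_Suc)

lemma partial_deriv_coordinate: "partial_deriv c (\<lambda>z. z i) y = (if c = i then 1 else 0)"
proof -
  have "((\<lambda>s. (y(c := s)) i) has_vector_derivative (if c = i then 1 else 0)) (at (y c))"
    by (cases "c = i") (auto intro!: derivative_eq_intros)
  then show ?thesis unfolding partial_deriv_def by (rule vector_derivative_at)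
qed

text \<open>Coordinates other than the first are preserved, so only the row of index 1 is not a unit
  row. The lower end \<open>l\<close> is 1 for the sphere and 0 for A, which has the additional
  coordinate u_0.\<close>

lemma jacobian_minor_graph:
  assumes l: "l \<le> 1" and j: "1 \<le> j" "j \<le> m" and m: "2 \<le> m"
    and \<phi>: "\<And>z i. i \<in> {l..m} \<Longrightarrow> i \<noteq> 1 \<Longrightarrow> \<phi> z i = z i"
  shows "jacobian_minor ({l..m} - {j}) ({l..m} - {1}) \<phi> y =
    (if j = 1 then 1 else (-1) ^ (j - 2) * partial_deriv j (\<lambda>z. \<phi> z 1) y)"
proof -
  let ?I = "{l..m} - {j}" and ?J = "{l..m} - {1::nat}"
  let ?M = "\<lambda>r c. partial_deriv (sorted_list_of_set ?J ! c) (\<lambda>z. \<phi> z (sorted_list_of_set ?I ! r)) y"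
  have card: "card ?J = m - l" using l m by auto
  have I: "sorted_list_of_set ?I ! r = (if l + r < j then l + r else Suc (l + r))" if "r < m - l" for r
    using sorted_list_of_interval_remove_nth[of l j m r] that l j by simp
  have J: "sorted_list_of_set ?J ! c = (if l + c < 1 then l + c else Suc (l + c))" if "c < m - l" for c
    using sorted_list_of_interval_remove_nth[of l 1 m c] that l m by simp
  have jm: "jacobian_minor ?I ?J \<phi> y = (\<Sum>p | p permutes {..<m-l}. of_int (sign p) * (\<Prod>r<m-l. ?M r (p r)))"
    unfolding jacobian_minor_def card ..
  have M: "?M r c = (if sorted_list_of_set ?J ! c = sorted_list_of_set ?I ! r then 1 else 0)"
    if "r < m - l" "sorted_list_of_set ?I ! r \<noteq> 1" for r c
  proof -
    have "sorted_list_of_set ?I ! r \<in> {l..m}" using I[OF that(1)] that(1) by auto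
    then have "(\<lambda>z. \<phi> z (sorted_list_of_set ?I ! r)) = (\<lambda>z. z (sorted_list_of_set ?I ! r))"
      using \<phi> that(2) by blast
    then show ?thesis by (simp only: partial_deriv_coordinate)
  qed
  show ?thesis
  proof (cases "j = 1")
    case True
    have 1: "?M r c = (if c = id r then 1 else 0)" if "r < m - l" "c < m - l" for r c
      using M[OF that(1), of c] I[OF that(1)] J[OF that(1)] J[OF that(2)] l True by (auto split: if_splits)
    have "jacobian_minor ?I ?J \<phi> y = of_int (sign (id :: nat \<Rightarrow> nat)) * ?M 0 (id 0)"
      unfolding jm by (rule sum_permutations_single[OF permutes_id]) (use l m 1 in auto)
    then show ?thesis using 1[of 0 0] l m True by (simp add: sign_id)
  next
    case False
    then have j2: "2 \<le> j" using j by simp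
    \<comment> \<open>Counted from 0, the index 1 stands at position 1 - l of \<open>?I\<close> and
      the index j at position j - 1 - l of \<open>?J\<close>, which is j - 2 places further.\<close>
    let ?p = "shift_cycle (1 - l) (j - 2)"
    have p: "?p permutes {..<m-l}" "sign ?p = (-1) ^ (j - 2)"
      using shift_cycle_permutes_sign[of "1 - l" "j - 2" "m - l"] l j j2 by auto
    have "jacobian_minor ?I ?J \<phi> y = of_int (sign ?p) * ?M (1 - l) (?p (1 - l))"
      unfolding jm
    proof (rule sum_permutations_single[OF p(1)])
      show "1 - l < m - l" using l m by simp
      fix r c assume r: "r < m - l" "r \<noteq> 1 - l" and c: "c < m - l"
      have l01: "l = 0 \<or> l = 1" using l by arith
      have "sorted_list_of_set ?I ! r \<noteq> 1"
        unfolding I[OF r(1)] using r(2) l01 j2 by (simp split: if_split; linarith)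
      note 1 = M[OF r(1) this, of c]
      have 2: "((if l + c < 1 then l + c else Suc (l + c)) = (if l + r < j then l + r else Suc (l + r)))
          \<longleftrightarrow> c = ?p r"
        unfolding shift_cycle_def using r(2) l01 j2 by (elim disjE) (simp_all split: if_split, linarith+)
      show "?M r c = (if c = ?p r then 1 else 0)"
        by (simp only: 1) (simp only: I[OF r(1)] J[OF c] 2)
    qed
    also have "?p (1 - l) = j - 1 - l" using l j2 by (simp add: shift_cycle_def)
    also have "sorted_list_of_set ?J ! (j - 1 - l) = j" using J[of "j - 1 - l"] l j j2 by auto
    also have "sorted_list_of_set ?I ! (1 - l) = 1" using I[of "1 - l"] l j j2 by auto
    finally show ?thesis using False p(2) by simp
  qed
qed

lemma subsets_of_codimension_one:
  assumes "finite K"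
  shows "{I. I \<subseteq> K \<and> card I = card K - 1} = (if K = {} then {{}} else (\<lambda>j. K - {j}) ` K)"
proof (cases "K = {}")
  case False
  have "I \<in> (\<lambda>j. K - {j}) ` K" if "I \<subseteq> K" "card I = card K - 1" for I
  proof -
    have fin: "finite I" using that assms finite_subset by blast
    have "card (K - I) = 1"
      using card_Diff_subset[OF fin that(1)] that(2) False assms card_gt_0_iff[of K] by simp
    then obtain j where "K - I = {j}" by (auto simp: card_1_singleton_iff)
    then have "I = K - {j}" "j \<in> K" using that by auto
    then show ?thesis by (rule image_eqI)
  qed
  then have "{I. I \<subseteq> K \<and> card I = card K - 1} \<subseteq> (\<lambda>j. K - {j}) ` K"
    by (intro subsetI) simp
  moreover have "(\<lambda>j. K - {j}) ` K \<subseteq> {I. I \<subseteq> K \<and> card I = card K - 1}"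
    using assms by (auto simp: card_Diff_singleton)
  ultimately show ?thesis using False by simp
qed auto

text \<open>The sign (-1)^(j-2) of the minor and the sign (-1)^(j-1) of the form combine to -1 for
  every j from 2 on. What remains is the graph function minus its radial derivative.\<close>

lemma pullback_coeff_graph:
  assumes l: "l \<le> 1" and m: "2 \<le> m"
    and \<phi>: "\<And>z i. i \<in> {l..m} \<Longrightarrow> i \<noteq> 1 \<Longrightarrow> \<phi> z i = z i"
    and \<omega>: "\<And>j. j \<in> {1..m} \<Longrightarrow> \<omega> ({l..m} - {j}) (\<phi> y) = ((-1) ^ (j - 1) * \<phi> y j) *\<^sub>R c"
    and \<omega>0: "l = 0 \<Longrightarrow> \<omega> ({l..m} - {0}) (\<phi> y) = 0"
  shows "pullback_coeff {l..m} ({l..m} - {1}) \<phi> \<omega> y =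
    (\<phi> y 1 - (\<Sum>j=2..m. y j * partial_deriv j (\<lambda>z. \<phi> z 1) y)) *\<^sub>R c"
proof -
  let ?K = "{l..m}" and ?J = "{l..m} - {1::nat}"
  let ?t = "\<lambda>j. jacobian_minor (?K - {j}) ?J \<phi> y *\<^sub>R \<omega> (?K - {j}) (\<phi> y)"
  have "{I. I \<subseteq> ?K \<and> card I = card ?J} = (\<lambda>j. ?K - {j}) ` ?K"
    using subsets_of_codimension_one[of ?K] l m by (auto simp: card_Diff_singleton)
  moreover have "inj_on (\<lambda>j. ?K - {j}) ?K" by (auto simp: inj_on_def)
  ultimately have "pullback_coeff ?K ?J \<phi> \<omega> y = (\<Sum>j\<in>?K. ?t j)"
    unfolding pullback_coeff_def by (simp add: sum.reindex)
  also have "\<dots> = (\<Sum>j=1..m. ?t j)"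
    using l \<omega>0 by (intro sum.mono_neutral_right) (auto simp: not_le)
  also have "\<dots> = ?t 1 + (\<Sum>j=2..m. ?t j)"
    using m by (subst sum.atLeast_Suc_atMost) (auto simp: numeral_2_eq_2)
  also have "?t 1 = \<phi> y 1 *\<^sub>R c"
    using jacobian_minor_graph[OF l _ _ m, of 1 \<phi> y] \<phi> \<omega>[of 1] m by simp
  also have "(\<Sum>j=2..m. ?t j) = (\<Sum>j=2..m. - (y j * partial_deriv j (\<lambda>z. \<phi> z 1) y) *\<^sub>R c)"
  proof (rule sum.cong)
    fix j assume "j \<in> {2..m}"
    then have j: "2 \<le> j" "j \<le> m" by auto
    obtain i where i: "j = i + 2" using j(1) by (metis add.commute le_Suc_ex)
    have "(-1 :: real) ^ (j - 2) * (-1) ^ (j - 1) = -1"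
      by (simp add: i power_add[symmetric] mult_2[symmetric])
    moreover have "(-1) ^ (j - 2) * P * ((-1) ^ (j - 1) * Y) = ((-1) ^ (j - 2) * (-1) ^ (j - 1)) * (Y * P)"
      for P Y :: real by (simp only: mult_ac)
    ultimately have "(-1) ^ (j - 2) * partial_deriv j (\<lambda>z. \<phi> z 1) y * ((-1) ^ (j - 1) * y j) =
        - (y j * partial_deriv j (\<lambda>z. \<phi> z 1) y)"
      by simp
    moreover have "jacobian_minor (?K - {j}) ?J \<phi> y = (-1) ^ (j - 2) * partial_deriv j (\<lambda>z. \<phi> z 1) y"
      using jacobian_minor_graph[OF l _ j(2) m, of \<phi> y] \<phi> j by simp
    moreover have "\<omega> (?K - {j}) (\<phi> y) = ((-1) ^ (j - 1) * y j) *\<^sub>R c"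
      using \<omega>[of j] \<phi>[of j y] j l by simp
    ultimately show "?t j = - (y j * partial_deriv j (\<lambda>z. \<phi> z 1) y) *\<^sub>R c"
      by (simp only: scaleR_scaleR)
  qed simp
  finally show ?thesis
    by (simp add: scaleR_left_diff_distrib scaleR_sum_left sum_negf)
qed

text \<open>The coefficients may depend on coordinate 0, where u_0 will stand; differentiation in
  the directions from 2 on treats them as constants.\<close>

lemma partial_deriv_sqrt_quadric:
  assumes j: "j \<in> {2..m}" and pos: "(\<Sum>i=2..m. \<kappa> (y 0) i * (y i)\<^sup>2) < 1"
  shows "partial_deriv j (\<lambda>z. s * sqrt (1 - (\<Sum>i=2..m. \<kappa> (z 0) i * (z i)\<^sup>2))) y =
    - (s * \<kappa> (y 0) j * y j / sqrt (1 - (\<Sum>i=2..m. \<kappa> (y 0) i * (y i)\<^sup>2)))"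
proof -
  have "((\<lambda>t. \<kappa> ((y(j := t)) 0) i * ((y(j := t)) i)\<^sup>2) has_real_derivative
      (if i = j then 2 * \<kappa> (y 0) j * y j else 0)) (at (y j))" for i
    using j by (cases "i = j") (auto intro!: derivative_eq_intros)
  then have "((\<lambda>t. \<Sum>i=2..m. \<kappa> ((y(j := t)) 0) i * ((y(j := t)) i)\<^sup>2) has_real_derivative
      (\<Sum>i=2..m. if i = j then 2 * \<kappa> (y 0) j * y j else 0)) (at (y j))"
    by (intro DERIV_sum) blast
  then have *: "((\<lambda>t. \<Sum>i=2..m. \<kappa> ((y(j := t)) 0) i * ((y(j := t)) i)\<^sup>2) has_real_derivative
      2 * \<kappa> (y 0) j * y j) (at (y j))"
    using j by simp
  let ?S = "\<lambda>t. \<Sum>i=2..m. \<kappa> ((y(j := t)) 0) i * ((y(j := t)) i)\<^sup>2"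
  have S: "?S (y j) = (\<Sum>i=2..m. \<kappa> (y 0) i * (y i)\<^sup>2)" by simp
  have "((\<lambda>t. 1 - ?S t) has_real_derivative 0 - 2 * \<kappa> (y 0) j * y j) (at (y j))"
    by (rule DERIV_diff[OF DERIV_const *])
  moreover have "0 < 1 - ?S (y j)" using pos by (simp only: S)
  ultimately have "((\<lambda>t. s * sqrt (1 - ?S t)) has_real_derivative
      s * (inverse (sqrt (1 - ?S (y j))) / 2 * (0 - 2 * \<kappa> (y 0) j * y j))) (at (y j))"
    by (intro DERIV_cmult DERIV_chain2[of sqrt] DERIV_real_sqrt)
  moreover have "s * (inverse R / 2 * (0 - 2 * k * Y)) = - (s * k * Y / R)" for R k Y :: real
    by (cases "R = 0") (auto simp: field_simps)
  ultimately show ?thesis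
    unfolding partial_deriv_def
    by (intro vector_derivative_at) (simp only: has_real_derivative_iff_has_vector_derivative fun_upd_triv)
qed

text \<open>
  The form \<open>\<Sum>\<^sub>j (-1)\<^sup>j\<^sup>-\<^sup>1 x\<^sub>j dx\<^sub>1 \<dots> (omit dx\<^sub>j) \<dots>\<close>, restricted to a graph \<open>x\<^sub>1 = \<plusminus>\<surd>(1 - q)\<close> with \<open>q\<close>
  homogeneous quadratic in \<open>x\<^sub>2, \<dots>\<close>, is \<open>\<plusminus>1/\<surd>(1 - q)\<close> by Euler's identity.
\<close>

lemma pullback_coeff_quadric_graph:
  assumes l: "l \<le> 1" and m: "2 \<le> m"
    and \<phi>: "\<And>z i. i \<in> {l..m} \<Longrightarrow> i \<noteq> 1 \<Longrightarrow> \<phi> z i = z i"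
    and \<phi>1: "\<And>z. \<phi> z 1 = s * sqrt (1 - (\<Sum>i=2..m. \<kappa> (z 0) i * (z i)\<^sup>2))"
    and \<omega>: "\<And>j. j \<in> {1..m} \<Longrightarrow> \<omega> ({l..m} - {j}) (\<phi> y) = ((-1) ^ (j - 1) * \<phi> y j) *\<^sub>R c"
    and \<omega>0: "l = 0 \<Longrightarrow> \<omega> ({l..m} - {0}) (\<phi> y) = 0"
    and pos: "(\<Sum>i=2..m. \<kappa> (y 0) i * (y i)\<^sup>2) < 1"
  shows "pullback_coeff {l..m} ({l..m} - {1}) \<phi> \<omega> y =
    (s / sqrt (1 - (\<Sum>i=2..m. \<kappa> (y 0) i * (y i)\<^sup>2))) *\<^sub>R c"
proof -
  let ?q = "\<Sum>i=2..m. \<kappa> (y 0) i * (y i)\<^sup>2"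
  let ?r = "sqrt (1 - ?q)"
  have r: "?r > 0" "?r * ?r = 1 - ?q" using pos by auto
  have "(\<Sum>j=2..m. y j * partial_deriv j (\<lambda>z. \<phi> z 1) y) = (\<Sum>j=2..m. - (s / ?r) * (\<kappa> (y 0) j * (y j)\<^sup>2))"
  proof (rule sum.cong)
    fix j assume "j \<in> {2..m}"
    from partial_deriv_sqrt_quadric[where \<kappa>=\<kappa> and y=y and s=s, OF this pos]
    show "y j * partial_deriv j (\<lambda>z. \<phi> z 1) y = - (s / ?r) * (\<kappa> (y 0) j * (y j)\<^sup>2)"
      unfolding \<phi>1 by (simp add: power2_eq_square[of "y j"])
  qed simp
  also have "\<dots> = - (s / ?r) * ?q" by (simp only: sum_distrib_left)
  finally have "\<phi> y 1 - (\<Sum>j=2..m. y j * partial_deriv j (\<lambda>z. \<phi> z 1) y) = s * ?r + s / ?r * ?q"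
    unfolding \<phi>1 by simp
  also have "s * ?r + s / ?r * ?q = s / ?r * (?r * ?r + ?q)"
  proof -
    have "s * R + s / R * q = s / R * (R * R + q)" if "R > 0" for R q :: real
      using that by (simp add: field_simps)
    from this[OF r(1)] show ?thesis .
  qed
  also have "\<dots> = s / ?r" unfolding r(2) by simp
  finally have *: "\<phi> y 1 - (\<Sum>j=2..m. y j * partial_deriv j (\<lambda>z. \<phi> z 1) y) = s / ?r" .
  have "pullback_coeff {l..m} ({l..m} - {1}) \<phi> \<omega> y =
      (\<phi> y 1 - (\<Sum>j=2..m. y j * partial_deriv j (\<lambda>z. \<phi> z 1) y)) *\<^sub>R c"
    by (rule pullback_coeff_graph[where \<phi>=\<phi>]) (use l m \<phi> \<omega> \<omega>0 in auto)
  then show ?thesis unfolding * .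
qed

lemma sphere_form_codim_one: 
  assumes "j \<in> {1..m}"
  shows "sphere_form m ({1..m} - {j}) \<xi> = (-1) ^ (j - 1) * \<xi> j"
proof -
  have "({1..m} - {j} = {1..m} - {i}) \<longleftrightarrow> i = j" if "i \<in> {1..m}" for i
    using that assms by (metis DiffD2 DiffI singletonD singletonI)
  then have "sphere_form m ({1..m} - {j}) \<xi> = (\<Sum>i=1..m. if i = j then (-1) ^ (i - 1) * \<xi> i else 0)"
    unfolding sphere_form_def by (intro sum.cong) auto
  then show ?thesis using assms by simp
qed

lemma set_integral_cong_on:
  fixes f g :: "'a \<Rightarrow> 'b::{banach, second_countable_topology}"
  assumes "\<And>y. y \<in> space M \<Longrightarrow> y \<in> D \<longleftrightarrow> y \<in> E" "\<And>y. y \<in> space M \<Longrightarrow> y \<in> E \<Longrightarrow> f y = g y"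
  shows "set_lebesgue_integral M D f = set_lebesgue_integral M E g"
  unfolding set_lebesgue_integral_def
  using assms by (intro Bochner_Integration.integral_cong) (auto simp: indicator_def)

lemma set_integrable_cong_on:
  fixes f g :: "'a \<Rightarrow> 'b::{banach, second_countable_topology}"
  assumes "\<And>y. y \<in> space M \<Longrightarrow> y \<in> D \<longleftrightarrow> y \<in> E" "\<And>y. y \<in> space M \<Longrightarrow> y \<in> E \<Longrightarrow> f y = g y"
  shows "set_integrable M D f \<longleftrightarrow> set_integrable M E g"
  unfolding set_integrable_def
  using assms by (intro Bochner_Integration.integrable_cong) (auto simp: indicator_def)

text \<open>The orientation sign of each hemisphere cancels against the sign of \<xi>_1 in the
  restricted form, so both enter with the positive density 1/|\<xi>_1|.\<close>

lemma sphere_integral_sphere_form: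
  fixes f :: "(nat \<Rightarrow> real) \<Rightarrow> complex"
  assumes m: "2 \<le> m"
  shows "sphere_integral m (\<lambda>I \<xi>. f \<xi> * complex_of_real (sphere_form m I \<xi>)) =
    (\<Sum>s\<in>{1, -1}. LINT y : {y. (\<Sum>i=2..m. (y i)\<^sup>2) < 1} | PiM {2..m} (\<lambda>_. lborel).
       (1 / sqrt (1 - (\<Sum>i=2..m. (y i)\<^sup>2))) *\<^sub>R f (hemisphere m s y))"
proof -
  let ?\<omega> = "\<lambda>I \<xi>. f \<xi> * complex_of_real (sphere_form m I \<xi>)"
  let ?S = "{y :: nat \<Rightarrow> real. (\<Sum>i=2..m. (y i)\<^sup>2) < 1}" and ?M = "PiM {2..m} (\<lambda>_. lborel :: real measure)"
  have J: "{2..m} = {1..m} - {1}" by auto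
  have "pullback_coeff {1..m} {2..m} (hemisphere m s) ?\<omega> y =
      s *\<^sub>R (1 / sqrt (1 - (\<Sum>i=2..m. (y i)\<^sup>2))) *\<^sub>R f (hemisphere m s y)" if "y \<in> ?S" for s y
    using pullback_coeff_quadric_graph[where l=1 and m=m and \<phi>="hemisphere m s" and s=s and \<kappa>="\<lambda>_ _. 1"
        and y=y and c="f (hemisphere m s y)" and \<omega>="?\<omega>", folded J] m that
    by (simp add: hemisphere_def sphere_form_codim_one[simplified] scaleR_conv_of_real mult_ac)
  note pb = this
  have "sphere_integral m ?\<omega> = (\<Sum>s\<in>{1, -1}. s *\<^sub>R (LINT y : ?S | ?M.
      s *\<^sub>R (1 / sqrt (1 - (\<Sum>i=2..m. (y i)\<^sup>2))) *\<^sub>R f (hemisphere m s y)))"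
    unfolding sphere_integral_def
    by (intro sum.cong refl arg_cong[where f="\<lambda>z. _ *\<^sub>R z"] set_integral_cong_on pb)
  also have "\<dots> = (\<Sum>s\<in>{1, -1}. LINT y : ?S | ?M. (1 / sqrt (1 - (\<Sum>i=2..m. (y i)\<^sup>2))) *\<^sub>R f (hemisphere m s y))"
    by (simp add: set_lebesgue_integral_def)
  finally show ?thesis .
qed

section \<open>Product Lebesgue measure and reflections\<close>

lemma product_sigma_finite_lborel: "product_sigma_finite (\<lambda>_ :: nat. lborel :: real measure)"
  by standard

text \<open>Both measures are compared on boxes, where they factor into one-dimensional scalings;
  boxes determine the product measure.\<close>

lemma PiM_lborel_scale:
  fixes c :: "nat \<Rightarrow> real"
  assumes I: "finite I" and c: "\<And>i. i \<in> I \<Longrightarrow> c i \<noteq> 0"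
  defines "M \<equiv> PiM I (\<lambda>_. lborel :: real measure)"
  shows "density (distr M M (\<lambda>y. \<lambda>i\<in>I. c i * y i)) (\<lambda>_. ennreal (\<Prod>i\<in>I. \<bar>c i\<bar>)) = M"
    (is "density ?D ?k = M")
  unfolding M_def
proof (rule product_sigma_finite.PiM_eqI[OF product_sigma_finite_lborel I])
  show "sets (density (distr (PiM I (\<lambda>_. lborel)) (PiM I (\<lambda>_. lborel)) (\<lambda>y. \<lambda>i\<in>I. c i * y i))
      (\<lambda>_. ennreal (\<Prod>i\<in>I. \<bar>c i\<bar>))) = sets (PiM I (\<lambda>_. lborel))"
    by simp
next
  fix A :: "nat \<Rightarrow> real set" assume A: "\<And>i. i \<in> I \<Longrightarrow> A i \<in> sets lborel"
  have T: "(\<lambda>y. \<lambda>i\<in>I. c i * y i) \<in> measurable M M"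
    unfolding M_def by measurable
  have box: "PiE I A \<in> sets M" using A I unfolding M_def by (intro sets_PiM_I_finite) auto
  have pre: "(\<lambda>y. \<lambda>i\<in>I. c i * y i) -` PiE I A \<inter> space M = PiE I (\<lambda>i. (\<lambda>t. c i * t) -` A i)"
    unfolding M_def space_PiM by (auto simp: PiE_iff)
  have scale: "ennreal \<bar>c i\<bar> * emeasure lborel ((\<lambda>t. c i * t) -` A i) = emeasure lborel (A i)" if "i \<in> I" for i
  proof -
    have meas: "A i \<in> sets borel" using A[OF that] by simp
    have "emeasure lborel (A i) = emeasure (density (distr lborel borel (\<lambda>x. 0 + c i * x)) (\<lambda>_. ennreal \<bar>c i\<bar>)) (A i)"
      using lborel_real_affine[OF c[OF that], of 0] by simp
    also have "\<dots> = ennreal \<bar>c i\<bar> * emeasure (distr lborel borel (\<lambda>x. 0 + c i * x)) (A i)"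
      using meas by (subst emeasure_density_const) auto
    also have "emeasure (distr lborel borel (\<lambda>x. 0 + c i * x)) (A i) = emeasure lborel ((\<lambda>t. c i * t) -` A i)"
      using meas by (subst emeasure_distr) auto
    finally show ?thesis by simp
  qed
  have "emeasure (density ?D ?k) (PiE I A) = ennreal (\<Prod>i\<in>I. \<bar>c i\<bar>) * emeasure ?D (PiE I A)"
    using box by (subst emeasure_density_const) auto
  also have "emeasure ?D (PiE I A) = emeasure M (PiE I (\<lambda>i. (\<lambda>t. c i * t) -` A i))"
    unfolding emeasure_distr[OF T box] pre ..
  also have "\<dots> = (\<Prod>i\<in>I. emeasure lborel ((\<lambda>t. c i * t) -` A i))"
    unfolding M_def
  proof (rule product_sigma_finite.emeasure_PiM[OF product_sigma_finite_lborel I])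
    fix i assume "i \<in> I"
    then have [measurable]: "A i \<in> sets borel" using A by auto
    show "(\<lambda>t. c i * t) -` A i \<in> sets lborel"
      using measurable_sets[of "\<lambda>t. c i * t" borel borel "A i"] by simp
  qed
  also have "ennreal (\<Prod>i\<in>I. \<bar>c i\<bar>) * (\<Prod>i\<in>I. emeasure lborel ((\<lambda>t. c i * t) -` A i)) =
      (\<Prod>i\<in>I. emeasure lborel (A i))"
    by (simp add: prod_ennreal[symmetric] prod.distrib[symmetric] scale cong: prod.cong)
  finally show "emeasure (density (distr (PiM I (\<lambda>_. lborel)) (PiM I (\<lambda>_. lborel)) (\<lambda>y. \<lambda>i\<in>I. c i * y i))
      (\<lambda>_. ennreal (\<Prod>i\<in>I. \<bar>c i\<bar>))) (PiE I A) = (\<Prod>i\<in>I. emeasure lborel (A i))"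
    unfolding M_def .
qed

lemma integral_PiM_lborel_scale:
  fixes c :: "nat \<Rightarrow> real" and f :: "(nat \<Rightarrow> real) \<Rightarrow> 'b::{banach, second_countable_topology}"
  assumes I: "finite I" and c: "\<And>i. i \<in> I \<Longrightarrow> c i \<noteq> 0"
    and f: "f \<in> borel_measurable (PiM I (\<lambda>_. lborel :: real measure))"
  shows "integral\<^sup>L (PiM I (\<lambda>_. lborel)) f =
    (\<Prod>i\<in>I. \<bar>c i\<bar>) *\<^sub>R integral\<^sup>L (PiM I (\<lambda>_. lborel)) (\<lambda>y. f (\<lambda>i\<in>I. c i * y i))"
proof -
  let ?M = "PiM I (\<lambda>_. lborel :: real measure)" and ?T = "\<lambda>y :: nat \<Rightarrow> real. \<lambda>i\<in>I. c i * y i"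
  have T: "?T \<in> measurable ?M ?M" by measurable
  have "integral\<^sup>L ?M f = integral\<^sup>L (density (distr ?M ?M ?T) (\<lambda>_. ennreal (\<Prod>i\<in>I. \<bar>c i\<bar>))) f"
    using PiM_lborel_scale[OF I c] by simp
  also have "\<dots> = integral\<^sup>L (distr ?M ?M ?T) (\<lambda>y. (\<Prod>i\<in>I. \<bar>c i\<bar>) *\<^sub>R f y)"
    using f by (intro integral_density) (auto intro!: prod_nonneg)
  also have "\<dots> = integral\<^sup>L ?M (\<lambda>y. (\<Prod>i\<in>I. \<bar>c i\<bar>) *\<^sub>R f (?T y))"
    using f T by (intro integral_distr) auto
  finally show ?thesis by simp
qed

lemma PiM_lborel_reflect:
  assumes I: "finite I" and i: "i \<in> I"
  defines "M \<equiv> PiM I (\<lambda>_ :: nat. lborel :: real measure)"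
  shows "(\<lambda>y. y(i := - y i)) \<in> measurable M M" "distr M M (\<lambda>y. y(i := - y i)) = M"
proof -
  let ?T = "\<lambda>y. \<lambda>j\<in>I. (if j = i then - 1 else 1) * y j"
  have eq: "?T y = y(i := - y i)" if "y \<in> space M" for y
    using that i by (auto simp: M_def fun_eq_iff space_PiM PiE_def extensional_def)
  have "?T \<in> measurable M M" unfolding M_def by measurable
  then show "(\<lambda>y. y(i := - y i)) \<in> measurable M M" by (simp add: eq cong: measurable_cong)
  have "distr M M ?T = M"
    using PiM_lborel_scale[OF I, of "\<lambda>j. if j = i then - 1 else 1"]
    by (simp add: M_def if_distrib[of abs] density_1 cong: if_cong)
  then show "distr M M (\<lambda>y. y(i := - y i)) = M" by (simp add: eq cong: distr_cong)
qed

lemma integral_PiM_lborel_reflect: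
  fixes f :: "(nat \<Rightarrow> real) \<Rightarrow> 'b::{banach, second_countable_topology}"
  assumes "finite I" "i \<in> I" "f \<in> borel_measurable (PiM I (\<lambda>_. lborel :: real measure))"
  shows "integral\<^sup>L (PiM I (\<lambda>_. lborel)) f = integral\<^sup>L (PiM I (\<lambda>_. lborel)) (\<lambda>y. f (y(i := - y i)))"
  using integral_distr[OF PiM_lborel_reflect(1)[OF assms(1,2)] assms(3)]
  by (simp add: PiM_lborel_reflect(2)[OF assms(1,2)])

lemma PiM_lborel_hyperplane_null:
  fixes I :: "nat set"
  assumes I: "finite I" and i: "i \<in> I"
  shows "AE y in PiM I (\<lambda>_. lborel :: real measure). y i \<noteq> 0"
proof -
  let ?A = "\<lambda>j. if j = i then {0} else UNIV :: real set"
  have "emeasure (PiM I (\<lambda>_. lborel)) (PiE I ?A) = (\<Prod>j\<in>I. emeasure lborel (?A j))"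
    by (rule product_sigma_finite.emeasure_PiM[OF product_sigma_finite_lborel I]) auto
  also have "\<dots> = 0" using I i by (auto intro!: prod_zero bexI[of _ i])
  finally have "PiE I ?A \<in> null_sets (PiM I (\<lambda>_. lborel))"
    using I by (auto simp: null_sets_def intro!: sets_PiM_I_finite)
  then show ?thesis
    by (rule AE_I') (use i in \<open>auto simp: space_PiM PiE_iff extensional_def\<close>)
qed

text \<open>The hyperplane is a null set, and the reflection carries the negative half of
  \<open>D\<close> to the positive one.\<close>

lemma set_integral_PiM_lborel_half:
  fixes h :: "(nat \<Rightarrow> real) \<Rightarrow> real"
  assumes I: "finite I" and i: "i \<in> I" and sym: "\<And>y. y(i := - y i) \<in> D \<longleftrightarrow> y \<in> D"
    and h: "set_integrable (PiM I (\<lambda>_. lborel)) D h"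
  shows "(LINT y : D | PiM I (\<lambda>_. lborel). h y) =
    (LINT y : D \<inter> {y. y i > 0} | PiM I (\<lambda>_. lborel). h y + h (y(i := - y i)))"
proof -
  let ?M = "PiM I (\<lambda>_. lborel :: real measure)"
  let ?f = "\<lambda>y. indicator D y * h y"
  have f: "integrable ?M ?f" using h by (simp add: set_integrable_def)
  have fm [measurable]: "?f \<in> borel_measurable ?M" using f by simp
  have [measurable]: "(\<lambda>y. y i) \<in> borel_measurable ?M"
    using measurable_component_singleton[OF i, of "\<lambda>_. lborel"] by simp
  have [measurable]: "(\<lambda>y. indicator {y. y i > 0} y :: real) \<in> borel_measurable ?M"
    "(\<lambda>y. indicator {y. y i < 0} y :: real) \<in> borel_measurable ?M"
    by measurable
  have pos: "integrable ?M (\<lambda>y. indicator {y. y i > 0} y * ?f y)"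
    by (rule Bochner_Integration.integrable_bound[OF f], measurable) (auto simp: indicator_def)
  have neg: "integrable ?M (\<lambda>y. indicator {y. y i < 0} y * ?f y)"
    by (rule Bochner_Integration.integrable_bound[OF f], measurable) (auto simp: indicator_def)
  have pos': "integrable ?M (\<lambda>y. indicator {y. y i > 0} y * ?f (y(i := - y i)))"
  proof -
    have "integrable (distr ?M ?M (\<lambda>y. y(i := - y i))) (\<lambda>y. indicator {y. y i < 0} y * ?f y)"
      using neg by (simp only: PiM_lborel_reflect(2)[OF I i])
    then have "integrable ?M (\<lambda>y. indicator {y. y i < 0} (y(i := - y i)) * ?f (y(i := - y i)))"
      by (subst (asm) integrable_distr_eq[OF PiM_lborel_reflect(1)[OF I i]]) auto
    then show ?thesis by (simp add: indicator_def cong: if_cong)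
  qed
  have "integral\<^sup>L ?M ?f = integral\<^sup>L ?M (\<lambda>y. indicator {y. y i > 0} y * ?f y + indicator {y. y i < 0} y * ?f y)"
  proof (intro integral_cong_AE)
    show "AE y in ?M. ?f y = indicator {y. y i > 0} y * ?f y + indicator {y. y i < 0} y * ?f y"
      using PiM_lborel_hyperplane_null[OF I i] by eventually_elim (auto simp: indicator_def)
  qed measurable
  also have "\<dots> = integral\<^sup>L ?M (\<lambda>y. indicator {y. y i > 0} y * ?f y) + integral\<^sup>L ?M (\<lambda>y. indicator {y. y i < 0} y * ?f y)"
    by (rule Bochner_Integration.integral_add[OF pos neg])
  also have "integral\<^sup>L ?M (\<lambda>y. indicator {y. y i < 0} y * ?f y) =
      integral\<^sup>L ?M (\<lambda>y. indicator {y. y i < 0} (y(i := - y i)) * ?f (y(i := - y i)))"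
    by (rule integral_PiM_lborel_reflect[OF I i]) measurable
  also have "\<dots> = integral\<^sup>L ?M (\<lambda>y. indicator {y. y i > 0} y * ?f (y(i := - y i)))"
    by (intro Bochner_Integration.integral_cong) (auto simp: indicator_def)
  also have "integral\<^sup>L ?M (\<lambda>y. indicator {y. y i > 0} y * ?f y) + \<dots> =
      integral\<^sup>L ?M (\<lambda>y. indicator {y. y i > 0} y * ?f y + indicator {y. y i > 0} y * ?f (y(i := - y i)))"
    by (rule Bochner_Integration.integral_add[OF pos pos', symmetric])
  finally show ?thesis
    unfolding set_lebesgue_integral_def using sym
    by (auto simp: indicator_def algebra_simps intro!: Bochner_Integration.integral_cong)
qed

text \<open>An antiderivative is arcsin (t / sqrt c). That the value is independent of c bounds the
  inner integral over u_2 uniformly in the other coordinates.\<close>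

lemma nn_integral_inverse_sqrt:
  assumes c: "c > 0"
  shows "(\<integral>\<^sup>+ t. indicator {t. t\<^sup>2 < c} t * ennreal (1 / sqrt (c - t\<^sup>2)) \<partial>lborel) = ennreal pi"
proof -
  let ?d = "sqrt c"
  have d: "?d > 0" and dd: "?d\<^sup>2 = c" using c by auto
  have sq: "t\<^sup>2 < c \<longleftrightarrow> - ?d < t \<and> t < ?d" for t
    using real_sqrt_less_iff[of "t\<^sup>2" c] by (simp add: abs_less_iff) linarith
  then have set: "{t. t\<^sup>2 < c} = einterval (ereal (- ?d)) (ereal ?d)"
    by (simp add: einterval_def)
  have cont: "continuous_on {- ?d .. ?d} (\<lambda>t. arcsin (t / ?d))"
    using d by (intro continuous_on_arcsin continuous_intros) (auto simp: field_simps)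
  have pos: "c - t\<^sup>2 > 0" if "ereal (- ?d) < ereal t" "ereal t < ereal ?d" for t
    using sq[of t] that by simp
  have deriv: "DERIV (\<lambda>t. arcsin (t / ?d)) t :> 1 / sqrt (c - t\<^sup>2)"
    if t: "ereal (- ?d) < ereal t" "ereal t < ereal ?d" for t
  proof -
    have lt: "- 1 < t / ?d" "t / ?d < 1" using d t by (auto simp: field_simps)
    have "DERIV (\<lambda>t. arcsin (t / ?d)) t :> inverse (sqrt (1 - (t / ?d)\<^sup>2)) * (1 / ?d)"
      using lt by (intro DERIV_chain2[OF DERIV_arcsin] DERIV_cdivide[OF DERIV_ident])
    moreover have "inverse (sqrt (1 - (t / ?d)\<^sup>2)) * (1 / ?d) = 1 / (sqrt ((1 - (t / ?d)\<^sup>2) * c))"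
      by (simp add: real_sqrt_mult divide_inverse)
    moreover have "(1 - (t / ?d)\<^sup>2) * c = c - t\<^sup>2"
      using c by (simp add: power_divide field_simps)
    ultimately show ?thesis by simp
  qed
  have lim: "(((\<lambda>t. arcsin (t / ?d)) \<circ> real_of_ereal) \<longlongrightarrow> arcsin (- 1)) (at_right (ereal (- ?d)))"
    "(((\<lambda>t. arcsin (t / ?d)) \<circ> real_of_ereal) \<longlongrightarrow> arcsin 1) (at_left (ereal ?d))"
    using continuous_on_Icc_at_rightD[OF cont] continuous_on_Icc_at_leftD[OF cont] d
    by (simp_all add: ereal_tendsto_simps)
  have cont': "isCont (\<lambda>t. 1 / sqrt (c - t\<^sup>2)) t" if "ereal (- ?d) < ereal t" "ereal t < ereal ?d" for t
    using pos[OF that] by (intro continuous_intros) auto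
  have nonneg: "AE t in lborel. ereal (- ?d) < ereal t \<longrightarrow> ereal t < ereal ?d \<longrightarrow> 0 \<le> 1 / sqrt (c - t\<^sup>2)"
    using pos by (intro AE_I2 impI) (simp add: less_imp_le)
  have "ereal (- ?d) < ereal ?d" using d by simp
  note * = interval_integral_FTC_nonneg[OF this deriv cont' nonneg lim]
  have "(\<integral>\<^sup>+ t. indicator {t. t\<^sup>2 < c} t * ennreal (1 / sqrt (c - t\<^sup>2)) \<partial>lborel) =
      (\<integral>\<^sup>+ t. ennreal (indicator {t. t\<^sup>2 < c} t * (1 / sqrt (c - t\<^sup>2))) \<partial>lborel)"
    by (intro nn_integral_cong) (auto simp: indicator_def)
  also have "\<dots> = ennreal (LINT t:{t. t\<^sup>2 < c}|lborel. 1 / sqrt (c - t\<^sup>2))"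
    using *(1) unfolding set[symmetric] set_integrable_def set_lebesgue_integral_def
    by (subst nn_integral_eq_integral) (auto simp: indicator_def)
  also have "(LINT t:{t. t\<^sup>2 < c}|lborel. 1 / sqrt (c - t\<^sup>2)) = arcsin 1 - arcsin (- 1)"
    using *(2) d unfolding set interval_lebesgue_integral_def by simp
  finally show ?thesis by simp
qed

section \<open>Integrals over the slices\<close>

definition quad_coeff :: "real \<Rightarrow> nat \<Rightarrow> real" where
  "quad_coeff u0 i = (if i = 3 then u0 else if i = 4 then 1 - u0 else 1)"

definition quad :: "nat \<Rightarrow> real \<Rightarrow> (nat \<Rightarrow> real) \<Rightarrow> real" where
  "quad m u0 y = (\<Sum>i=2..m. quad_coeff u0 i * (y i)\<^sup>2)"

definition graph_point :: "nat \<Rightarrow> (nat \<Rightarrow> real) \<Rightarrow> real \<Rightarrow> real \<Rightarrow> (nat \<Rightarrow> real) \<Rightarrow> nat \<Rightarrow> real" where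
  "graph_point n b s u0 y = join_vars n b (y(0 := u0, 1 := s * sqrt (1 - quad (2*n+2) u0 y)))"

text \<open>The last divisor is |u_1|: the quotient by it is the density of the restricted Euler
  form.\<close>

definition slice_kernel ::
    "nat \<Rightarrow> nat \<Rightarrow> ((nat \<Rightarrow> real) \<Rightarrow> real) \<Rightarrow> (nat \<Rightarrow> real) \<Rightarrow> real \<Rightarrow> real \<Rightarrow> (nat \<Rightarrow> real) \<Rightarrow> real" where
  "slice_kernel n K P b s u0 y =
     P (graph_point n b s u0 y) / denom n (graph_point n b s u0 y) ^ K / sqrt (1 - quad (2*n+2) u0 y)"

abbreviation slice_measure :: "nat \<Rightarrow> (nat \<Rightarrow> real) measure" where
  "slice_measure n \<equiv> PiM {2..2*n+2} (\<lambda>_. lborel)"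

text \<open>The set \<open>S\<close> interpolates between the full slice, on which the reflections
  act, and the slice of A, where certain coordinates are positive.\<close>

definition half_slice :: "nat \<Rightarrow> nat set \<Rightarrow> real \<Rightarrow> (nat \<Rightarrow> real) set" where
  "half_slice n S u0 = {y. quad (2*n+2) u0 y < 1 \<and> (\<forall>i\<in>S. 0 < y i)}"

lemma graph_point_simps:
  "graph_point n b s u0 y 0 = u0"
  "graph_point n b s u0 y 1 = s * sqrt (1 - quad (2*n+2) u0 y)"
  "2 \<le> i \<Longrightarrow> i \<le> 2*n+2 \<Longrightarrow> graph_point n b s u0 y i = y i"
  "graph_point n b s u0 y (2*n+3+i) = b i"
  by (auto simp: graph_point_def join_vars_def)

lemma quad_expand:
  assumes "1 \<le> n"
  shows "quad (2*n+2) u0 y = (y 2)\<^sup>2 + u0 * (y 3)\<^sup>2 + (1 - u0) * (y 4)\<^sup>2 + (\<Sum>i=5..2*n+2. (y i)\<^sup>2)"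
proof -
  have "quad (2*n+2) u0 y = (\<Sum>i\<in>{2,3,4} \<union> {5..2*n+2}. quad_coeff u0 i * (y i)\<^sup>2)"
    unfolding quad_def using assms by (intro sum.cong) auto
  also have "\<dots> = (\<Sum>i\<in>{2,3,4}. quad_coeff u0 i * (y i)\<^sup>2) + (\<Sum>i=5..2*n+2. quad_coeff u0 i * (y i)\<^sup>2)"
    by (intro sum.union_disjoint) auto
  also have "(\<Sum>i=5..2*n+2. quad_coeff u0 i * (y i)\<^sup>2) = (\<Sum>i=5..2*n+2. (y i)\<^sup>2)"
    by (intro sum.cong) (auto simp: quad_coeff_def)
  finally show ?thesis by (simp add: quad_coeff_def)
qed

lemma quad_reflect: "quad m u0 (y(i := - y i)) = quad m u0 y"
  unfolding quad_def by (intro sum.cong) auto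

lemma quad_term_le:
  assumes "0 < u0" "u0 < 1" "i \<in> A" "finite A"
  shows "quad_coeff u0 i * (y i)\<^sup>2 \<le> (\<Sum>i\<in>A. quad_coeff u0 i * (y i)\<^sup>2)"
  using assms by (intro member_le_sum) (auto simp: quad_coeff_def)

lemma quad_coeff_ge: "0 < u0 \<Longrightarrow> u0 < 1 \<Longrightarrow> u0 * (1 - u0) \<le> quad_coeff u0 i"
proof -
  assume u0: "0 < u0" "u0 < 1"
  have "u0 * (1 - u0) \<le> u0 * 1" "u0 * (1 - u0) \<le> 1 * (1 - u0)"
    using u0 by (intro mult_left_mono mult_right_mono; simp)+
  moreover from this(1) have "u0 * (1 - u0) \<le> 1" using u0 by linarith
  ultimately show ?thesis by (simp add: quad_coeff_def)
qed

text \<open>Every coefficient is at least u_0 (1 - u_0), and |t| is at most 1 + t^2. The bound is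
  not uniform as u_0 approaches 0 or 1.\<close>

lemma coordinate_bound:
  assumes u0: "0 < u0" "u0 < 1" and i: "i \<in> A" "finite A" and lt: "(\<Sum>i\<in>A. quad_coeff u0 i * (y i)\<^sup>2) < 1"
  shows "\<bar>y i\<bar> \<le> 1 + 1 / (u0 * (1 - u0))"
proof -
  have pos: "0 < u0 * (1 - u0)" using u0 by simp
  have "u0 * (1 - u0) * (y i)\<^sup>2 \<le> quad_coeff u0 i * (y i)\<^sup>2"
    by (intro mult_right_mono quad_coeff_ge u0) auto
  also have "\<dots> < 1" using quad_term_le[OF u0 i, of y] lt by linarith
  finally have "(y i)\<^sup>2 \<le> 1 / (u0 * (1 - u0))" using pos by (simp add: field_simps)
  moreover have "\<bar>y i\<bar> \<le> 1 + (y i)\<^sup>2"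
  proof (cases "\<bar>y i\<bar> \<le> 1")
    case False
    then have "\<bar>y i\<bar> * 1 \<le> \<bar>y i\<bar> * \<bar>y i\<bar>" by (intro mult_left_mono) auto
    then show ?thesis by (simp add: power2_eq_square)
  qed (use zero_le_power2[of "y i"] in linarith)
  ultimately show ?thesis by linarith
qed

section \<open>Symmetries and bounds of the integrand\<close>

lemma denom_reflect: "1 \<le> i \<Longrightarrow> i \<le> 2*n+2 \<Longrightarrow> denom n (w(i := - w i)) = denom n (w :: nat \<Rightarrow> real)"
proof -
  assume i: "1 \<le> i" "i \<le> 2*n+2"
  have sq: "((w(i := - w i)) j)\<^sup>2 = (w j)\<^sup>2" for j by simp
  show ?thesis
    unfolding denom_def cleared_Q_def sq using i by simp
qed

lemma graph_point_reflect:
  assumes "2 \<le> i" "i \<le> 2*n+2"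
  shows "graph_point n b s u0 (y(i := - y i)) = (graph_point n b s u0 y)(i := - graph_point n b s u0 y i)"
proof -
  have "(y(i := - y i))(0 := u0, 1 := c) = (y(0 := u0, 1 := c))(i := - y i)" for c
    using assms by (auto simp: fun_eq_iff)
  then show ?thesis
    unfolding graph_point_def quad_reflect using assms by (auto simp: join_vars_def fun_eq_iff)
qed

lemma slice_kernel_reflect:
  assumes "2 \<le> i" "i \<le> 2*n+2"
  shows "slice_kernel n K P b s u0 (y(i := - y i)) = slice_kernel n K (\<lambda>w. P (w(i := - w i))) b s u0 y"
  using assms by (simp add: slice_kernel_def graph_point_reflect denom_reflect quad_reflect)

lemma slice_kernel_reflect_sign:
  "slice_kernel n K P b (- s) u0 y = slice_kernel n K (\<lambda>w. P (w(1 := - w 1))) b s u0 y"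
proof -
  have "graph_point n b (- s) u0 y = (graph_point n b s u0 y)(1 := - graph_point n b s u0 y 1)"
    by (auto simp: graph_point_def join_vars_def fun_eq_iff)
  then show ?thesis by (simp add: slice_kernel_def denom_reflect)
qed

lemma slice_kernel_add: "slice_kernel n K (\<lambda>w. P w + P' w) b s u0 y = slice_kernel n K P b s u0 y + slice_kernel n K P' b s u0 y"
  by (simp add: slice_kernel_def add_divide_distrib)

text \<open>On the quadric u_1^2 + q = 1, where q is \<open>quad\<close>. Since u_0 and 1 - u_0 are
  less than 1, \<alpha>^2 Q is term by term at least min(\<alpha>^2, 1) times the left side.\<close>

lemma denom_lower_bound:
  assumes n: "1 \<le> n" and u0: "0 < u0" "u0 < 1" and b: "0 < b 0" and s: "s\<^sup>2 = 1" and q: "quad (2*n+2) u0 y < 1"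
  shows "u0 * (1 - u0) * b 0 * min ((b 0)\<^sup>2) 1 \<le> denom n (graph_point n b s u0 y)"
proof -
  let ?w = "graph_point n b s u0 y" and ?\<mu> = "min ((b 0)\<^sup>2) 1" and ?q = "quad (2*n+2) u0 y"
  have sum: "(\<Sum>i=5..2*n+2. (?w i)\<^sup>2) = (\<Sum>i=5..2*n+2. (y i)\<^sup>2)"
    by (rule sum.cong) (auto simp: graph_point_simps)
  have w: "?w 1 = s * sqrt (1 - ?q)" "?w 2 = y 2" "?w 3 = y 3" "?w 4 = y 4" "?w (2*n+3) = b 0"
    using n graph_point_simps(4)[of n b s u0 y 0]
    by (simp_all only: graph_point_simps(2)) (simp_all add: graph_point_simps)
  have "(?w 1)\<^sup>2 = 1 - ?q" unfolding w(1) using s q by (simp add: power_mult_distrib)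
  then have Q: "cleared_Q n ?w = (b 0)\<^sup>2 * (1 - ?q) + ((y 2)\<^sup>2 + (y 3)\<^sup>2 + (y 4)\<^sup>2) + (b 0)\<^sup>2 * (\<Sum>i=5..2*n+2. (y i)\<^sup>2)"
    unfolding cleared_Q_def sum w(2-5) by simp
  have \<mu>: "0 \<le> ?\<mu>" "?\<mu> \<le> (b 0)\<^sup>2" "?\<mu> \<le> 1" by auto
  have t1: "?\<mu> * (1 - ?q) \<le> (b 0)\<^sup>2 * (1 - ?q)" using q \<mu> by (intro mult_right_mono) auto
  have t2: "?\<mu> * (y 2)\<^sup>2 \<le> 1 * (y 2)\<^sup>2" using \<mu> by (intro mult_right_mono) auto
  have t3: "?\<mu> * (u0 * (y 3)\<^sup>2) \<le> 1 * (1 * (y 3)\<^sup>2)" using \<mu> u0 by (intro mult_mono) auto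
  have t4: "?\<mu> * ((1 - u0) * (y 4)\<^sup>2) \<le> 1 * (1 * (y 4)\<^sup>2)" using \<mu> u0 by (intro mult_mono) auto
  have t5: "?\<mu> * (\<Sum>i=5..2*n+2. (y i)\<^sup>2) \<le> (b 0)\<^sup>2 * (\<Sum>i=5..2*n+2. (y i)\<^sup>2)"
    using \<mu> by (intro mult_right_mono sum_nonneg) auto
  have "?\<mu> = ?\<mu> * (1 - ?q) + ?\<mu> * ?q" by (simp add: algebra_simps)
  also have "?\<mu> * ?q = ?\<mu> * (y 2)\<^sup>2 + ?\<mu> * (u0 * (y 3)\<^sup>2) + ?\<mu> * ((1 - u0) * (y 4)\<^sup>2) + ?\<mu> * (\<Sum>i=5..2*n+2. (y i)\<^sup>2)"
    unfolding quad_expand[OF n] by (simp only: distrib_left)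
  finally have "?\<mu> \<le> cleared_Q n ?w" unfolding Q using t1 t2 t3 t4 t5 by linarith
  then show ?thesis
    unfolding denom_def graph_point_simps(1) w(5) using u0 b by (intro mult_left_mono) auto
qed

section \<open>Measurability and integrability on the slices\<close>

lemma quad_measurable:
  assumes "m \<le> 2*n+2"
  shows "(\<lambda>(u0, y). quad m u0 y) \<in> borel_measurable (borel \<Otimes>\<^sub>M slice_measure n)"
proof -
  have "(\<lambda>p. snd p i) \<in> borel_measurable (borel \<Otimes>\<^sub>M slice_measure n)" if "i \<in> {2..m}" for i
    using measurable_compose[OF measurable_snd measurable_component_singleton[of i "{2..2*n+2}" "\<lambda>_. lborel"]]
      that assms by simp
  moreover have "(\<lambda>p. quad_coeff (fst p) i) \<in> borel_measurable (borel \<Otimes>\<^sub>M slice_measure n)" for i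
    by (simp add: quad_coeff_def)
  ultimately show ?thesis
    unfolding quad_def split_beta by (intro borel_measurable_sum borel_measurable_times borel_measurable_power)
qed

lemma slice_kernel_measurable:
  assumes n: "1 \<le> n" and P: "P \<in> polyfuns (4*n+4)"
  shows "(\<lambda>(u0, y). slice_kernel n K P b s u0 y) \<in> borel_measurable (borel \<Otimes>\<^sub>M slice_measure n)"
proof -
  note [measurable] = quad_measurable[of "2*n+2" n, unfolded split_beta, OF order_refl]
  have W: "(\<lambda>p. graph_point n b s (fst p) (snd p) i) \<in> borel_measurable (borel \<Otimes>\<^sub>M slice_measure n)" for i
  proof -
    consider "i = 0" | "i = 1" | "i \<in> {2..2*n+2}" | "i \<ge> 2*n+3" by force
    then show ?thesis
    proof cases
      case 3
      then have "(\<lambda>p. snd p i) \<in> borel_measurable (borel \<Otimes>\<^sub>M slice_measure n)"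
        using measurable_compose[OF measurable_snd measurable_component_singleton[of i "{2..2*n+2}" "\<lambda>_. lborel"]] by simp
      then show ?thesis using 3 by (simp add: graph_point_simps)
    next
      case 4
      then show ?thesis by (simp add: graph_point_def join_vars_def)
    next
      case 2
      show ?thesis unfolding 2 graph_point_simps(2) by measurable
    qed (simp add: graph_point_simps)
  qed
  have "(\<lambda>p. P (graph_point n b s (fst p) (snd p))) \<in> borel_measurable (borel \<Otimes>\<^sub>M slice_measure n)"
    "(\<lambda>p. denom n (graph_point n b s (fst p) (snd p))) \<in> borel_measurable (borel \<Otimes>\<^sub>M slice_measure n)"
    by (intro polyfuns_measurable[OF P] polyfuns_measurable[OF denom_polyfun[OF n]] W)+
  then show ?thesis
    unfolding slice_kernel_def split_beta by measurable
qed

lemma half_slice_measurable: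
  assumes S: "S \<subseteq> {2..2*n+2}"
  shows "{p \<in> space (borel \<Otimes>\<^sub>M slice_measure n). snd p \<in> half_slice n S (fst p)} \<in> sets (borel \<Otimes>\<^sub>M slice_measure n)"
proof -
  note [measurable] = quad_measurable[of "2*n+2" n, unfolded split_beta, OF order_refl]
  have fin: "finite S" using S finite_subset by blast
  have [measurable]: "(\<lambda>p. snd p i) \<in> borel_measurable (borel \<Otimes>\<^sub>M slice_measure n)" if "i \<in> S" for i
    using measurable_compose[OF measurable_snd measurable_component_singleton[of i "{2..2*n+2}" "\<lambda>_. lborel"]]
      that S by auto
  have "Measurable.pred (borel \<Otimes>\<^sub>M slice_measure n) (\<lambda>p. quad (2*n+2) (fst p) (snd p) < 1 \<and> (\<forall>i\<in>S. 0 < snd p i))"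
    using fin by measurable
  then show ?thesis
    by (simp add: half_slice_def pred_def)
qed

text \<open>Measurability is needed jointly in u_0 and y, because the integral over the slice has to
  be a measurable function of u_0.\<close>

lemma half_slice_kernel_measurable:
  assumes n: "1 \<le> n" and P: "P \<in> polyfuns (4*n+4)" and S: "S \<subseteq> {2..2*n+2}"
  shows "(\<lambda>(u0, y). indicator (half_slice n S u0) y *\<^sub>R slice_kernel n K P b s u0 y)
    \<in> borel_measurable (borel \<Otimes>\<^sub>M slice_measure n)"
proof -
  let ?M = "borel \<Otimes>\<^sub>M slice_measure n :: (real \<times> (nat \<Rightarrow> real)) measure"
  have "(\<lambda>p. indicator {p \<in> space ?M. snd p \<in> half_slice n S (fst p)} p *\<^sub>R slice_kernel n K P b s (fst p) (snd p)) \<in> borel_measurable ?M"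
    using slice_kernel_measurable[OF n P, of K b s] half_slice_measurable[OF S]
    unfolding split_beta by (intro borel_measurable_scaleR borel_measurable_indicator)
  then show ?thesis
    by (rule measurable_cong[THEN iffD1, rotated]) (auto simp: indicator_def split_beta)
qed

lemma slice_kernel_borel:
  assumes "1 \<le> n" "P \<in> polyfuns (4*n+4)" "S \<subseteq> {2..2*n+2}"
  shows "(\<lambda>y. indicator (half_slice n S u0) y *\<^sub>R slice_kernel n K P b s u0 y) \<in> borel_measurable (slice_measure n)"
  using measurable_compose[OF measurable_Pair1'[of u0 borel "slice_measure n"]
      half_slice_kernel_measurable[OF assms, of K b s]] by simp

text \<open>Tonelli with u_2 innermost. Its coefficient in \<open>quad\<close> is 1 for all u_0, its
  integral is \<pi> or 0, and the other coordinates are confined to a box of finite measure.\<close>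

lemma set_integrable_inverse_sqrt_quad:
  assumes n: "1 \<le> n" and u0: "0 < u0" "u0 < 1"
  shows "set_integrable (slice_measure n) (half_slice n {} u0) (\<lambda>y. 1 / sqrt (1 - quad (2*n+2) u0 y))"
proof -
  \<comment> \<open>The density as a kernel with numerator 1 and exponent 0, so that measurability
    is already known.\<close>
  let ?f = "\<lambda>y. indicator (half_slice n {} u0) y *\<^sub>R slice_kernel n 0 (\<lambda>_. 1) (\<lambda>_. 0) 1 u0 y"
  let ?I = "{3..2*n+2}"
  let ?q = "\<lambda>x. \<Sum>i\<in>?I. quad_coeff u0 i * (x i)\<^sup>2"
  let ?R = "1 + 1 / (u0 * (1 - u0))"
  have I: "{2..2*n+2} = insert 2 ?I" by auto
  have f: "?f = (\<lambda>y. indicator (half_slice n {} u0) y * (1 / sqrt (1 - quad (2*n+2) u0 y)))"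
    by (auto simp: slice_kernel_def)
  have fy: "?f y = indicator (half_slice n {} u0) y * (1 / sqrt (1 - quad (2*n+2) u0 y))" for y
    by (simp add: slice_kernel_def)
  have meas: "?f \<in> borel_measurable (slice_measure n)"
    by (rule slice_kernel_borel[OF n polyfuns_one]) simp
  have quad: "quad (2*n+2) u0 (x(2 := t)) = t\<^sup>2 + ?q x" for x t
    unfolding quad_def I by (subst sum.insert) (auto simp: quad_coeff_def intro!: sum.cong)
  have "(\<integral>\<^sup>+ y. ennreal (?f y) \<partial>slice_measure n) =
      (\<integral>\<^sup>+ x. \<integral>\<^sup>+ t. ennreal (?f (x(2 := t))) \<partial>lborel \<partial>PiM ?I (\<lambda>_. lborel))"
    unfolding I
    by (rule product_sigma_finite.product_nn_integral_insert[OF product_sigma_finite_lborel])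
       (use measurable_compose[OF meas measurable_ennreal, unfolded I] in simp_all)
  also have "\<dots> \<le> (\<integral>\<^sup>+ x. ennreal pi * indicator (PiE ?I (\<lambda>_. {- ?R .. ?R})) x \<partial>PiM ?I (\<lambda>_. lborel))"
  proof (rule nn_integral_mono)
    fix x :: "nat \<Rightarrow> real" assume x: "x \<in> space (PiM ?I (\<lambda>_. lborel))"
    show "(\<integral>\<^sup>+ t. ennreal (?f (x(2 := t))) \<partial>lborel) \<le> ennreal pi * indicator (PiE ?I (\<lambda>_. {- ?R .. ?R})) x"
    proof (cases "?q x < 1")
      case True
      have "(\<integral>\<^sup>+ t. ennreal (?f (x(2 := t))) \<partial>lborel) =
          (\<integral>\<^sup>+ t. indicator {t. t\<^sup>2 < 1 - ?q x} t * ennreal (1 / sqrt ((1 - ?q x) - t\<^sup>2)) \<partial>lborel)"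
      proof (rule nn_integral_cong)
        fix t
        have "ennreal (of_bool (t\<^sup>2 + Q < 1) * (1 / sqrt (1 - (t\<^sup>2 + Q)))) =
            of_bool (t\<^sup>2 < 1 - Q) * ennreal (1 / sqrt (1 - Q - t\<^sup>2))" for Q
          by (auto simp: algebra_simps)
        from this[of "?q x"] show "ennreal (?f (x(2 := t))) = indicator {t. t\<^sup>2 < 1 - ?q x} t * ennreal (1 / sqrt ((1 - ?q x) - t\<^sup>2))"
          unfolding fy unfolding half_slice_def indicator_def mem_Collect_eq quad by (simp only: ball_simps simp_thms)
      qed
      also have "\<dots> = ennreal pi" by (rule nn_integral_inverse_sqrt) (use True in simp)
      moreover have "x \<in> PiE ?I (\<lambda>_. {- ?R .. ?R})"
      proof (rule PiE_I)
        fix i assume "i \<in> ?I"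
        from coordinate_bound[OF u0 this _ True] show "x i \<in> {- ?R .. ?R}" by (simp add: abs_le_iff)
      qed (use x in \<open>auto simp: space_PiM PiE_def extensional_def\<close>)
      ultimately show ?thesis by simp
    next
      case False
      have "?f (x(2 := t)) = 0" for t
      proof -
        have "\<not> t\<^sup>2 + ?q x < 1" using False zero_le_power2[of t] by linarith
        then show ?thesis
          unfolding fy unfolding half_slice_def indicator_def mem_Collect_eq quad
          by (simp only: simp_thms of_bool_eq mult_zero_left)
      qed
      then have "(\<integral>\<^sup>+ t. ennreal (?f (x(2 := t))) \<partial>lborel) = (\<integral>\<^sup>+ t. 0 \<partial>(lborel :: real measure))"
        by (simp only: ennreal_0)
      also have "\<dots> = 0" by simp
      finally show ?thesis by (simp only: zero_le)
    qed
  qed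
  also have "\<dots> = ennreal pi * emeasure (PiM ?I (\<lambda>_. lborel)) (PiE ?I (\<lambda>_. {- ?R .. ?R}))"
    by (intro nn_integral_cmult_indicator sets_PiM_I_finite) auto
  also have "emeasure (PiM ?I (\<lambda>_. lborel)) (PiE ?I (\<lambda>_. {- ?R .. ?R})) = (\<Prod>i\<in>?I. emeasure lborel {- ?R .. ?R})"
    by (rule product_sigma_finite.emeasure_PiM[OF product_sigma_finite_lborel]) auto
  also have "ennreal pi * \<dots> < \<infinity>"
    by (auto simp: ennreal_mult_less_top power_less_top_ennreal emeasure_lborel_Icc_eq)
  finally have "(\<integral>\<^sup>+ y. ennreal (?f y) \<partial>slice_measure n) < \<infinity>" .
  moreover have "0 \<le> ?f y" for y unfolding fy by (auto simp: indicator_def half_slice_def)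
  ultimately have "integrable (slice_measure n) ?f"
    by (intro integrableI_nonneg[OF meas]) auto
  then show ?thesis unfolding f by (simp add: set_integrable_def)
qed

text \<open>The rational factor is bounded, having bounded arguments and a denominator bounded away
  from zero, and the density is integrable.\<close>

lemma slice_kernel_integrable:
  assumes n: "1 \<le> n" and P: "P \<in> polyfuns (4*n+4)" and S: "S \<subseteq> {2..2*n+2}"
    and u0: "0 < u0" "u0 < 1" and b: "0 < b 0" and s: "s\<^sup>2 = 1"
  shows "set_integrable (slice_measure n) (half_slice n S u0) (slice_kernel n K P b s u0)"
proof -
  \<comment> \<open>A bound for all 4n+4 arguments of \<open>P\<close>: the first two summands for
    the coordinates u, the last for the 2n+1 parameters.\<close>
  define R where "R = 1 + 1 / (u0 * (1 - u0)) + (\<Sum>i<2*n+1. \<bar>b i\<bar>)"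
  have R: "1 + 1 / (u0 * (1 - u0)) \<le> R" by (auto simp: R_def intro!: sum_nonneg)
  have R1: "1 \<le> 1 + 1 / (u0 * (1 - u0))" using u0 by simp
  have R0: "1 \<le> R" using R R1 by linarith
  obtain B where B: "\<And>w. (\<forall>i<4*n+4. \<bar>w i\<bar> \<le> R) \<Longrightarrow> \<bar>P w\<bar> \<le> B"
    using polyfuns_bounded[OF P] by blast
  define \<delta> where "\<delta> = u0 * (1 - u0) * b 0 * min ((b 0)\<^sup>2) 1"
  have \<delta>: "\<delta> > 0" using u0 b by (simp add: \<delta>_def)
  have bound: "\<bar>slice_kernel n K P b s u0 y\<bar> \<le> B / \<delta> ^ K * (1 / sqrt (1 - quad (2*n+2) u0 y))"
    if q: "quad (2*n+2) u0 y < 1" for y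
  proof -
    let ?w = "graph_point n b s u0 y"
    have nonneg: "0 \<le> quad (2*n+2) u0 y"
      unfolding quad_def using u0 by (intro sum_nonneg) (auto simp: quad_coeff_def)
    have "\<bar>?w i\<bar> \<le> R" if i: "i < 4*n+4" for i
    proof -
      consider "i = 0" | "i = 1" | "i \<in> {2..2*n+2}" | j where "i = 2*n+3+j" "j < 2*n+1"
      proof -
        have "\<exists>j. i = 2*n+3+j \<and> j < 2*n+1" if "i \<ge> 2*n+3" using i that le_Suc_ex by fastforce
        then show ?thesis using that by (cases "i \<ge> 2*n+3") force+
      qed
      then show ?thesis
      proof cases
        case 1
        then show ?thesis using u0 R0 by (simp add: graph_point_simps)
      next
        case 2
        have "\<bar>s\<bar> = 1" using s by (simp add: power2_eq_1_iff) auto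
        moreover have "sqrt (1 - quad (2*n+2) u0 y) \<le> 1" using nonneg by simp
        then have "sqrt (1 - quad (2*n+2) u0 y) \<le> R" using R0 by linarith
        ultimately show ?thesis
          unfolding 2 graph_point_simps(2) abs_mult using q by simp
      next
        case 3
        then show ?thesis
          using coordinate_bound[OF u0 3, of y] q R by (simp add: graph_point_simps quad_def)
      next
        case 4
        have "\<bar>b j\<bar> \<le> (\<Sum>i<2*n+1. \<bar>b i\<bar>)" using 4 by (intro member_le_sum) auto
        then show ?thesis unfolding 4(1) graph_point_simps(4) R_def using R1 by linarith
      qed
    qed
    then have P: "\<bar>P ?w\<bar> \<le> B" using B by blast
    have den: "\<delta> \<le> denom n ?w" unfolding \<delta>_def by (rule denom_lower_bound[where b=b, OF n u0 b s q])
    then have "\<delta> ^ K \<le> denom n ?w ^ K" using \<delta> by (intro power_mono) auto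
    then have "\<bar>P ?w / denom n ?w ^ K\<bar> \<le> B / \<delta> ^ K"
      using P \<delta> den by (simp add: abs_divide) (intro frac_le, auto)
    then have "\<bar>P ?w / denom n ?w ^ K\<bar> / sqrt (1 - quad (2*n+2) u0 y) \<le> B / \<delta> ^ K / sqrt (1 - quad (2*n+2) u0 y)"
      using q by (intro divide_right_mono) auto
    moreover have abs: "\<bar>A / r\<bar> = \<bar>A\<bar> / r" if "r \<ge> 0" for A r :: real using that by simp
    have "\<bar>slice_kernel n K P b s u0 y\<bar> = \<bar>P ?w / denom n ?w ^ K\<bar> / sqrt (1 - quad (2*n+2) u0 y)"
      unfolding slice_kernel_def by (rule abs) (use q in simp)
    ultimately show ?thesis by simp
  qed
  have meas: "(\<lambda>y. indicator (half_slice n S u0) y *\<^sub>R slice_kernel n K P b s u0 y) \<in> borel_measurable (slice_measure n)"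
    by (rule slice_kernel_borel[OF n P S])
  have "integrable (slice_measure n)
      (\<lambda>y. B / \<delta> ^ K * (indicator (half_slice n {} u0) y * (1 / sqrt (1 - quad (2*n+2) u0 y))))"
    by (intro Bochner_Integration.integrable_mult_right)
       (use set_integrable_inverse_sqrt_quad[OF n u0] in \<open>simp add: set_integrable_def\<close>)
  then show ?thesis
    unfolding set_integrable_def
  proof (rule Bochner_Integration.integrable_bound[OF _ meas])
    have "\<bar>indicator (half_slice n S u0) y * slice_kernel n K P b s u0 y\<bar> \<le>
        \<bar>B / \<delta> ^ K * (indicator (half_slice n {} u0) y * (1 / sqrt (1 - quad (2*n+2) u0 y)))\<bar>" for y
    proof (cases "y \<in> half_slice n S u0")
      case True
      then have "y \<in> half_slice n {} u0" and "quad (2*n+2) u0 y < 1" by (auto simp: half_slice_def)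
      moreover from bound[OF this(2)] have "\<bar>slice_kernel n K P b s u0 y\<bar> \<le> \<bar>B / \<delta> ^ K * (1 / sqrt (1 - quad (2*n+2) u0 y))\<bar>"
        by (rule order_trans[OF _ abs_ge_self])
      ultimately show ?thesis using True by (simp only: indicator_simps mult_1)
    qed simp
    then show "AE y in slice_measure n. norm (indicator (half_slice n S u0) y *\<^sub>R slice_kernel n K P b s u0 y) \<le>
      norm (B / \<delta> ^ K * (indicator (half_slice n {} u0) y * (1 / sqrt (1 - quad (2*n+2) u0 y))))"
      by simp
  qed
qed

section \<open>Folding and reflecting the slices\<close>

text \<open>\<open>denom\<close> and \<open>quad\<close> are even in each of these coordinates.
  Folding along y_i = 0 therefore adds to the numerator its reflection and keeps the denominator;
  the operation is the same for all parameters.\<close>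

lemma slice_kernel_symmetrise:
  assumes n: "1 \<le> n" and P: "P \<in> polyfuns (4*n+4)" and S: "finite S" "S \<subseteq> {2..2*n+2}"
  shows "\<exists>P'\<in>polyfuns (4*n+4). \<forall>b u0 s. 0 < u0 \<and> u0 < 1 \<and> 0 < b 0 \<and> s\<^sup>2 = 1 \<longrightarrow>
    (LINT y : half_slice n {} u0 | slice_measure n. slice_kernel n K P b s u0 y) =
    (LINT y : half_slice n S u0 | slice_measure n. slice_kernel n K P' b s u0 y)"
  using S
proof (induction S rule: finite_induct)
  case empty
  show ?case using P by blast
next
  case (insert i S)
  have i: "2 \<le> i" "i \<le> 2*n+2" and S: "S \<subseteq> {2..2*n+2}" using insert.prems by auto
  obtain P' where P': "P' \<in> polyfuns (4*n+4)" and IH: "\<And>b u0 s. 0 < u0 \<Longrightarrow> u0 < 1 \<Longrightarrow> 0 < b 0 \<Longrightarrow> s\<^sup>2 = 1 \<Longrightarrow>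
    (LINT y : half_slice n {} u0 | slice_measure n. slice_kernel n K P b s u0 y) =
    (LINT y : half_slice n S u0 | slice_measure n. slice_kernel n K P' b s u0 y)"
    using insert.IH[OF S] by blast
  let ?P = "\<lambda>w. P' w + P' (w(i := - w i))"
  have "(LINT y : half_slice n {} u0 | slice_measure n. slice_kernel n K P b s u0 y) =
      (LINT y : half_slice n (insert i S) u0 | slice_measure n. slice_kernel n K ?P b s u0 y)"
    if h: "0 < u0" "u0 < 1" "0 < b 0" "s\<^sup>2 = 1" for b u0 s
  proof -
    have sym: "y(i := - y i) \<in> half_slice n S u0 \<longleftrightarrow> y \<in> half_slice n S u0" for y
      using insert.hyps(2) by (auto simp: half_slice_def quad_reflect)
    have "(LINT y : half_slice n {} u0 | slice_measure n. slice_kernel n K P b s u0 y) =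
        (LINT y : half_slice n S u0 | slice_measure n. slice_kernel n K P' b s u0 y)"
      by (rule IH[where b=b, OF h])
    also have "\<dots> = (LINT y : half_slice n S u0 \<inter> {y. 0 < y i} | slice_measure n.
        slice_kernel n K P' b s u0 y + slice_kernel n K P' b s u0 (y(i := - y i)))"
      using i sym slice_kernel_integrable[where b=b, OF n P' S h]
      by (intro set_integral_PiM_lborel_half) auto
    also have "half_slice n S u0 \<inter> {y. 0 < y i} = half_slice n (insert i S) u0"
      by (auto simp: half_slice_def)
    also have "(\<lambda>y. slice_kernel n K P' b s u0 y + slice_kernel n K P' b s u0 (y(i := - y i))) = slice_kernel n K ?P b s u0"
      using i by (simp add: fun_eq_iff slice_kernel_reflect slice_kernel_add)
    finally show ?thesis .
  qed
  moreover have "?P \<in> polyfuns (4*n+4)" by (intro polyfuns.add polyfuns_flip P')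
  ultimately show ?case by blast
qed

text \<open>The reflections in u_2 and in u_3 preserve the measure, the slice and
  \<open>denom\<close>, and together they turn P into -P. The integral equals its own
  negative.\<close>

lemma slice_kernel_odd_integral:
  assumes n: "1 \<le> n" and P: "P \<in> polyfuns (4*n+4)" and odd: "\<And>w. P (flip23 w) = - P w"
  shows "(LINT y : half_slice n {} u0 | slice_measure n. slice_kernel n K P b s u0 y) = 0"
proof -
  let ?f = "\<lambda>P y. indicator (half_slice n {} u0) y *\<^sub>R slice_kernel n K P b s u0 y"
  let ?P2 = "\<lambda>w. P (w(2 := - w 2))"
  have meas: "?f Q \<in> borel_measurable (slice_measure n)" if "Q \<in> polyfuns (4*n+4)" for Q
    by (rule slice_kernel_borel[OF n that]) simp
  have two: "2 \<le> 2*n+2" and three: "3 \<le> 2*n+2" using n by auto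
  have reflect: "?f Q (y(i := - y i)) = ?f (\<lambda>w. Q (w(i := - w i))) y" if "2 \<le> i" "i \<le> 2*n+2" for Q i y
    using that by (simp add: slice_kernel_reflect half_slice_def quad_reflect indicator_def)
  have "integral\<^sup>L (slice_measure n) (?f P) = integral\<^sup>L (slice_measure n) (?f ?P2)"
    by (subst integral_PiM_lborel_reflect[OF _ _ meas[OF P], of 2]) (use n in \<open>simp, simp, simp only: reflect[OF order_refl two]\<close>)
  also have "\<dots> = integral\<^sup>L (slice_measure n) (?f (\<lambda>w. ?P2 (w(3 := - w 3))))"
    by (subst integral_PiM_lborel_reflect[OF _ _ meas[OF polyfuns_flip[OF P, of 2]], of 3])
       (use n in \<open>simp, simp, simp only: reflect[OF _ three] numeral_le_iff semiring_norm\<close>)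
  also have "(\<lambda>w. ?P2 (w(3 := - w 3))) = (\<lambda>w. - P w)"
    by (simp add: odd[symmetric] flip23_def fun_upd_twist)
  also have "integral\<^sup>L (slice_measure n) (?f (\<lambda>w. - P w)) = - integral\<^sup>L (slice_measure n) (?f P)"
    by (simp add: slice_kernel_def)
  finally show ?thesis by (simp add: set_lebesgue_integral_def)
qed

text \<open>Dividing y_3 by sin \<eta> and y_4 by cos \<eta> takes the ball to the slice and 1 -
  |y|^2 to 1 - q, so that 1/|\<xi>_1| becomes 1/|u_1|. The Jacobian leaves the factor sin \<eta> cos
  \<eta>, and the contribution of \<open>P1\<close> vanishes.\<close>

lemma sphere_to_slice:
  assumes n: "1 \<le> n" and \<eta>: "0 < \<eta>" "\<eta> < pi/2" and b: "0 < b 0" and s: "s\<^sup>2 = 1"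
    and P0: "P0 \<in> polyfuns (4*n+4)" and P1: "P1 \<in> polyfuns (4*n+4)" and odd: "\<And>w. P1 (flip23 w) = - P1 w"
    and F: "\<And>y. (\<Sum>i=2..2*n+2. (y i)\<^sup>2) < 1 \<Longrightarrow> F (hemisphere (2*n+2) s y) = complex_of_real
       (let w = join_vars n b (u_point \<eta> (hemisphere (2*n+2) s y)) in (P0 w + sin \<eta> * cos \<eta> * P1 w) / denom n w ^ K)"
  shows "(LINT y : {y. (\<Sum>i=2..2*n+2. (y i)\<^sup>2) < 1} | slice_measure n.
      (1 / sqrt (1 - (\<Sum>i=2..2*n+2. (y i)\<^sup>2))) *\<^sub>R F (hemisphere (2*n+2) s y)) =
    complex_of_real (sin \<eta> * cos \<eta> *
      (LINT y : half_slice n {} ((sin \<eta>)\<^sup>2) | slice_measure n. slice_kernel n K P0 b s ((sin \<eta>)\<^sup>2) y))"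
proof -
  let ?M = "slice_measure n" and ?m = "2*n+2" and ?u0 = "(sin \<eta>)\<^sup>2"
  have sc: "sin \<eta> > 0" "cos \<eta> > 0" using \<eta> by (auto intro: sin_gt_zero cos_gt_zero)
  have cos2: "1 - ?u0 = (cos \<eta>)\<^sup>2" by (simp add: cos_squared_eq)
  have u0: "0 < ?u0" "?u0 < 1"
    using sc cos2 by (simp, metis cos2 diff_gt_0_iff_gt zero_less_power sc(2))
  let ?c = "\<lambda>i :: nat. if i = 3 then 1 / sin \<eta> else if i = 4 then 1 / cos \<eta> else 1"
  let ?T = "\<lambda>y. \<lambda>i\<in>{2..?m}. ?c i * y i"
  let ?k = "\<lambda>y. slice_kernel n K P0 b s ?u0 y + sin \<eta> * cos \<eta> * slice_kernel n K P1 b s ?u0 y"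
  let ?f = "\<lambda>y. indicator (half_slice n {} ?u0) y *\<^sub>R ?k y"
  let ?S = "\<lambda>y. \<Sum>i=2..?m. (y i)\<^sup>2"
  let ?w = "\<lambda>y. join_vars n b (u_point \<eta> (hemisphere ?m s y))"
  let ?g = "\<lambda>y. (P0 (?w y) + sin \<eta> * cos \<eta> * P1 (?w y)) / denom n (?w y) ^ K / sqrt (1 - ?S y)"
  have quad: "quad ?m ?u0 (?T y) = ?S y" for y
    unfolding quad_def using sc
    by (intro sum.cong) (auto simp: quad_coeff_def cos2 power_mult_distrib power_divide)
  have gp: "graph_point n b s ?u0 (?T y) = ?w y" for y
    unfolding graph_point_def quad using n
    by (auto simp: join_vars_def u_point_def hemisphere_def fun_eq_iff)
  have fT: "?f (?T y) = indicator {y. ?S y < 1} y *\<^sub>R ?g y" for y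
  proof -
    have "indicator (half_slice n {} ?u0) (?T y) = (indicator {y. ?S y < 1} y :: real)"
      by (simp only: half_slice_def indicator_def mem_Collect_eq quad ball_simps simp_thms)
    moreover have "?k (?T y) = ?g y"
      unfolding slice_kernel_def gp quad by (simp add: add_divide_distrib)
    ultimately show ?thesis by simp
  qed
  have prod: "(\<Prod>i\<in>{2..?m}. \<bar>?c i\<bar>) = 1 / (sin \<eta> * cos \<eta>)"
  proof -
    have "(\<Prod>i\<in>{2..?m}. \<bar>?c i\<bar>) = (\<Prod>i\<in>{3,4}. \<bar>?c i\<bar>)"
      using n by (intro prod.mono_neutral_right) auto
    then show ?thesis using sc by simp
  qed
  have int: "set_integrable ?M (half_slice n {} ?u0) (slice_kernel n K P b s ?u0)" if "P \<in> polyfuns (4*n+4)" for P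
    by (rule slice_kernel_integrable[where b=b, OF n that _ u0 b s]) simp
  have "(LINT y : half_slice n {} ?u0 | ?M. ?k y) =
      (LINT y : half_slice n {} ?u0 | ?M. slice_kernel n K P0 b s ?u0 y)
      + sin \<eta> * cos \<eta> * (LINT y : half_slice n {} ?u0 | ?M. slice_kernel n K P1 b s ?u0 y)"
    using int[OF P0] int[OF P1] by (subst set_integral_add(2)) auto
  also have "\<dots> = (LINT y : half_slice n {} ?u0 | ?M. slice_kernel n K P0 b s ?u0 y)"
    by (simp only: slice_kernel_odd_integral[OF n P1 odd] mult_zero_right add_0_right)
  finally have 1: "integral\<^sup>L ?M ?f = (LINT y : half_slice n {} ?u0 | ?M. slice_kernel n K P0 b s ?u0 y)"
    by (simp add: set_lebesgue_integral_def)
  have "integrable ?M ?f"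
    using set_integral_add(1)[OF int[OF P0] set_integrable_mult_right[of "sin \<eta> * cos \<eta>", OF int[OF P1]]]
    by (simp add: set_integrable_def)
  then have "?f \<in> borel_measurable ?M" by (rule borel_measurable_integrable)
  from integral_PiM_lborel_scale[OF _ _ this, of ?c]
  have "integral\<^sup>L ?M ?f = 1 / (sin \<eta> * cos \<eta>) * (LINT y : {y. ?S y < 1} | ?M. ?g y)"
    using sc unfolding prod fT by (auto simp: set_lebesgue_integral_def)
  then have 2: "(LINT y : {y. ?S y < 1} | ?M. ?g y) = sin \<eta> * cos \<eta> * integral\<^sup>L ?M ?f"
    using sc by simp
  have "(LINT y : {y. ?S y < 1} | ?M. (1 / sqrt (1 - ?S y)) *\<^sub>R F (hemisphere ?m s y)) =
      (LINT y : {y. ?S y < 1} | ?M. complex_of_real (?g y))"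
  proof (rule set_integral_cong_on)
    fix y :: "nat \<Rightarrow> real" assume "y \<in> {y. ?S y < 1}"
    then have y: "?S y < 1" by simp
    have "(1 / r) *\<^sub>R complex_of_real v = complex_of_real (v / r)" for r v
      by (simp add: scaleR_conv_of_real)
    then show "(1 / sqrt (1 - ?S y)) *\<^sub>R F (hemisphere ?m s y) = complex_of_real (?g y)"
      by (simp only: F[OF y] Let_def)
  qed simp
  also have "\<dots> = complex_of_real (LINT y : {y. ?S y < 1} | ?M. ?g y)"
    by (rule set_integral_complex_of_real)
  finally show ?thesis by (simp only: 2 1)
qed

definition slice_indices :: "nat \<Rightarrow> nat set" where
  "slice_indices n = {2} \<union> {5..2*n+2}"

abbreviation trace_sphere_integral :: "(real \<Rightarrow> real) \<Rightarrow> nat \<Rightarrow> (nat \<Rightarrow> real) \<Rightarrow> complex" where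
  "trace_sphere_integral a n x \<equiv>
     sphere_integral (2*n+2) (\<lambda>I \<xi>. trace (parametrix a n (2*n) x \<xi>) * complex_of_real (sphere_form (2*n+2) I \<xi>))"

abbreviation slice_total ::
    "nat \<Rightarrow> nat \<Rightarrow> ((nat \<Rightarrow> real) \<Rightarrow> real) \<Rightarrow> (nat \<Rightarrow> real) \<Rightarrow> real \<Rightarrow> real" where
  "slice_total n K P b u0 \<equiv>
     LINT y : half_slice n (slice_indices n) u0 | slice_measure n. slice_kernel n K P b 1 u0 y"

text \<open>The two hemispheres are folded together by \<xi>_1 -> -\<xi>_1, the coordinates in
  \<open>slice_indices\<close> by their reflections. The coordinates u_3 and u_4 keep both signs, as
  they do in A.\<close>

lemma sphere_trace_integral:
  assumes n: "1 \<le> n"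
  shows "\<exists>K P. P \<in> polyfuns (4*n+4) \<and> (\<forall>a T x. open T \<and> (\<forall>k. (deriv ^^ k) a differentiable_on T) \<and>
      (\<forall>s\<in>T. a s > 0) \<and> x 1 \<in> T \<and> 0 < x 2 \<and> x 2 < pi/2 \<longrightarrow>
    trace_sphere_integral a n x =
    complex_of_real (sin (x 2) * cos (x 2) *
      slice_total n K P (\<lambda>i. (deriv ^^ i) a (x 1)) ((sin (x 2))\<^sup>2)))"
proof -
  obtain K P0 P1 where P0: "P0 \<in> polyfuns (4*n+4)" and P1: "P1 \<in> polyfuns (4*n+4)"
    and odd: "\<And>w. P1 (flip23 w) = - P1 w"
    and trace: "\<And>a T x \<xi>. good n a T x \<xi> \<Longrightarrow> trace (parametrix a n (2*n) x \<xi>) = complex_of_real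
       (let w = join_vars n (\<lambda>i. (deriv ^^ i) a (x 1)) (u_point (x 2) \<xi>) in
         (P0 w + sin (x 2) * cos (x 2) * P1 w) / denom n w ^ K)"
    using trace_parametrix_rational[OF n] by blast
  let ?P2 = "\<lambda>w. P0 w + P0 (w(1 := - w 1))"
  have P2: "?P2 \<in> polyfuns (4*n+4)" by (intro polyfuns.add polyfuns_flip P0)
  have S: "finite (slice_indices n)" "slice_indices n \<subseteq> {2..2*n+2}" by (auto simp: slice_indices_def)
  obtain P where P: "P \<in> polyfuns (4*n+4)" and sym: "\<And>b u0 s. 0 < u0 \<Longrightarrow> u0 < 1 \<Longrightarrow> 0 < b 0 \<Longrightarrow> s\<^sup>2 = 1 \<Longrightarrow>
    (LINT y : half_slice n {} u0 | slice_measure n. slice_kernel n K ?P2 b s u0 y) =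
    (LINT y : half_slice n (slice_indices n) u0 | slice_measure n. slice_kernel n K P b s u0 y)"
    using slice_kernel_symmetrise[OF n P2 S, of K] by blast
  have "trace_sphere_integral a n x =
    complex_of_real (sin (x 2) * cos (x 2) *
      slice_total n K P (\<lambda>i. (deriv ^^ i) a (x 1)) ((sin (x 2))\<^sup>2))"
    if T: "open T" "\<forall>k. (deriv ^^ k) a differentiable_on T" "\<forall>s\<in>T. a s > 0" "x 1 \<in> T"
      and \<eta>: "0 < x 2" "x 2 < pi/2" for a T x
  proof -
    let ?m = "2*n+2" and ?M = "slice_measure n" and ?u0 = "(sin (x 2))\<^sup>2" and ?b = "\<lambda>i. (deriv ^^ i) a (x 1)"
    have sc: "sin (x 2) > 0" "cos (x 2) > 0" using \<eta> by (auto intro: sin_gt_zero cos_gt_zero)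
    have "1 - ?u0 = (cos (x 2))\<^sup>2" by (simp add: cos_squared_eq)
    moreover have "(cos (x 2))\<^sup>2 > 0" using sc by simp
    ultimately have u0: "0 < ?u0" "?u0 < 1" using sc by (simp, linarith)
    have b: "0 < ?b 0" using T by simp
    have good: "good n a T x (hemisphere ?m s y)" if "s\<^sup>2 = 1" "(\<Sum>i=2..?m. (y i)\<^sup>2) < 1" for s y
    proof -
      \<comment> \<open>\<xi>_1 does not vanish on the open hemispheres, so Q is positive
        there.\<close>
      have "0 < (hemisphere ?m s y 1)\<^sup>2" using that by (simp add: hemisphere_def power_mult_distrib)
      then have "0 < conf_sq n a x (hemisphere ?m s y)"
        unfolding conf_sq_def by (intro add_pos_nonneg divide_nonneg_nonneg add_nonneg_nonneg sum_nonneg) auto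
      then show ?thesis using T \<eta> by (simp add: good_def)
    qed
    let ?J = "\<lambda>s. LINT y : half_slice n {} ?u0 | ?M. slice_kernel n K P0 ?b s ?u0 y"
    have J: "(LINT y : {y. (\<Sum>i=2..?m. (y i)\<^sup>2) < 1} | ?M. (1 / sqrt (1 - (\<Sum>i=2..?m. (y i)\<^sup>2))) *\<^sub>R
        trace (parametrix a n (2*n) x (hemisphere ?m s y))) = complex_of_real (sin (x 2) * cos (x 2) * ?J s)"
      if "s\<^sup>2 = 1" for s
      by (rule sphere_to_slice[where b="?b" and F="\<lambda>\<xi>. trace (parametrix a n (2*n) x \<xi>)", OF n \<eta> b that P0 P1 odd])
         (rule trace[OF good[OF that]])
    have int: "set_integrable ?M (half_slice n {} ?u0) (slice_kernel n K P0 ?b s ?u0)" if "s\<^sup>2 = 1" for s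
      by (rule slice_kernel_integrable[where b="?b", OF n P0 _ u0 b that]) simp
    have "?J 1 + ?J (- 1) = (LINT y : half_slice n {} ?u0 | ?M. slice_kernel n K P0 ?b 1 ?u0 y + slice_kernel n K P0 ?b (- 1) ?u0 y)"
      using int by (subst set_integral_add(2)) auto
    also have "(\<lambda>y. slice_kernel n K P0 ?b 1 ?u0 y + slice_kernel n K P0 ?b (- 1) ?u0 y) = slice_kernel n K ?P2 ?b 1 ?u0"
      by (simp add: fun_eq_iff slice_kernel_reflect_sign slice_kernel_add)
    also have "(LINT y : half_slice n {} ?u0 | ?M. slice_kernel n K ?P2 ?b 1 ?u0 y) =
        slice_total n K P ?b ?u0"
      by (rule sym[where b="?b", OF u0 b]) simp
    finally have sum: "?J 1 + ?J (- 1) = slice_total n K P ?b ?u0" .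
    have "2 \<le> ?m" by simp
    note sphere_integral_sphere_form[OF this, of "\<lambda>\<xi>. trace (parametrix a n (2*n) x \<xi>)"]
    also have "(\<Sum>s\<in>{1, - 1}. LINT y : {y. (\<Sum>i=2..?m. (y i)\<^sup>2) < 1} | ?M. (1 / sqrt (1 - (\<Sum>i=2..?m. (y i)\<^sup>2))) *\<^sub>R
        trace (parametrix a n (2*n) x (hemisphere ?m s y))) =
        (\<Sum>s\<in>{1, - 1}. complex_of_real (sin (x 2) * cos (x 2) * ?J s))"
      by (intro sum.cong refl J) auto
    also have "\<dots> = complex_of_real (sin (x 2) * cos (x 2) * (?J 1 + ?J (- 1)))"
      by (simp add: algebra_simps)
    finally show ?thesis unfolding sum .
  qed
  then show ?thesis using P by blast
qed

section \<open>The algebraic form\<close>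

lemma A_chart_simps:
  assumes n: "1 \<le> n"
  shows "A_chart n z 1 = 1 * sqrt (1 - (\<Sum>i=2..2*n+2. quad_coeff (z 0) i * (z i)\<^sup>2))"
    and "i \<le> 2*n+2 \<Longrightarrow> i \<noteq> 1 \<Longrightarrow> A_chart n z i = z i"
  unfolding A_chart_def quad_expand[OF n, of "z 0" z, unfolded quad_def] by simp_all

text \<open>The upper bounds in A follow from the equation of the quadric, in which the coordinates
  concerned have coefficient 1.\<close>

lemma A_slice_eq:
  assumes n: "1 \<le> n" and u0: "0 < u0" "u0 < 1"
  shows "A_slice n u0 = half_slice n (slice_indices n) u0"
proof (intro set_eqI)
  fix y
  let ?z = "y(0 := u0)" and ?q = "quad (2*n+2) u0 y"
  have q: "(\<Sum>i=2..2*n+2. quad_coeff (?z 0) i * (?z i)\<^sup>2) = ?q"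
    unfolding quad_def by (intro sum.cong) auto
  have c1: "A_chart n ?z 1 = sqrt (1 - ?q)"
    using A_chart_simps(1)[OF n, of ?z] unfolding q by simp
  have c0: "A_chart n ?z 0 = u0" using A_chart_simps(2)[OF n, of 0 ?z] by simp
  have ci: "A_chart n ?z i = y i" if "2 \<le> i" "i \<le> 2*n+2" for i
    using A_chart_simps(2)[OF n, of i ?z] that by simp
  have sum: "(\<Sum>i=5..2*n+2. (A_chart n ?z i)\<^sup>2) = (\<Sum>i=5..2*n+2. (y i)\<^sup>2)"
    by (intro sum.cong) (simp_all add: ci)
  have aff: "A_chart n ?z \<in> affine_space (2*n+3)"
    by (simp add: A_chart_def affine_space_def)
  have c: "A_chart n ?z 2 = y 2" "A_chart n ?z 3 = y 3" "A_chart n ?z 4 = y 4"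
    using ci n by auto
  have eq: "(A_chart n ?z 1)\<^sup>2 + (A_chart n ?z 2)\<^sup>2 + A_chart n ?z 0 * (A_chart n ?z 3)\<^sup>2 +
      (1 - A_chart n ?z 0) * (A_chart n ?z 4)\<^sup>2 + (\<Sum>i=5..2*n+2. (A_chart n ?z i)\<^sup>2) = (sqrt (1 - ?q))\<^sup>2 + ?q"
    unfolding sum c1 c0 c quad_expand[OF n] by simp
  show "y \<in> A_slice n u0 \<longleftrightarrow> y \<in> half_slice n (slice_indices n) u0"
  proof
    assume "y \<in> A_slice n u0"
    then have *: "\<forall>i\<in>{0,1,2} \<union> {5..2*n+2}. 0 < A_chart n ?z i \<and> A_chart n ?z i < 1"
      by (simp add: A_slice_def A_set_def)
    then have "0 < A_chart n ?z 1" by blast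
    then have "?q < 1" unfolding c1 by simp
    moreover have "0 < y i" if "i \<in> slice_indices n" for i
    proof -
      have "0 < A_chart n ?z i" using * that by (auto simp: slice_indices_def)
      moreover have "2 \<le> i" "i \<le> 2*n+2" using that by (auto simp: slice_indices_def)
      ultimately show ?thesis by (simp add: ci)
    qed
    ultimately show "y \<in> half_slice n (slice_indices n) u0" by (simp add: half_slice_def)
  next
    assume y: "y \<in> half_slice n (slice_indices n) u0"
    then have q1: "?q < 1" and pos: "\<And>i. i \<in> slice_indices n \<Longrightarrow> 0 < y i" by (auto simp: half_slice_def)
    have le: "(y i)\<^sup>2 \<le> ?q" if "i \<in> slice_indices n" for i
    proof -
      have "quad_coeff u0 i = 1" "i \<in> {2..2*n+2}" using that by (auto simp: slice_indices_def quad_coeff_def)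
      then show ?thesis
        using quad_term_le[OF u0, of i "{2..2*n+2}" y] by (simp add: quad_def)
    qed
    \<comment> \<open>u_1 < 1 requires another strictly positive term in the quadric; u_2 provides
      it.\<close>
    have "0 < (y 2)\<^sup>2" using pos[of 2] by (simp add: slice_indices_def)
    moreover have "(y 2)\<^sup>2 \<le> ?q" by (rule le) (simp add: slice_indices_def)
    ultimately have q0: "0 < ?q" by linarith
    have lt: "y i < 1" if "i \<in> slice_indices n" for i
    proof -
      have "(y i)\<^sup>2 < 1" using le[OF that] q1 by simp
      then show ?thesis by (simp add: abs_square_less_1)
    qed
    have "0 < A_chart n ?z i \<and> A_chart n ?z i < 1" if i: "i \<in> {0,1,2} \<union> {5..2*n+2}" for i
    proof -
      consider "i = 0" | "i = 1" | "i \<in> slice_indices n" using i unfolding slice_indices_def by blast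
      then show ?thesis
      proof cases
        case 2
        show ?thesis unfolding 2 c1 using q0 q1 by simp
      next
        case 3
        then have "2 \<le> i" "i \<le> 2*n+2" by (auto simp: slice_indices_def)
        then show ?thesis using pos[OF 3] lt[OF 3] by (simp add: ci)
      qed (use c0 u0 in simp)
    qed
    moreover have "(sqrt (1 - ?q))\<^sup>2 + ?q = 1" using q1 by simp
    ultimately show "y \<in> A_slice n u0"
      unfolding A_slice_def A_set_def using aff eq by simp
  qed
qed

section \<open>The form and its restriction to A\<close>

definition denom_qpoly :: "nat \<Rightarrow> qpoly" where
  "denom_qpoly n =
     qvar 0 * (qconst 1 + qconst (- 1) * qvar 0) * qvar (2*n+3) *
     (qvar (2*n+3) ^ 2 * qvar 1 ^ 2 + (qvar 2 ^ 2 + qvar 3 ^ 2 + qvar 4 ^ 2)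
        + qvar (2*n+3) ^ 2 * (\<Sum>i=5..2*n+2. qvar i ^ 2))"

lemma qpoly_eval_denom_qpoly: "qpoly_eval (denom_qpoly n) w = denom n w"
  by (simp only: denom_qpoly_def denom_def cleared_Q_def qpoly_eval_mult qpoly_eval_add qpoly_eval_sum
      qpoly_eval_power qpoly_eval_qvar qpoly_eval_qconst of_rat_1 of_rat_minus mult_minus1 uminus_add_conv_diff
      add_uminus_conv_diff)

lemma qpoly_vars_denom_qpoly:
  assumes "1 \<le> n"
  shows "qpoly_vars (denom_qpoly n) \<subseteq> {..<4*n+4}"
proof -
  let ?V = "{..<4*n+4}"
  have v: "qpoly_vars (qvar i) \<subseteq> ?V" if "i < 4*n+4" for i using that by simp
  have c: "qpoly_vars (qconst r) \<subseteq> ?V" for r by simp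
  have p: "qpoly_vars (P ^ k) \<subseteq> ?V" if "qpoly_vars P \<subseteq> ?V" for P k
    using that qpoly_vars_power by blast
  have m: "qpoly_vars (P * Q) \<subseteq> ?V" if "qpoly_vars P \<subseteq> ?V" "qpoly_vars Q \<subseteq> ?V" for P Q
    using that qpoly_vars_mult by blast
  have a: "qpoly_vars (P + Q) \<subseteq> ?V" if "qpoly_vars P \<subseteq> ?V" "qpoly_vars Q \<subseteq> ?V" for P Q
    using that qpoly_vars_add by blast
  show ?thesis
    unfolding denom_qpoly_def by (intro m a p c v qpoly_vars_sum) (use assms in auto)
qed

text \<open>
  The numerators are those of the contraction of \<open>f du\<^sub>0 du\<^sub>1 \<dots>\<close> with the Euler field of
  \<open>u\<^sub>1, u\<^sub>2, \<dots>\<close>; the missing index \<open>j\<close> of \<open>I\<close> is recovered from its complement.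
\<close>

definition euler_form :: "nat \<Rightarrow> nat \<Rightarrow> qpoly \<Rightarrow> nat set \<Rightarrow> qpoly \<times> qpoly" where
  "euler_form n K P I =
     (let j = the_elem ({0..2*n+2} - I) in
       (if j = 0 then 0 else qconst ((- 1) ^ (j - 1)) * (qvar j * P), denom_qpoly n ^ K))"

lemma the_elem_complement: "j \<in> {0..m} \<Longrightarrow> the_elem ({0..m} - ({0..m} - {j})) = (j :: nat)"
  by (simp add: double_diff)

text \<open>At complex points, too, \<open>cleared_Q\<close> is \<alpha>^2 Q for nonzero \<alpha>,
  so the zeros of \<open>denom\<close> lie on u_0 = 0, u_0 = 1 and Q = 0.\<close>

lemma euler_form_algebraic:
  assumes n: "1 \<le> n" and P: "qpoly_vars P \<subseteq> {..<4*n+4}"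
  shows "algebraic_form n (euler_form n K P)"
  unfolding algebraic_form_def
proof (intro allI impI conjI)
  fix I :: "nat set" assume I: "I \<subseteq> {0..2*n+2} \<and> card I = 2*n+2"
  have "I \<in> {I. I \<subseteq> {0..2*n+2} \<and> card I = card {0..2*n+2} - 1}" using I by simp
  then obtain j where j: "j \<in> {0..2*n+2}" "I = {0..2*n+2} - {j}"
    unfolding subsets_of_codimension_one[OF finite_atLeastAtMost] by auto
  have el: "the_elem ({0..2*n+2} - I) = j" unfolding j(2) by (rule the_elem_complement[OF j(1)])
  have "qpoly_vars (qvar j * P) \<subseteq> {..<4*n+4}"
    using qpoly_vars_mult[of "qvar j" P] j(1) P by auto
  then have "qpoly_vars (qconst ((- 1) ^ (j - 1)) * (qvar j * P)) \<subseteq> {..<4*n+4}"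
    using qpoly_vars_mult[of "qconst ((- 1) ^ (j - 1))" "qvar j * P"] by auto
  then show "qpoly_vars (fst (euler_form n K P I)) \<subseteq> {..<4*n+4}"
    unfolding euler_form_def el Let_def by simp
  show "qpoly_vars (snd (euler_form n K P I)) \<subseteq> {..<4*n+4}"
    using qpoly_vars_power[of "denom_qpoly n" K] qpoly_vars_denom_qpoly[OF n] by (auto simp: euler_form_def Let_def)
  fix b u :: "nat \<Rightarrow> complex"
  assume *: "b 0 \<noteq> 0 \<and> u \<in> affine_space (2*n+3) - (CZ_hat n (b 0) \<union> H0 n \<union> H1 n)"
  let ?w = "join_vars n b u"
  have w: "?w i = u i" if "i \<le> 2*n+2" for i using that by (simp add: join_vars_def)
  have wb: "?w (2*n+3) = b 0" by (simp add: join_vars_def)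
  have sum: "(\<Sum>i=5..2*n+2. (?w i)\<^sup>2) = (\<Sum>i=5..2*n+2. (u i)\<^sup>2)"
    by (intro sum.cong) (auto simp: w)
  have "cleared_Q n ?w = (b 0)\<^sup>2 * Q_form n (b 0) u"
    unfolding cleared_Q_def sum wb Q_form_def using n * by (simp add: w field_simps)
  moreover have "Q_form n (b 0) u \<noteq> 0" "u 0 \<noteq> 0" "u 0 \<noteq> 1" using * by (auto simp: CZ_hat_def H0_def H1_def)
  ultimately have "denom n ?w \<noteq> 0" using * wb by (simp add: denom_def w)
  then show "qpoly_eval (snd (euler_form n K P I)) ?w \<noteq> 0"
    by (simp add: euler_form_def Let_def qpoly_eval_power qpoly_eval_denom_qpoly)
qed

text \<open>The chart of A is a graph over the coordinates other than u_1, with quadratic form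
  \<open>quad\<close> for fixed u_0. \<open>pullback_coeff_quadric_graph\<close> applies with l = 0,
  the component without du_0 being zero by construction.\<close>

lemma A_coeff_euler_form:
  assumes n: "1 \<le> n" and q: "quad (2*n+2) u0 y < 1"
  shows "A_coeff n (form_at n (euler_form n K P) b) u0 y = slice_kernel n K (qpoly_eval P) b 1 u0 y"
proof -
  let ?m = "2*n+2" and ?z = "y(0 := u0)" and ?\<omega> = "form_at n (euler_form n K P) b"
  let ?w = "graph_point n b 1 u0 y"
  have J: "{0} \<union> {2..?m} = {0..?m} - {1}" by auto
  have Q: "(\<Sum>i=2..?m. quad_coeff (?z 0) i * (?z i)\<^sup>2) = quad ?m u0 y"
    unfolding quad_def by (intro sum.cong) auto
  have join: "join_vars n b (A_chart n ?z) = ?w"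
  proof
    fix i
    consider "i = 1" | "i \<le> ?m" "i \<noteq> 1" | "i > ?m" by force
    then show "join_vars n b (A_chart n ?z) i = ?w i"
    proof cases
      case 1
      have "join_vars n b (A_chart n ?z) 1 = A_chart n ?z 1" by (simp add: join_vars_def)
      also have "\<dots> = ?w 1" unfolding A_chart_simps(1)[OF n] Q graph_point_simps(2) ..
      finally show ?thesis unfolding 1 .
    next
      case 2
      then show ?thesis using A_chart_simps(2)[OF n 2, of ?z] by (simp add: join_vars_def graph_point_def)
    qed (simp add: join_vars_def graph_point_def)
  qed
  let ?c = "qpoly_eval P ?w / denom n ?w ^ K"
  have \<omega>: "?\<omega> ({0..?m} - {j}) (A_chart n ?z) =
      (if j = 0 then 0 else (- 1) ^ (j - 1) * A_chart n ?z j * ?c)" if j: "j \<in> {0..?m}" for j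
  proof -
    have "?w j = A_chart n ?z j"
      unfolding join[symmetric] using j by (simp add: join_vars_def)
    then show ?thesis
      unfolding form_at_def euler_form_def the_elem_complement[OF j] Let_def join
      by (simp add: qpoly_eval_power qpoly_eval_denom_qpoly qpoly_eval_mult of_rat_power of_rat_minus)
  qed
  have "pullback_coeff {0..?m} ({0..?m} - {1}) (A_chart n) ?\<omega> ?z =
      (1 / sqrt (1 - (\<Sum>i=2..?m. quad_coeff (?z 0) i * (?z i)\<^sup>2))) *\<^sub>R ?c"
  proof (rule pullback_coeff_quadric_graph[where \<kappa>=quad_coeff and s=1 and l=0 and m="?m" and y="?z" and \<phi>="A_chart n"])
    show "A_chart n z 1 = 1 * sqrt (1 - (\<Sum>i=2..?m. quad_coeff (z 0) i * (z i)\<^sup>2))" for z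
      by (rule A_chart_simps(1)[OF n])
    show "A_chart n z i = z i" if "i \<in> {0..?m}" "i \<noteq> 1" for z i
      using A_chart_simps(2)[OF n _ that(2)] that(1) by simp
    show "?\<omega> ({0..?m} - {j}) (A_chart n ?z) = ((- 1) ^ (j - 1) * A_chart n ?z j) *\<^sub>R ?c" if "j \<in> {1..?m}" for j
      using \<omega>[of j] that by simp
    show "?\<omega> ({0..?m} - {0}) (A_chart n ?z) = 0" using \<omega>[of 0] by simp
    show "(\<Sum>i=2..?m. quad_coeff (?z 0) i * (?z i)\<^sup>2) < 1" unfolding Q by (rule q)
  qed auto
  then show ?thesis
    unfolding A_coeff_def J Q slice_kernel_def by simp
qed

lemma slice_integral_euler_form:
  assumes n: "1 \<le> n" and u0: "0 < u0" "u0 < 1"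
  shows "slice_integral n (form_at n (euler_form n K P) b) u0 =
    slice_total n K (qpoly_eval P) b u0"
  unfolding slice_integral_def A_slice_eq[OF n u0]
  by (intro set_integral_cong_on A_coeff_euler_form[OF n]) (auto simp: half_slice_def)

lemma slice_integrable_euler_form:
  assumes n: "1 \<le> n" and u0: "0 < u0" "u0 < 1" and b: "0 < b 0" and P: "qpoly_eval P \<in> polyfuns (4*n+4)"
  shows "slice_integrable n (form_at n (euler_form n K P) b) u0"
proof -
  have "set_integrable (slice_measure n) (half_slice n (slice_indices n) u0) (A_coeff n (form_at n (euler_form n K P) b) u0) \<longleftrightarrow>
      set_integrable (slice_measure n) (half_slice n (slice_indices n) u0) (slice_kernel n K (qpoly_eval P) b 1 u0)"
    by (intro set_integrable_cong_on A_coeff_euler_form[OF n]) (auto simp: half_slice_def)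
  moreover have "set_integrable (slice_measure n) (half_slice n (slice_indices n) u0) (slice_kernel n K (qpoly_eval P) b 1 u0)"
    by (rule slice_kernel_integrable[where b=b, OF n P _ u0 b]) (auto simp: slice_indices_def)
  ultimately show ?thesis
    unfolding slice_integrable_def A_slice_eq[OF n u0] by blast
qed

lemma half_slice_integral_measurable:
  assumes n: "1 \<le> n" and P: "P \<in> polyfuns (4*n+4)"
  shows "slice_total n K P b \<in> borel_measurable borel"
proof -
  interpret finite_product_sigma_finite "\<lambda>_ :: nat. lborel :: real measure" "{2..2*n+2}"
    by (intro finite_product_sigma_finite.intro product_sigma_finite_lborel) (unfold_locales, simp)
  show ?thesis
    unfolding set_lebesgue_integral_def
    by (rule borel_measurable_lebesgue_integral)
       (rule half_slice_kernel_measurable[OF n P], auto simp: slice_indices_def)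
qed

section \<open>The integrals over u_0, the angles and the torus\<close>

text \<open>No integrability is assumed: both integrands are integrable or neither is, and in the
  latter case both integrals have the default value 0. The change of variables is available for the
  completed measure and the absolute value of the Jacobian, which explains the passage through
  \<open>lebesgue\<close> and the use of positivity.\<close>

lemma sin_sq_substitution:
  fixes f :: "real \<Rightarrow> real"
  assumes f: "f \<in> borel_measurable borel"
  shows "set_integrable lborel {0<..<pi/2} (\<lambda>\<eta>. 2 * sin \<eta> * cos \<eta> * f ((sin \<eta>)\<^sup>2)) \<longleftrightarrow> set_integrable lborel {0<..<1} f"
    and "(LINT \<eta> : {0<..<pi/2} | lborel. 2 * sin \<eta> * cos \<eta> * f ((sin \<eta>)\<^sup>2)) = (LINT u : {0<..<1} | lborel. f u)"
proof -
  let ?g = "\<lambda>\<eta> :: real. (sin \<eta>)\<^sup>2" and ?I = "{0<..<pi/2} :: real set"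
  have pos: "0 < sin \<eta>" "0 < cos \<eta>" if "\<eta> \<in> ?I" for \<eta>
    using that by (auto intro: sin_gt_zero cos_gt_zero)
  have inj: "inj_on ?g ?I"
  proof (rule inj_onI)
    fix x y assume xy: "x \<in> ?I" "y \<in> ?I" "(sin x)\<^sup>2 = (sin y)\<^sup>2"
    then have "sin x = sin y" using pos(1)[OF xy(1)] pos(1)[OF xy(2)] by (simp add: power2_eq_iff)
    then show "x = y" using xy sin_inj_pi[of x y] by auto
  qed
  have img: "?g ` ?I = {0<..<1}"
  proof (intro equalityI subsetI)
    fix u assume "u \<in> ?g ` ?I"
    then obtain \<eta> where \<eta>: "\<eta> \<in> ?I" "u = (sin \<eta>)\<^sup>2" by blast
    have "(cos \<eta>)\<^sup>2 > 0" "(sin \<eta>)\<^sup>2 > 0" using pos[OF \<eta>(1)] by simp_all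
    then have "0 < u \<and> u < 1" using \<eta>(2) sin_cos_squared_add[of \<eta>] by linarith
    then show "u \<in> {0<..<1}" by simp
  next
    fix u :: real assume u: "u \<in> {0<..<1}"
    let ?s = "sqrt u"
    have s: "0 < ?s" "?s < 1" using u by auto
    have "arcsin 0 < arcsin ?s" "arcsin ?s < arcsin 1" using s by (intro arcsin_less_arcsin; linarith)+
    then have "arcsin ?s \<in> ?I" by simp
    moreover have "sin (arcsin ?s) = ?s" using s by (intro sin_arcsin; linarith)
    then have "u = (sin (arcsin ?s))\<^sup>2" using u by simp
    ultimately show "u \<in> ?g ` ?I" by blast
  qed
  have der: "(?g has_field_derivative 2 * sin \<eta> * cos \<eta>) (at \<eta> within ?I)" for \<eta>
    by (auto intro!: derivative_eq_intros)
  have cov: "(\<lambda>\<eta>. \<bar>2 * sin \<eta> * cos \<eta>\<bar> * f (?g \<eta>)) absolutely_integrable_on ?I \<and>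
      integral ?I (\<lambda>\<eta>. \<bar>2 * sin \<eta> * cos \<eta>\<bar> * f (?g \<eta>)) = c \<longleftrightarrow>
      f absolutely_integrable_on {0<..<1} \<and> integral {0<..<1} f = c" for c
    using has_absolute_integral_change_of_variables_1'[OF _ der inj, of f c] unfolding img by simp
  have nonneg: "\<bar>2 * sin \<eta> * cos \<eta>\<bar> = 2 * sin \<eta> * cos \<eta>" if "\<eta> \<in> ?I" for \<eta>
    using pos[OF that] by (intro abs_of_nonneg) simp
  let ?h = "\<lambda>\<eta>. 2 * sin \<eta> * cos \<eta> * f (?g \<eta>)"
  have h: "?h \<in> borel_measurable borel" using f by measurable
  have lebesgue: "set_integrable lborel {a<..<c} F \<longleftrightarrow> F absolutely_integrable_on {a<..<c}"
    "(LINT x : {a<..<c} | lborel. F x) = (LINT x : {a<..<c} | lebesgue. F x)"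
    if "F \<in> borel_measurable borel" for F :: "real \<Rightarrow> real" and a c
    unfolding set_integrable_def set_lebesgue_integral_def using that
    by (simp_all add: integrable_completion integral_completion)
  have abs: "(\<lambda>\<eta>. \<bar>2 * sin \<eta> * cos \<eta>\<bar> * f (?g \<eta>)) absolutely_integrable_on ?I \<longleftrightarrow> ?h absolutely_integrable_on ?I"
    by (intro set_integrable_cong_on refl) (simp only: nonneg)
  have int: "integral ?I (\<lambda>\<eta>. \<bar>2 * sin \<eta> * cos \<eta>\<bar> * f (?g \<eta>)) = integral ?I ?h"
    by (intro Henstock_Kurzweil_Integration.integral_cong) (simp only: nonneg)
  show iff: "set_integrable lborel ?I ?h \<longleftrightarrow> set_integrable lborel {0<..<1} f"
    unfolding lebesgue(1)[OF h] lebesgue(1)[OF f] abs[symmetric] using cov by blast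
  show "(LINT \<eta> : ?I | lborel. ?h \<eta>) = (LINT u : {0<..<1} | lborel. f u)"
  proof (cases "set_integrable lborel {0<..<1} f")
    case True
    then have fa: "f absolutely_integrable_on {0<..<1}" by (simp only: lebesgue(1)[OF f])
    have ha: "?h absolutely_integrable_on ?I" using True iff by (simp only: lebesgue(1)[OF h])
    have "integral ?I ?h = integral {0<..<1} f" using cov[of "integral {0<..<1} f"] fa int by metis
    then show ?thesis
      unfolding lebesgue(2)[OF h] lebesgue(2)[OF f]
      by (simp only: set_lebesgue_integral_eq_integral(2)[OF fa] set_lebesgue_integral_eq_integral(2)[OF ha])
  next
    case False
    then have "\<not> set_integrable lborel ?I ?h" using iff by blast
    with False show ?thesis
      unfolding set_integrable_def set_lebesgue_integral_def
      by (simp only: not_integrable_integral_eq simp_thms)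
  qed
qed

text \<open>\<open>A\<close> may differ from the measurable set outside the space: the cube in
  \<open>eta_density\<close> is a set of arbitrary functions, whereas the product space contains
  only extensional ones.\<close>

lemma set_integral_const_on:
  fixes c :: "'b::{banach, second_countable_topology}"
  assumes "A' \<in> sets M" "emeasure M A' < \<infinity>" "\<And>x. x \<in> space M \<Longrightarrow> x \<in> A \<longleftrightarrow> x \<in> A'"
  shows "(LINT x : A | M. c) = measure M A' *\<^sub>R c"
proof -
  have "(LINT x : A | M. c) = (LINT x : A' | M. c)"
    using assms(3) by (intro set_integral_cong_on) auto
  also have "\<dots> = (\<integral>x. indicator A' x \<partial>M) *\<^sub>R c"
    unfolding set_lebesgue_integral_def using assms(1,2)
    by (intro Bochner_Integration.integral_scaleR_left) simp
  finally show ?thesis using assms(1) by simp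
qed

text \<open>The angles contribute (2 \<pi>)^2 and the torus its volume 1, which for n = 1 is an
  empty product.\<close>

lemma eta_density_const:
  assumes c: "\<And>x. x 1 = t \<Longrightarrow> x 2 = \<eta> \<Longrightarrow> trace_sphere_integral a n x = c"
  shows "eta_density a n t \<eta> = (4 * pi\<^sup>2) *\<^sub>R c"
proof -
  let ?I = "{5..2*n+2}" and ?A = "{0..<1} :: real set"
  have em: "emeasure (PiM ?I (\<lambda>_. lborel)) (PiE ?I (\<lambda>_. ?A)) = 1"
  proof -
    have "emeasure (PiM ?I (\<lambda>_. lborel)) (PiE ?I (\<lambda>_. ?A)) = (\<Prod>i\<in>?I. emeasure lborel ?A)"
      by (rule product_sigma_finite.emeasure_PiM[OF product_sigma_finite_lborel]) auto
    then show ?thesis by simp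
  qed
  have cube: "(LINT x' : {x'. \<forall>i\<in>?I. 0 \<le> x' i \<and> x' i < 1} | PiM ?I (\<lambda>_. lborel :: real measure). c) = c"
  proof -
    have "(LINT x' : {x'. \<forall>i\<in>?I. 0 \<le> x' i \<and> x' i < 1} | PiM ?I (\<lambda>_. lborel :: real measure). c) =
        measure (PiM ?I (\<lambda>_. lborel)) (PiE ?I (\<lambda>_. ?A)) *\<^sub>R c"
    proof (rule set_integral_const_on)
      show "PiE ?I (\<lambda>_. ?A) \<in> sets (PiM ?I (\<lambda>_. lborel))" by (intro sets_PiM_I_finite) auto
      show "emeasure (PiM ?I (\<lambda>_. lborel)) (PiE ?I (\<lambda>_. ?A)) < \<infinity>" unfolding em by simp
    qed (auto simp: space_PiM PiE_iff)
    then show ?thesis unfolding measure_def em by simp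
  qed
  have interval: "(LINT \<phi> : {0<..<2*pi} | lborel. d) = (2 * pi) *\<^sub>R d" for d :: complex
    by (subst set_integral_const_on[of "{0<..<2*pi}"]) auto
  have inner: "trace_sphere_integral a n (x'(1 := t, 2 := \<eta>, 3 := \<phi>1, 4 := \<phi>2)) = c" for x' \<phi>1 \<phi>2
    by (rule c) auto
  show ?thesis
    unfolding eta_density_def inner cube interval by (simp add: power2_eq_square)
qed

theorem theorem6p2:
  fixes n :: nat
  assumes "n \<ge> 1"
  shows "Q_semialgebraic (2*n+3) (A_set n) \<and>
    (\<exists>(C :: real) \<Omega>. algebraic_form n \<Omega> \<and>
      (\<forall>(a :: real \<Rightarrow> real) T t.
         open T \<and> (\<forall>k. (deriv ^^ k) a differentiable_on T) \<and> (\<forall>s\<in>T. a s > 0) \<and> t \<in> T \<longrightarrow>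
         (let \<omega> = form_at n \<Omega> (\<lambda>i. (deriv ^^ i) a t) in
            (\<forall>u0\<in>{0<..<1}. slice_integrable n \<omega> u0) \<and>
            (set_integrable lborel {0<..<1} (slice_integral n \<omega>) \<longleftrightarrow>
             set_integrable lborel {0<..<pi/2} (eta_density a n t)) \<and>
            heat_coeff a n t = complex_of_real (C * A_integral n \<omega>))))"
proof -
  obtain K P where P: "P \<in> polyfuns (4*n+4)" and sphere: "\<And>a T x. open T \<Longrightarrow> \<forall>k. (deriv ^^ k) a differentiable_on T \<Longrightarrow>
      \<forall>s\<in>T. a s > 0 \<Longrightarrow> x 1 \<in> T \<Longrightarrow> 0 < x 2 \<Longrightarrow> x 2 < pi/2 \<Longrightarrow>
    trace_sphere_integral a n x =
    complex_of_real (sin (x 2) * cos (x 2) *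
      slice_total n K P (\<lambda>i. (deriv ^^ i) a (x 1)) ((sin (x 2))\<^sup>2))"
    using sphere_trace_integral[OF assms] by blast
  obtain R where R: "qpoly_vars R \<subseteq> {..<4*n+4}" "qpoly_eval R = P"
    using polyfuns_qpoly[OF P] by blast
  \<comment> \<open>Of the angular factor 4 \<pi>^2, a factor 2 is absorbed in du_0 = 2 sin \<eta>
    cos \<eta> d\<eta>.\<close>
  define C where "C = 1 / (2^5 * pi^(3+n)) * (2 * pi\<^sup>2)"
  let ?\<Omega> = "euler_form n K R"
  have main: "(\<forall>u0\<in>{0<..<1}. slice_integrable n \<omega> u0) \<and>
      (set_integrable lborel {0<..<1} (slice_integral n \<omega>) \<longleftrightarrow> set_integrable lborel {0<..<pi/2} (eta_density a n t)) \<and>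
      heat_coeff a n t = complex_of_real (C * A_integral n \<omega>)"
    if T: "open T" "\<forall>k. (deriv ^^ k) a differentiable_on T" "\<forall>s\<in>T. a s > 0" "t \<in> T"
      and \<omega>: "\<omega> = form_at n ?\<Omega> (\<lambda>i. (deriv ^^ i) a t)" for a T t \<omega>
  proof -
    let ?b = "\<lambda>i. (deriv ^^ i) a t" and ?I = "{0<..<pi/2} :: real set"
    have b: "0 < ?b 0" using T by simp
    \<comment> \<open>\<open>J\<close> is measurable on the whole line, as the substitution demands,
      and agrees with \<open>slice_integral\<close> on (0, 1), where the slices of A have been
      identified.\<close>
    define J where "J u0 = slice_total n K P ?b u0" for u0
    have J: "J \<in> borel_measurable borel"
      unfolding J_def by (rule half_slice_integral_measurable[OF assms P])
    have slice: "slice_integral n \<omega> u0 = J u0" if "u0 \<in> {0<..<1}" for u0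
      using slice_integral_euler_form[OF assms, of u0 K R ?b] that by (simp add: \<omega> J_def R(2))
    have eta: "eta_density a n t \<eta> = complex_of_real (2 * pi\<^sup>2 * (2 * sin \<eta> * cos \<eta> * J ((sin \<eta>)\<^sup>2)))" if "\<eta> \<in> ?I" for \<eta>
    proof -
      have "eta_density a n t \<eta> = (4 * pi\<^sup>2) *\<^sub>R complex_of_real (sin \<eta> * cos \<eta> * J ((sin \<eta>)\<^sup>2))"
      proof (rule eta_density_const)
        fix x :: "nat \<Rightarrow> real" assume x: "x 1 = t" "x 2 = \<eta>"
        show "trace_sphere_integral a n x =
            complex_of_real (sin \<eta> * cos \<eta> * J ((sin \<eta>)\<^sup>2))"
          using sphere[of T a x] T that unfolding x J_def by simp
      qed
      then show ?thesis by (simp add: scaleR_conv_of_real)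
    qed
    have "set_integrable lborel {0<..<1} (slice_integral n \<omega>) \<longleftrightarrow> set_integrable lborel {0<..<1} J"
      by (intro set_integrable_cong_on slice) auto
    also have "\<dots> \<longleftrightarrow> set_integrable lborel ?I (\<lambda>\<eta>. 2 * sin \<eta> * cos \<eta> * J ((sin \<eta>)\<^sup>2))"
      by (rule sin_sq_substitution(1)[OF J, symmetric])
    also have "\<dots> \<longleftrightarrow> set_integrable lborel ?I (\<lambda>\<eta>. 2 * pi\<^sup>2 * (2 * sin \<eta> * cos \<eta> * J ((sin \<eta>)\<^sup>2)))"
      using set_integrable_mult_right_iff[of "2 * pi\<^sup>2" lborel ?I "\<lambda>\<eta>. 2 * sin \<eta> * cos \<eta> * J ((sin \<eta>)\<^sup>2)"] by simp
    also have "\<dots> \<longleftrightarrow> set_integrable lborel ?I (\<lambda>\<eta>. complex_of_real (2 * pi\<^sup>2 * (2 * sin \<eta> * cos \<eta> * J ((sin \<eta>)\<^sup>2))))"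
      unfolding set_integrable_def
      by (subst complex_of_real_integrable_eq[symmetric]) (simp add: scaleR_conv_of_real)
    also have "\<dots> \<longleftrightarrow> set_integrable lborel ?I (eta_density a n t)"
      by (intro set_integrable_cong_on eta[symmetric]) auto
    finally have iff: "set_integrable lborel {0<..<1} (slice_integral n \<omega>) \<longleftrightarrow> set_integrable lborel ?I (eta_density a n t)" .
    have "(LINT \<eta> : ?I | lborel. eta_density a n t \<eta>) =
        (LINT \<eta> : ?I | lborel. complex_of_real (2 * pi\<^sup>2 * (2 * sin \<eta> * cos \<eta> * J ((sin \<eta>)\<^sup>2))))"
      by (intro set_integral_cong_on eta) auto
    also have "\<dots> = complex_of_real (LINT \<eta> : ?I | lborel. 2 * pi\<^sup>2 * (2 * sin \<eta> * cos \<eta> * J ((sin \<eta>)\<^sup>2)))"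
      by (rule set_integral_complex_of_real)
    also have "(LINT \<eta> : ?I | lborel. 2 * pi\<^sup>2 * (2 * sin \<eta> * cos \<eta> * J ((sin \<eta>)\<^sup>2))) =
        2 * pi\<^sup>2 * (LINT \<eta> : ?I | lborel. 2 * sin \<eta> * cos \<eta> * J ((sin \<eta>)\<^sup>2))"
      by (rule set_integral_mult_right)
    also have "(LINT \<eta> : ?I | lborel. 2 * sin \<eta> * cos \<eta> * J ((sin \<eta>)\<^sup>2)) = (LINT u0 : {0<..<1} | lborel. J u0)"
      by (rule sin_sq_substitution(2)[OF J])
    also have "\<dots> = A_integral n \<omega>"
      unfolding A_integral_def by (intro set_integral_cong_on slice[symmetric]) auto
    finally have "heat_coeff a n t = complex_of_real (C * A_integral n \<omega>)"
      unfolding heat_coeff_def C_def by (simp only: of_real_mult mult.assoc)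
    moreover have "\<forall>u0\<in>{0<..<1}. slice_integrable n \<omega> u0"
      unfolding \<omega> using slice_integrable_euler_form[OF assms, where b="?b" and P=R and K=K] b P R(2) by simp
    ultimately show ?thesis using iff by blast
  qed
  show ?thesis
    unfolding Let_def
  proof (intro conjI exI allI impI)
    show "Q_semialgebraic (2*n+3) (A_set n)" by (rule Q_semialgebraic_A_set[OF assms])
    show "algebraic_form n ?\<Omega>" by (rule euler_form_algebraic[OF assms R(1)])
  qed (use main in blast)+
qed

end
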